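(* Let $(\mathcal G,\wedge,[\ ,\ ])$ be a Gerstenhaber algebra and let $\mathcal H=\underline\bigotimes^+(\mathcal G[1])$ be equipped with the bracket $[\ ,\ ]$ and the operator $\mu$ defined in the context. Then $(\mathcal H,[\ ,\ ],\mu)$ is a differential graded Lie algebra: for all homogeneous $\alpha,\beta,\gamma\in\mathcal H$ of degrees $a,b,c$, (i) $[\alpha,\beta]=-(-1)^{ab}[\beta,\alpha]$; (ii) $(-1)^{ac}[[\alpha,\beta],\gamma]+(-1)^{ba}[[\beta,\gamma],\alpha]+(-1)^{cb}[[\gamma,\alpha],\beta]=0$; (iii) $\mu([\alpha,\beta])=[\mu(\alpha),\beta]+(-1)^a[\alpha,\mu(\beta)]$.
   Context: Vector spaces are $\mathbb Z$-graded over a field of characteristic $0$. A Gerstenhaber algebra is a graded vector space $\mathcal G$ with an associative product $\wedge$ of degree $0$, $\alpha\wedge\beta=(-1)^{|\alpha||\beta|}\beta\wedge\alpha$, and a bracket $[\ ,\ ]$ of degree $-1$ such that $(\mathcal G[1],[\ ,\ ])$ is a graded Lie algebra and $[\alpha,\beta\wedge\gamma]=[\alpha,\beta]\wedge\gamma+(-1)^{|\beta|(|\alpha|-1)}\beta\wedge[\alpha,\gamma]$. $V[1]$ is $V$ with degrees lowered by $1$; for $\alpha_i\in\mathcal G$, $a_i=|\alpha_i|-1$ is its degree in $\mathcal G[1]$. Koszul sign: $\varepsilon\binom{a_1\dots a_n}{a_{i_1}\dots a_{i_n}}$ is the sign of the graded permutation, where exchanging adjacent elements of degrees $x,y$ costs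 $(-1)^{xy}$. $Bat(p,q)$ is the set of permutations $\sigma$ of $\{1,\dots,p+q\}$ with $\sigma(1)<\dots<\sigma(p)$ and $\sigma(p+1)<\dots<\sigma(p+q)$, and $$bat_{p,q}(\alpha_1\otimes\dots\otimes\alpha_p,\alpha_{p+1}\otimes\dots\otimes\alpha_{p+q})=\sum_{\sigma\in Bat(p,q)}\varepsilon\binom{a_1\dots a_{p+q}}{a_{\sigma^{-1}(1)}\dots a_{\sigma^{-1}(p+q)}}\alpha_{\sigma^{-1}(1)}\otimes\dots\otimes\alpha_{\sigma^{-1}(p+q)}.$$ $\underline\bigotimes^n(\mathcal G[1])$ is the quotient of $(\mathcal G[1])^{\otimes n}$ by the sum of the images of $bat_{p,n-p}$, $0<p<n$; the class of $\alpha_1\otimes\dots\otimes\alpha_n$ is $\alpha_1\underline\otimes\dots\underline\otimes\alpha_n$, of degree $a_1+\dots+a_n$; $\mathcal H=\underline\bigotimes^+(\mathcal G[1])=\bigoplus_{n\ge1}\underline\bigotimes^n(\mathcal G[1])$. With $\mu_2(\alpha,\beta)=(-1)^a\alpha\wedge\beta$ ($a$ the degree of $\alpha$ in $\mathcal G[1]$), $$\mu(\alpha_1\underline\otimes\dots\underline\otimes\alpha_n)=\sum_{0<j<n}(-1)^{a_1+\dots+a_{j-1}}\alpha_1\underline\otimes\dots\underline\otimes\alpha_{j-1}\underline\otimes\mu_2(\alpha_j,\alpha_{j+1})\underline\otimes\alpha_{j+2}\underline\otimes\dots\underline\otimes\alpha_n,$$ $$[\alpha_1\underline\otimes\dots\underline\otimes\alpha_p,\alpha_{p+1}\underline\otimes\dots\underline\otimes\alpha_{p+q}]=\sum_{\sigma,k}\varepsilon\binom{a_1\dots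 a_{p+q}}{a_{\sigma^{-1}(1)}\dots a_{\sigma^{-1}(p+q)}}\alpha_{\sigma^{-1}(1)}\underline\otimes\dots\underline\otimes[\alpha_{\sigma^{-1}(k)},\alpha_{\sigma^{-1}(k+1)}]\underline\otimes\dots\underline\otimes\alpha_{\sigma^{-1}(p+q)},$$ the sum being over $\sigma\in Bat(p,q)$ and $k$ with $\sigma^{-1}(k)\le p<\sigma^{-1}(k+1)$. Both are well defined on the quotient; $\mu$ has degree $1$, satisfies $\mu\circ\mu=0$, and the bracket has degree $0$. *)

theory Defs
  imports Complex_Main "HOL-Combinatorics.Permutations" "HOL-Library.Poly_Mapping"
    "HOL-Algebra.Module"
begin

section \<open>Graded vector spaces and graded Lie algebras\<close>

text \<open>The scalars form a type of class \<open>field_char_0\<close>. This record presents them to the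
  HOL-Algebra notion of module; a vector space is a module over it. The fields \<open>mult\<close>
  and \<open>one\<close> of a module record play no role.\<close>

definition scalars :: "'k::field_char_0 ring" where
  "scalars = \<lparr>carrier = UNIV, mult = (*), one = 1, zero = 0, add = (+)\<rparr>"

locale graded_vector_space = Module.module scalars V
  for V :: "('k::field_char_0, 'v) module" (structure) +
  fixes grade :: "int \<Rightarrow> 'v set"
  assumes grade_submodule: "submodule (grade i) scalars V"
    and decomposition: "x \<in> carrier V \<Longrightarrow>
      \<exists>!f. (\<forall>i. f i \<in> grade i) \<and> finite {i. f i \<noteq> \<zero>\<^bsub>V\<^esub>} \<and>
        x = finsum V f {i. f i \<noteq> \<zero>\<^bsub>V\<^esub>}"

definition linear_operator :: "('k::field_char_0, 'v) module \<Rightarrow> ('v \<Rightarrow> 'v) \<Rightarrow> bool" where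
  "linear_operator V f \<longleftrightarrow>
    (\<forall>x\<in>carrier V. f x \<in> carrier V) \<and>
    (\<forall>x\<in>carrier V. \<forall>y\<in>carrier V. f (x \<oplus>\<^bsub>V\<^esub> y) = f x \<oplus>\<^bsub>V\<^esub> f y) \<and>
    (\<forall>c. \<forall>x\<in>carrier V. f (c \<odot>\<^bsub>V\<^esub> x) = c \<odot>\<^bsub>V\<^esub> f x)"

definition bilinear_operation :: "('k::field_char_0, 'v) module \<Rightarrow> ('v \<Rightarrow> 'v \<Rightarrow> 'v) \<Rightarrow> bool"
  where
  "bilinear_operation V b \<longleftrightarrow>
    (\<forall>x\<in>carrier V. linear_operator V (b x)) \<and>
    (\<forall>y\<in>carrier V. linear_operator V (\<lambda>x. b x y))"

locale graded_lie_algebra = graded_vector_space V grade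
  for V :: "('k::field_char_0, 'v) module" (structure) and grade +
  fixes br :: "'v \<Rightarrow> 'v \<Rightarrow> 'v"
  assumes br_bilinear: "bilinear_operation V br"
    and br_degree: "\<lbrakk>x \<in> grade a; y \<in> grade b\<rbrakk> \<Longrightarrow> br x y \<in> grade (a + b)"
    and br_antisym: "\<lbrakk>x \<in> grade a; y \<in> grade b\<rbrakk> \<Longrightarrow>
      br x y = (- ((-1) powi (a * b))) \<odot>\<^bsub>V\<^esub> br y x"
    and br_jacobi: "\<lbrakk>x \<in> grade a; y \<in> grade b; z \<in> grade c\<rbrakk> \<Longrightarrow>
      (-1) powi (a * c) \<odot>\<^bsub>V\<^esub> br (br x y) z
      \<oplus>\<^bsub>V\<^esub> (-1) powi (b * a) \<odot>\<^bsub>V\<^esub> br (br y z) x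
      \<oplus>\<^bsub>V\<^esub> (-1) powi (c * b) \<odot>\<^bsub>V\<^esub> br (br z x) y = \<zero>\<^bsub>V\<^esub>"

locale dg_lie_algebra = graded_lie_algebra V grade br
  for V :: "('k::field_char_0, 'v) module" (structure) and grade br +
  fixes d :: "'v \<Rightarrow> 'v"
  assumes d_linear: "linear_operator V d"
    and d_degree: "x \<in> grade a \<Longrightarrow> d x \<in> grade (a + 1)"
    and d_square: "x \<in> carrier V \<Longrightarrow> d (d x) = \<zero>\<^bsub>V\<^esub>"
    and d_derivation: "\<lbrakk>x \<in> grade a; y \<in> grade b\<rbrakk> \<Longrightarrow>
      d (br x y) = br (d x) y \<oplus>\<^bsub>V\<^esub> (-1) powi a \<odot>\<^bsub>V\<^esub> br x (d y)"

text \<open>The homogeneous components of \<open>V[1]\<close>.\<close>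

definition shift :: "(int \<Rightarrow> 'v set) \<Rightarrow> int \<Rightarrow> 'v set" where
  "shift grade a = grade (a + 1)"

text \<open>That the bracket has degree \<open>-1\<close> on \<open>V\<close> is the statement that it has degree \<open>0\<close>
  on \<open>V[1]\<close>, hence is contained in \<open>shifted_lie\<close>.\<close>

locale gerstenhaber_algebra = graded_vector_space V grade
  for V :: "('k::field_char_0, 'v) module" (structure) and grade +
  fixes wedge :: "'v \<Rightarrow> 'v \<Rightarrow> 'v"
    and br :: "'v \<Rightarrow> 'v \<Rightarrow> 'v"
  assumes wedge_bilinear: "bilinear_operation V wedge"
    and wedge_degree: "\<lbrakk>x \<in> grade i; y \<in> grade j\<rbrakk> \<Longrightarrow> wedge x y \<in> grade (i + j)"
    and wedge_assoc: "\<lbrakk>x \<in> carrier V; y \<in> carrier V; z \<in> carrier V\<rbrakk> \<Longrightarrow>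
      wedge (wedge x y) z = wedge x (wedge y z)"
    and wedge_commute: "\<lbrakk>x \<in> grade i; y \<in> grade j\<rbrakk> \<Longrightarrow>
      wedge x y = (-1) powi (i * j) \<odot>\<^bsub>V\<^esub> wedge y x"
    and shifted_lie: "graded_lie_algebra V (shift grade) br"
    and leibniz: "\<lbrakk>x \<in> grade i; y \<in> grade j; z \<in> grade k\<rbrakk> \<Longrightarrow>
      br x (wedge y z) = wedge (br x y) z \<oplus>\<^bsub>V\<^esub> (-1) powi (j * (i - 1)) \<odot>\<^bsub>V\<^esub> wedge y (br x z)"


section \<open>Shuffles and Koszul signs\<close>

text \<open>Positions are numbered from \<open>0\<close>: the sets \<open>{1,...,p}\<close> and \<open>{p+1,...,p+q}\<close> become
  \<open>{..<p}\<close> and \<open>{p..<p+q}\<close>.\<close>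

definition Bat :: "nat \<Rightarrow> nat \<Rightarrow> (nat \<Rightarrow> nat) set" where
  "Bat p q = {\<sigma>. \<sigma> permutes {..<p + q} \<and>
     strict_mono_on {..<p} \<sigma> \<and> strict_mono_on {p..<p + q} \<sigma>}"

text \<open>The sign of the rearrangement of elements of degrees \<open>as ! 0, as ! 1, ...\<close> into the
  order \<open>\<pi> 0, \<pi> 1, ...\<close>: every pair that changes its relative order is exchanged once. The
  two lemmas after the definition show that this is the sign generated by exchanges of adjacent
  elements.\<close>

definition koszul :: "int list \<Rightarrow> (nat \<Rightarrow> nat) \<Rightarrow> 'k::field_char_0" where
  "koszul as \<pi> = (\<Prod>(k, l) | k < l \<and> l < length as \<and> \<pi> l < \<pi> k. (-1) powi (as ! \<pi> k * as ! \<pi> l))"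

lemma koszul_id: "koszul as id = 1"
proof -
  have "{(k, l). k < l \<and> l < length as \<and> id l < id k} = {}" by auto
  then show ?thesis unfolding koszul_def by (simp only: prod.empty)
qed

lemma koszul_adjacent:
  assumes \<pi>: "inj_on \<pi> {..<length as}" and m: "Suc m < length as"
  shows "(koszul as (\<pi> \<circ> transpose m (Suc m)) :: 'k::field_char_0) =
    (-1) powi (as ! \<pi> m * as ! \<pi> (Suc m)) * koszul as \<pi>"
proof -
  define n where "n = length as"
  define I where "I \<rho> = {(k, l). k < l \<and> l < n \<and> \<rho> l < \<rho> k}" for \<rho> :: "nat \<Rightarrow> nat"
  define t where "t = transpose m (Suc m)"
  define T where "T = (\<lambda>(k, l). (t k, t l))"
  define f :: "(nat \<Rightarrow> nat) \<Rightarrow> nat \<times> nat \<Rightarrow> 'k"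
    where "f \<rho> = (\<lambda>(k, l). (-1) powi (as ! \<rho> k * as ! \<rho> l))" for \<rho>
  have koszul: "koszul as \<rho> = prod (f \<rho>) (I \<rho>)" for \<rho>
    by (simp add: koszul_def f_def I_def n_def)
  have fin: "finite (I \<rho>)" for \<rho>
    by (rule finite_subset[of _ "{..<n} \<times> {..<n}"]) (auto simp: I_def)
  let ?e = "(m, Suc m)"
  have tm: "t m = Suc m" "t (Suc m) = m" and tid: "k \<noteq> m \<Longrightarrow> k \<noteq> Suc m \<Longrightarrow> t k = k" for k
    by (auto simp: t_def transpose_def)
  have tt: "t (t k) = k" for k by (simp add: t_def)
  have T_ord: "t k < t l" "t l < n" if "k < l" "l < n" "(k, l) \<noteq> ?e" for k l
    using that m by (auto simp: t_def transpose_def n_def)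
  have T_ne: "(t k, t l) \<noteq> ?e" if "k < l" for k l
  proof
    assume "(t k, t l) = ?e"
    then have "t (t k) = Suc m" "t (t l) = m" by (simp_all add: tm)
    then show False using that by (simp add: tt)
  qed
  have base: "prod (f (\<pi> \<circ> t)) (I (\<pi> \<circ> t) - {?e}) = prod (f \<pi>) (I \<pi> - {?e})"
  proof (rule prod.reindex_bij_witness[where i = T and j = T])
    fix e assume "e \<in> I (\<pi> \<circ> t) - {?e}"
    then show "T (T e) = e" "T e \<in> I \<pi> - {?e}" "f \<pi> (T e) = f (\<pi> \<circ> t) e"
      using T_ord T_ne by (auto simp: T_def I_def f_def tt)
  next
    fix e assume "e \<in> I \<pi> - {?e}"
    then show "T (T e) = e" "T e \<in> I (\<pi> \<circ> t) - {?e}"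
      using T_ord T_ne by (auto simp: T_def I_def tt)
  qed
  define s :: 'k where "s = (-1) powi (as ! \<pi> m * as ! \<pi> (Suc m))"
  have s: "f (\<pi> \<circ> t) ?e = s" "f \<pi> ?e = s" "s * s = 1"
    by (simp_all add: f_def s_def tm mult.commute power_int_minus_left)
  have split: "prod (f \<rho>) (I \<rho>) = (if ?e \<in> I \<rho> then f \<rho> ?e else 1) * prod (f \<rho>) (I \<rho> - {?e})"
    for \<rho>
    using prod.remove[OF fin, of ?e \<rho> "f \<rho>"] by simp
  have "\<pi> m \<noteq> \<pi> (Suc m)"
    using inj_onD[OF \<pi>, of m "Suc m"] m by auto
  then have e: "?e \<in> I (\<pi> \<circ> t) \<longleftrightarrow> ?e \<notin> I \<pi>"
    using m by (auto simp: I_def tm n_def)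
  have "prod (f (\<pi> \<circ> t)) (I (\<pi> \<circ> t)) = s * prod (f \<pi>) (I \<pi>)"
  proof (cases "?e \<in> I \<pi>")
    case True
    then have "prod (f (\<pi> \<circ> t)) (I (\<pi> \<circ> t)) = (s * s) * prod (f \<pi>) (I \<pi> - {?e})"
      using split[of "\<pi> \<circ> t"] e s base by simp
    moreover have "s * prod (f \<pi>) (I \<pi>) = (s * s) * prod (f \<pi>) (I \<pi> - {?e})"
      unfolding split[of \<pi>] using True by (simp add: s(2) mult.assoc)
    ultimately show ?thesis by (rule trans[OF _ sym])
  next
    case False
    then show ?thesis
      using split[of "\<pi> \<circ> t"] split[of \<pi>] e s base by (simp only: if_True if_False not_False_eq_True mult_1_left)
  qed
  then show ?thesis
    by (simp only: koszul s_def t_def)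
qed


section \<open>The space \<open>H\<close>\<close>

text \<open>A letter \<open>(a, x)\<close> is an element \<open>x\<close> of degree \<open>a\<close> in \<open>V[1]\<close>, and a word stands for
  the tensor product of its letters. As the tensor powers of \<open>V[1]\<close> are the direct sums of
  the tensor products of its homogeneous components, they are the quotient of the vector space
  freely generated by the words by multilinearity in each letter, for fixed degrees.\<close>

type_synonym 'v word = "(int \<times> 'v) list"

definition words :: "(int \<Rightarrow> 'v set) \<Rightarrow> 'v word set" where
  "words grade = {w. w \<noteq> [] \<and> (\<forall>(a, x)\<in>set w. x \<in> shift grade a)}"

definition word_degree :: "'v word \<Rightarrow> int" where
  "word_degree w = sum_list (map fst w)"

definition free_space :: "(int \<Rightarrow> 'v set) \<Rightarrow> ('v word \<Rightarrow>\<^sub>0 'k::field_char_0) set" where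
  "free_space grade = {f. Poly_Mapping.keys f \<subseteq> words grade}"

definition fscale :: "'k::field_char_0 \<Rightarrow> ('w \<Rightarrow>\<^sub>0 'k) \<Rightarrow> ('w \<Rightarrow>\<^sub>0 'k)" where
  "fscale c f = Poly_Mapping.map ((*) c) f"

definition linear_extension ::
  "('w \<Rightarrow> ('u \<Rightarrow>\<^sub>0 'k)) \<Rightarrow> ('w \<Rightarrow>\<^sub>0 'k::field_char_0) \<Rightarrow> ('u \<Rightarrow>\<^sub>0 'k)" where
  "linear_extension F f = (\<Sum>w\<in>Poly_Mapping.keys f. fscale (Poly_Mapping.lookup f w) (F w))"

definition bilinear_extension ::
  "('w \<Rightarrow> 'w \<Rightarrow> ('u \<Rightarrow>\<^sub>0 'k)) \<Rightarrow> ('w \<Rightarrow>\<^sub>0 'k::field_char_0) \<Rightarrow> ('w \<Rightarrow>\<^sub>0 'k) \<Rightarrow> ('u \<Rightarrow>\<^sub>0 'k)" where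
  "bilinear_extension F f g = linear_extension (\<lambda>u. linear_extension (F u) g) f"

definition multilinear_relations ::
  "('k::field_char_0, 'v) module \<Rightarrow> (int \<Rightarrow> 'v set) \<Rightarrow> ('v word \<Rightarrow>\<^sub>0 'k) set" where
  "multilinear_relations V grade =
    {Poly_Mapping.single (u @ [(a, x \<oplus>\<^bsub>V\<^esub> y)] @ v) 1
       - Poly_Mapping.single (u @ [(a, x)] @ v) 1 - Poly_Mapping.single (u @ [(a, y)] @ v) 1
     | u v a x y. u @ [(a, x)] @ v \<in> words grade \<and> u @ [(a, y)] @ v \<in> words grade} \<union>
    {Poly_Mapping.single (u @ [(a, c \<odot>\<^bsub>V\<^esub> x)] @ v) 1 - Poly_Mapping.single (u @ [(a, x)] @ v) c
     | u v a c x. u @ [(a, x)] @ v \<in> words grade}"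

definition bat :: "'v word \<Rightarrow> 'v word \<Rightarrow> ('v word \<Rightarrow>\<^sub>0 'k::field_char_0)" where
  "bat u v =
    (\<Sum>\<sigma>\<in>Bat (length u) (length v).
       let \<pi> = inv_into UNIV \<sigma>
       in Poly_Mapping.single (permute_list \<pi> (u @ v)) (koszul (map fst (u @ v)) \<pi>))"

text \<open>The quotients by multilinearity and by the images of the maps \<open>bat\<close> are taken in one
  step.\<close>

definition relations ::
  "('k::field_char_0, 'v) module \<Rightarrow> (int \<Rightarrow> 'v set) \<Rightarrow> ('v word \<Rightarrow>\<^sub>0 'k) set" where
  "relations V grade = Modules.module.span fscale
     (multilinear_relations V grade \<union> {bat u v | u v. u \<in> words grade \<and> v \<in> words grade})"

definition H_eq ::
  "('k::field_char_0, 'v) module \<Rightarrow> (int \<Rightarrow> 'v set) \<Rightarrow> (('v word \<Rightarrow>\<^sub>0 'k) \<times> ('v word \<Rightarrow>\<^sub>0 'k)) set"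
  where
  "H_eq V grade =
    {(f, g). f \<in> free_space grade \<and> g \<in> free_space grade \<and> f - g \<in> relations V grade}"

text \<open>Operations on classes are unions of the classes of the results on representatives, as in
  \<open>Equiv_Relations\<close>. Such a union is an element of the quotient exactly if all these classes
  coincide, that is, if the operation is well defined; so the closure of \<open>H\<close> under the
  operations includes their well-definedness.\<close>

definition H ::
  "('k::field_char_0, 'v) module \<Rightarrow> (int \<Rightarrow> 'v set) \<Rightarrow> ('k, ('v word \<Rightarrow>\<^sub>0 'k) set) module" where
  "H V grade =
    \<lparr>carrier = free_space grade // H_eq V grade,
     mult = undefined,
     one = undefined,
     zero = H_eq V grade `` {0},
     add = (\<lambda>A B. \<Union>f\<in>A. \<Union>g\<in>B. H_eq V grade `` {f + g}),
     smult = (\<lambda>c A. \<Union>f\<in>A. H_eq V grade `` {fscale c f})\<rparr>"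

definition H_grade ::
  "('k::field_char_0, 'v) module \<Rightarrow> (int \<Rightarrow> 'v set) \<Rightarrow> int \<Rightarrow> ('v word \<Rightarrow>\<^sub>0 'k) set set" where
  "H_grade V grade d =
    {H_eq V grade `` {f} | f. f \<in> free_space grade \<and>
       (\<forall>w\<in>Poly_Mapping.keys f. word_degree w = d)}"


section \<open>The operator \<open>\<mu>\<close> and the bracket on \<open>H\<close>\<close>

text \<open>\<open>\<mu>\<^sub>2\<close> has degree \<open>1\<close> for the shifted degrees, the bracket of \<open>V\<close> has degree \<open>0\<close>.\<close>

definition \<mu>2 ::
  "('k::field_char_0, 'v) module \<Rightarrow> ('v \<Rightarrow> 'v \<Rightarrow> 'v) \<Rightarrow> int \<times> 'v \<Rightarrow> int \<times> 'v \<Rightarrow> int \<times> 'v" where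
  "\<mu>2 V wedge = (\<lambda>(a, x) (b, y). (a + b + 1, (-1) powi a \<odot>\<^bsub>V\<^esub> wedge x y))"

definition letter_bracket :: "('v \<Rightarrow> 'v \<Rightarrow> 'v) \<Rightarrow> int \<times> 'v \<Rightarrow> int \<times> 'v \<Rightarrow> int \<times> 'v" where
  "letter_bracket br = (\<lambda>(a, x) (b, y). (a + b, br x y))"

definition merge :: "('l \<Rightarrow> 'l \<Rightarrow> 'l) \<Rightarrow> nat \<Rightarrow> 'l list \<Rightarrow> 'l list" where
  "merge m k w = take k w @ [m (w ! k) (w ! Suc k)] @ drop (k + 2) w"

definition \<mu>_word ::
  "('k::field_char_0, 'v) module \<Rightarrow> ('v \<Rightarrow> 'v \<Rightarrow> 'v) \<Rightarrow> 'v word \<Rightarrow> ('v word \<Rightarrow>\<^sub>0 'k)" where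
  "\<mu>_word V wedge w =
    (\<Sum>j | Suc j < length w.
       Poly_Mapping.single (merge (\<mu>2 V wedge) j w) ((-1) powi word_degree (take j w)))"

definition bracket_word ::
  "('v \<Rightarrow> 'v \<Rightarrow> 'v) \<Rightarrow> 'v word \<Rightarrow> 'v word \<Rightarrow> ('v word \<Rightarrow>\<^sub>0 'k::field_char_0)" where
  "bracket_word br u v =
    (\<Sum>\<sigma>\<in>Bat (length u) (length v).
       let \<pi> = inv_into UNIV \<sigma>
       in \<Sum>k | Suc k < length u + length v \<and> \<pi> k < length u \<and> length u \<le> \<pi> (Suc k).
            Poly_Mapping.single (merge (letter_bracket br) k (permute_list \<pi> (u @ v)))
              (koszul (map fst (u @ v)) \<pi>))"

definition H_\<mu> ::
  "('k::field_char_0, 'v) module \<Rightarrow> (int \<Rightarrow> 'v set) \<Rightarrow> ('v \<Rightarrow> 'v \<Rightarrow> 'v) \<Rightarrow>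
   ('v word \<Rightarrow>\<^sub>0 'k) set \<Rightarrow> ('v word \<Rightarrow>\<^sub>0 'k) set" where
  "H_\<mu> V grade wedge A =
    (\<Union>f\<in>A. H_eq V grade `` {linear_extension (\<mu>_word V wedge) f})"

definition H_bracket ::
  "('k::field_char_0, 'v) module \<Rightarrow> (int \<Rightarrow> 'v set) \<Rightarrow> ('v \<Rightarrow> 'v \<Rightarrow> 'v) \<Rightarrow>
   ('v word \<Rightarrow>\<^sub>0 'k) set \<Rightarrow> ('v word \<Rightarrow>\<^sub>0 'k) set \<Rightarrow> ('v word \<Rightarrow>\<^sub>0 'k) set" where
  "H_bracket V grade br A B =
    (\<Union>f\<in>A. \<Union>g\<in>B. H_eq V grade `` {bilinear_extension (bracket_word br) f g})"

end

theory Submission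
  imports Defs
begin

text \<open>
  Everything happens before passing to the quotient by shuffles. If words are multiplied by the
  signed shuffle product, written \<open>*\<close> here, then
  \<open>[u, v] = \<Sum> \<plusminus> (u' * v') [x, y] (u'' * v'')\<close>, summed over all \<open>u = u' x u''\<close> and
  \<open>v = v' y v''\<close>. In this form the bracket is antisymmetric, a derivation of \<open>*\<close> in each argument, and satisfies the Jacobi identity,
  and \<open>\<mu>\<close> is a differential for both \<open>*\<close> and the bracket; all these are inductions on the first
  letters of words. A bracket or \<open>\<mu>\<close> of a shuffle product is therefore a combination of shuffle
  products, so both operations descend to the quotient.

  The identities on words hold only modulo multilinearity. To have them as equations, a
  linear map \<open>rep\<close> of degree 0 is chosen on the space freely generated by the letters \<open>(a, x)\<close>
  whose kernel consists of the linear relations between letters. With \<open>[x, y]\<close> and \<open>\<mu>\<^sub>2(x, y)\<close>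
  replaced by their images under \<open>rep\<close>, all identities become exact, and the kernel of the
  multilinear extension of \<open>rep\<close> consists of the multilinear relations between words.
\<close>

section \<open>Free vector spaces\<close>

text \<open>A letter is a basis vector, so even an antisymmetry \<open>br x y = - br y x\<close>
  relates two different letters only modulo linear relations. Carried through nested brackets, these
  relations would have to be shown stable at every step of the inductions on words. The locales
  below therefore take bracket and product of letters as maps into combinations of letters that
  satisfy their laws exactly. The raw operations return by a transfer: on valid words
  \<open>Rep\<close> intertwines them with the normalised ones, and elements with equal image under
  \<open>Rep\<close> differ by a relation.

  The shuffle quotient fits \<mu> because of commutativity: in a shuffle product, a letter of one
  factor and a letter of the other are multiplied in both orders, and the two products cancel. For
  the bracket a second cancellation is needed, which is the Leibniz rule.

  No canonical \<open>rep\<close> exists. It comes from a linear complement obtained by choice, and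
  must preserve degrees because all Koszul signs depend on them.\<close>

notation fscale (infixr "\<cdot>" 75)

abbreviation vec :: "'w \<Rightarrow> ('w \<Rightarrow>\<^sub>0 'k::field_char_0)" where
  "vec w \<equiv> Poly_Mapping.single w 1"

lemma lookup_fscale [simp]: "Poly_Mapping.lookup (c \<cdot> f) w = c * Poly_Mapping.lookup f w"
  by (simp add: fscale_def Poly_Mapping.map.rep_eq when_def)

interpretation fscale: vector_space "fscale :: 'k::field_char_0 \<Rightarrow> ('w \<Rightarrow>\<^sub>0 'k) \<Rightarrow> ('w \<Rightarrow>\<^sub>0 'k)"
  by unfold_locales (rule poly_mapping_eqI; simp add: lookup_add algebra_simps)+

lemmas fscale_simps = fscale.scale_right_distrib fscale.scale_left_distrib fscale.scale_scale
  fscale.scale_minus_left fscale.scale_minus_right fscale.scale_right_diff_distrib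
  fscale.scale_left_diff_distrib

lemma fscale_single: "c \<cdot> Poly_Mapping.single w d = Poly_Mapping.single w (c * d)"
  by (rule poly_mapping_eqI) (simp add: lookup_single when_def)

lemma single_eq_fscale_vec: "Poly_Mapping.single w c = c \<cdot> vec w"
  by (simp add: fscale_single)

lemma keys_fscale_subset: "Poly_Mapping.keys (c \<cdot> f) \<subseteq> Poly_Mapping.keys f"
  by (auto simp: in_keys_iff)

lemma poly_mapping_expand: "f = (\<Sum>w\<in>Poly_Mapping.keys f. Poly_Mapping.lookup f w \<cdot> vec w)"
  by (rule poly_mapping_eqI)
    (simp add: lookup_sum lookup_single when_def if_distrib sum.delta in_keys_iff cong: if_cong)

text \<open>Only generators among the keys of \<open>f\<close> have to be treated, so hypotheses on
  the words of \<open>f\<close>, such as validity, remain available.\<close>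

lemma poly_mapping_span_induct:
  fixes f :: "'w \<Rightarrow>\<^sub>0 'k::field_char_0"
  assumes "P 0" and "\<And>f g. P f \<Longrightarrow> P g \<Longrightarrow> P (f + g)" and "\<And>c f. P f \<Longrightarrow> P (c \<cdot> f)"
    and "\<And>w. w \<in> Poly_Mapping.keys f \<Longrightarrow> P (vec w)"
  shows "P f"
proof -
  have "P (\<Sum>w\<in>A. Poly_Mapping.lookup f w \<cdot> vec w)" if "finite A" "A \<subseteq> Poly_Mapping.keys f" for A
    using that by induction (auto intro: assms)
  from this[OF finite_keys order_refl] show ?thesis
    using poly_mapping_expand[of f] by simp
qed

section \<open>Linear extensions and linear maps between free spaces\<close>

lemma linear_extension_superset:
  assumes "finite A" "Poly_Mapping.keys f \<subseteq> A"
  shows "linear_extension F f = (\<Sum>w\<in>A. Poly_Mapping.lookup f w \<cdot> F w)"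
  unfolding linear_extension_def using assms
  by (intro sum.mono_neutral_left) (auto simp: in_keys_iff)

lemma linear_extension_add [simp]:
  "linear_extension F (f + g) = linear_extension F f + linear_extension F g"
  using linear_extension_superset[of "Poly_Mapping.keys f \<union> Poly_Mapping.keys g" f F]
    linear_extension_superset[of "Poly_Mapping.keys f \<union> Poly_Mapping.keys g" g F]
    linear_extension_superset[of "Poly_Mapping.keys f \<union> Poly_Mapping.keys g" "f + g" F]
    keys_add[of f g]
  by (simp add: lookup_add fscale_simps sum.distrib)

lemma linear_extension_scale [simp]:
  "linear_extension F (c \<cdot> f) = c \<cdot> linear_extension F f"
  using linear_extension_superset[of "Poly_Mapping.keys f" f F]
    linear_extension_superset[of "Poly_Mapping.keys f" "c \<cdot> f" F] keys_fscale_subset[of c f]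
  by (simp add: fscale.scale_sum_right)

text \<open>A multilinear identity is reduced to words one argument at a time, and each reduction
  needs both sides to be linear in that argument; closure rules for a plain predicate let simp
  establish this.\<close>

definition lin :: "(('w \<Rightarrow>\<^sub>0 'k::field_char_0) \<Rightarrow> ('u \<Rightarrow>\<^sub>0 'k)) \<Rightarrow> bool" where
  "lin \<phi> \<longleftrightarrow> (\<forall>f g. \<phi> (f + g) = \<phi> f + \<phi> g) \<and> (\<forall>c f. \<phi> (c \<cdot> f) = c \<cdot> \<phi> f)"

lemma lin_linear_extension [simp]: "lin (linear_extension F)"
  by (simp add: lin_def)

lemma lin_id [simp]: "lin (\<lambda>f. f)"
  by (simp add: lin_def)

lemma lin_zero [simp]: "lin (\<lambda>f. 0)"
  by (simp add: lin_def)

lemma lin_plus [simp]: "lin \<phi> \<Longrightarrow> lin \<psi> \<Longrightarrow> lin (\<lambda>f. \<phi> f + \<psi> f)"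
  by (simp add: lin_def fscale_simps)

lemma lin_scale [simp]: "lin \<phi> \<Longrightarrow> lin (\<lambda>f. c \<cdot> \<phi> f)"
  by (simp add: lin_def fscale_simps mult.commute)

lemma lin_uminus [simp]: "lin \<phi> \<Longrightarrow> lin (\<lambda>f. - \<phi> f)"
  by (simp add: lin_def fscale_simps)

lemma lin_diff [simp]: "lin \<phi> \<Longrightarrow> lin \<psi> \<Longrightarrow> lin (\<lambda>f. \<phi> f - \<psi> f)"
  by (simp add: lin_def fscale_simps)

lemma lin_compose: "lin \<phi> \<Longrightarrow> lin \<psi> \<Longrightarrow> lin (\<lambda>f. \<phi> (\<psi> f))"
  by (simp add: lin_def)

lemma linD:
  assumes "lin \<phi>"
  shows "\<phi> (f + g) = \<phi> f + \<phi> g" "\<phi> (c \<cdot> f) = c \<cdot> \<phi> f" "\<phi> 0 = 0" "\<phi> (- f) = - \<phi> f"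
    "\<phi> (f - g) = \<phi> f - \<phi> g"
proof -
  show a: "\<phi> (f + g) = \<phi> f + \<phi> g" and s: "\<phi> (c \<cdot> f) = c \<cdot> \<phi> f" for f g c
    using assms by (auto simp: lin_def)
  show "\<phi> 0 = 0" using s[of 0 0] by simp
  show m: "\<phi> (- f) = - \<phi> f" for f using s[of "-1" f] by simp
  show "\<phi> (f - g) = \<phi> f - \<phi> g" using a[of f "- g"] by (simp add: m)
qed

lemma lin_sum: "lin \<phi> \<Longrightarrow> \<phi> (\<Sum>i\<in>I. F i) = (\<Sum>i\<in>I. \<phi> (F i))"
  by (induction I rule: infinite_finite_induct) (auto simp: linD)

lemmas linear_extension_zero [simp] = linD(3)[OF lin_linear_extension]
lemmas linear_extension_minus [simp] = linD(4,5)[OF lin_linear_extension]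

lemma linear_extension_single [simp]: "linear_extension F (Poly_Mapping.single w c) = c \<cdot> F w"
  by (cases "c = 0") (simp_all add: linear_extension_def)

lemma lin_linear_extension_param:
  assumes "\<And>w. lin (\<lambda>f. F f w)"
  shows "lin (\<lambda>f. linear_extension (F f) g)"
  unfolding lin_def
proof (intro conjI allI)
  fix f f' show "linear_extension (F (f + f')) g = linear_extension (F f) g + linear_extension (F f') g"
    by (simp add: linear_extension_def linD[OF assms] fscale_simps sum.distrib)
next
  fix c f show "linear_extension (F (c \<cdot> f)) g = c \<cdot> linear_extension (F f) g"
    by (simp add: linear_extension_def linD[OF assms] fscale_simps fscale.scale_sum_right mult.commute)
qed

lemma lin_eqI:
  assumes "lin \<phi>" "lin \<psi>" "\<And>w. w \<in> Poly_Mapping.keys f \<Longrightarrow> \<phi> (vec w) = \<psi> (vec w)"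
  shows "\<phi> f = \<psi> f"
  by (rule poly_mapping_span_induct[where P = "\<lambda>f. \<phi> f = \<psi> f"])
    (simp_all add: assms(3) linD[OF assms(1)] linD[OF assms(2)])

lemma lin_bilinear_extension [simp]:
  "lin (\<lambda>f. bilinear_extension F f g)" "lin (bilinear_extension F f)"
  unfolding bilinear_extension_def
  by (simp_all add: lin_linear_extension_param)

lemma bilinear_extension_single [simp]:
  "bilinear_extension F (Poly_Mapping.single u c) (Poly_Mapping.single v d) = c \<cdot> d \<cdot> F u v"
  by (simp add: bilinear_extension_def)

lemmas bilinear_extension_lin [simp] = linD[OF lin_bilinear_extension(1)] linD[OF lin_bilinear_extension(2)]

lemma span_induct_lin:
  assumes "f \<in> fscale.span B" "fscale.subspace S" "lin \<phi>" "\<And>b. b \<in> B \<Longrightarrow> \<phi> b \<in> S"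
  shows "\<phi> f \<in> S"
  using assms(1)
  by (induction rule: fscale.span_induct_alt)
    (auto simp: linD[OF assms(3)] assms(4) fscale.subspace_0[OF assms(2)]
      intro!: fscale.subspace_add[OF assms(2)] fscale.subspace_scale[OF assms(2)])

section \<open>Signs, degrees and the shuffle product\<close>

text \<open>A symmetric bimultiplicative symbol of square 1, with \<open>ks 1 a\<close> as the sign
  of the degree \<open>a\<close>: the Koszul signs below are products of its values, which
  \<open>ks_simps\<close> normalises.\<close>

definition ks :: "int \<Rightarrow> int \<Rightarrow> 'k::field_char_0" where
  "ks a b = (-1) powi (a * b)"

lemma ks_add_left: "ks (a + b) c = ks a c * ks b c"
  by (simp add: ks_def distrib_right power_int_add)

lemma ks_add_right: "ks c (a + b) = ks c a * ks c b"
  by (simp add: ks_def distrib_left power_int_add)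

lemma ks_commute: "ks a b = ks b a"
  by (simp add: ks_def mult.commute)

lemma ks_square [simp]: "ks a b * ks a b = 1"
  by (simp add: ks_def power_int_minus_left)

lemma ks_square_left [simp]: "ks a b * (ks a b * c) = c"
  by (simp flip: mult.assoc)

lemma ks_1_1 [simp]: "ks 1 1 = -1"
  by (simp add: ks_def)

lemma ks_0 [simp]: "ks 0 a = 1" "ks a 0 = 1"
  by (simp_all add: ks_def)

lemmas ks_simps = ks_add_left ks_add_right ks_commute mult.assoc mult.commute mult.left_commute

section \<open>Homogeneous elements and sign twists\<close>

definition homog :: "('w \<Rightarrow> int) \<Rightarrow> int \<Rightarrow> ('w \<Rightarrow>\<^sub>0 'k::field_char_0) \<Rightarrow> bool" where
  "homog D d f \<longleftrightarrow> (\<forall>w\<in>Poly_Mapping.keys f. D w = d)"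

lemma homog_vec [simp]: "homog D (D w) (vec w)"
  by (simp add: homog_def)

lemma homog_zero [simp]: "homog D d 0"
  by (simp add: homog_def)

lemma homog_add [simp]: "homog D d f \<Longrightarrow> homog D d g \<Longrightarrow> homog D d (f + g)"
  using keys_add[of f g] by (auto simp: homog_def)

lemma homog_scale [simp]: "homog D d f \<Longrightarrow> homog D d (c \<cdot> f)"
  using keys_fscale_subset[of c f] by (auto simp: homog_def)

lemma homog_sum: "(\<And>i. i \<in> I \<Longrightarrow> homog D d (F i)) \<Longrightarrow> homog D d (\<Sum>i\<in>I. F i)"
  by (induction I rule: infinite_finite_induct) auto

lemma homog_linear_extension:
  "homog D d f \<Longrightarrow> (\<And>w. D w = d \<Longrightarrow> homog E e (F w)) \<Longrightarrow> homog E e (linear_extension F f)"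
  unfolding linear_extension_def by (auto intro!: homog_sum simp: homog_def[of D])

lemma homog_bilinear_extension:
  assumes "homog D d f" "homog D e g" "\<And>u v. homog E (D u + D v + c) (F u v)"
  shows "homog E (d + e + c) (bilinear_extension F f g)"
  unfolding bilinear_extension_def using assms
  by (intro homog_linear_extension[OF assms(1)] homog_linear_extension[OF assms(2)]) auto

lemma lin_eqI_homog:
  assumes "lin \<phi>" "lin \<psi>" "homog D d f" "\<And>w. D w = d \<Longrightarrow> \<phi> (vec w) = \<psi> (vec w)"
  shows "\<phi> f = \<psi> f"
  using assms(3,4) by (intro lin_eqI[OF assms(1,2), of f]) (auto simp: homog_def)

text \<open>The Koszul sign of moving an element of degree \<open>d\<close> past \<open>f\<close>,
  applied word by word so that it is linear in \<open>f\<close> even when \<open>f\<close> is not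
  homogeneous.\<close>

definition twist :: "('w \<Rightarrow> int) \<Rightarrow> int \<Rightarrow> ('w \<Rightarrow>\<^sub>0 'k::field_char_0) \<Rightarrow> ('w \<Rightarrow>\<^sub>0 'k)" where
  "twist D d = linear_extension (\<lambda>w. ks d (D w) \<cdot> vec w)"

lemma lin_twist [simp]: "lin (twist D d)"
  by (simp add: twist_def)

lemmas twist_lin [simp] = linD[OF lin_twist]

lemma twist_vec: "twist D d (vec w) = ks d (D w) \<cdot> vec w"
  by (simp add: twist_def)

lemma twist_homog: "homog D e f \<Longrightarrow> twist D d f = ks d e \<cdot> f"
proof (rule lin_eqI_homog[where \<phi> = "twist D d"])
  show "twist D d (vec w) = ks d e \<cdot> vec w" if "D w = e" for w
    using that by (simp add: twist_vec)
qed simp_all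

text \<open>The first argument is a combination of letters, because brackets and products of letters
  become combinations once \<open>rep\<close> is applied.\<close>

definition prepend :: "('l \<Rightarrow>\<^sub>0 'k::field_char_0) \<Rightarrow> ('l list \<Rightarrow>\<^sub>0 'k) \<Rightarrow> ('l list \<Rightarrow>\<^sub>0 'k)" where
  "prepend l f = linear_extension (\<lambda>x. linear_extension (\<lambda>w. vec (x # w)) f) l"

lemma lin_prepend [simp]: "lin (\<lambda>l. prepend l f)" "lin (prepend l)"
  unfolding prepend_def by (simp_all add: lin_linear_extension_param)

lemmas prepend_lin [simp] = linD[OF lin_prepend(1)] linD[OF lin_prepend(2)]

lemma prepend_vec: "prepend (vec x) (vec w) = vec (x # w)"
  by (simp add: prepend_def)

lemmas lin_rules = lin_compose[OF lin_prepend(1)] lin_compose[OF lin_prepend(2)] lin_compose[OF lin_twist]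
  lin_compose[OF lin_linear_extension] lin_compose[OF lin_bilinear_extension(1)]
  lin_compose[OF lin_bilinear_extension(2)]

section \<open>Degrees of words and the signed shuffle product\<close>

lemma word_degree_simps [simp]: "word_degree [] = 0" "word_degree (x # w) = fst x + word_degree w"
  "word_degree (u @ v) = word_degree u + word_degree v"
  by (simp_all add: word_degree_def)

abbreviation "homw \<equiv> homog word_degree"
abbreviation "homl \<equiv> homog fst"
abbreviation "tw \<equiv> twist word_degree"

lemma homog_prepend:
  assumes l: "homl d l" and f: "homw e f"
  shows "homw (d + e) (prepend l f)"
  unfolding prepend_def
proof (rule homog_linear_extension[OF l], rule homog_linear_extension[OF f])
  fix x :: "int \<times> 'a" and w :: "'a word"
  assume "fst x = d" "word_degree w = e"
  then show "homw (d + e) (vec (x # w))" using homog_vec[of word_degree "x # w"] by simp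
qed

text \<open>In the second summand \<open>y\<close> comes first and has passed the whole word
  \<open>x # u\<close>, whence its sign. Agreement with the sum over \<open>Bat\<close> is
  \<open>bat_eq_shuffle\<close>.\<close>

fun shuffle :: "'v word \<Rightarrow> 'v word \<Rightarrow> ('v word \<Rightarrow>\<^sub>0 'k::field_char_0)" where
  "shuffle [] v = vec v"
| "shuffle (x # u) [] = vec (x # u)"
| "shuffle (x # u) (y # v) = prepend (vec x) (shuffle u (y # v)) +
    ks (fst y) (fst x + word_degree u) \<cdot> prepend (vec y) (shuffle (x # u) v)"

lemma shuffle_Nil2 [simp]: "shuffle u [] = vec u"
  by (cases u) simp_all

lemma homog_shuffle: "homw (word_degree u + word_degree v) (shuffle u v)"
proof (induction u v rule: shuffle.induct)
  case (1 v) then show ?case using homog_vec[of word_degree v] by simp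
next
  case (2 x u) then show ?case using homog_vec[of word_degree "x # u"] by simp
next
  case (3 x u y v)
  show ?case
    using homog_prepend[OF homog_vec[of fst x] 3(1)] homog_prepend[OF homog_vec[of fst y] 3(2)]
    by (simp add: algebra_simps)
qed

abbreviation SH :: "('v word \<Rightarrow>\<^sub>0 'k::field_char_0) \<Rightarrow> _" where
  "SH \<equiv> bilinear_extension shuffle"

lemma homog_SH: "homw d f \<Longrightarrow> homw e g \<Longrightarrow> homw (d + e) (SH f g)"
  using homog_bilinear_extension[of word_degree d f e g word_degree 0 shuffle] homog_shuffle by auto

lemma SH_Nil [simp]: "SH (vec []) g = g" "SH f (vec []) = f"
proof -
  show "SH (vec []) g = g" by (rule lin_eqI[of "\<lambda>g. SH (vec []) g"]) (simp_all add: lin_rules)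
  show "SH f (vec []) = f" by (rule lin_eqI[of "\<lambda>f. SH f (vec [])"]) (simp_all add: lin_rules)
qed

text \<open>The recursion of \<open>shuffle\<close> freed from single words: combinations may stand
  in all four places, and homogeneity is asked of \<open>m\<close> alone because \<open>tw\<close>
  carries the sign.\<close>

lemma SH_prepend:
  assumes "homl d m"
  shows "SH (prepend l f) (prepend m g) = prepend l (SH f (prepend m g)) + prepend m (SH (tw d (prepend l f)) g)"
proof (rule lin_eqI[where \<phi> = "\<lambda>l. SH (prepend l f) (prepend m g)"])
  fix x
  show "SH (prepend (vec x) f) (prepend m g) = prepend (vec x) (SH f (prepend m g)) + prepend m (SH (tw d (prepend (vec x) f)) g)"
  proof (rule lin_eqI[where \<phi> = "\<lambda>f. SH (prepend (vec x) f) (prepend m g)"])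
    fix u
    show "SH (prepend (vec x) (vec u)) (prepend m g) =
        prepend (vec x) (SH (vec u) (prepend m g)) + prepend m (SH (tw d (prepend (vec x) (vec u))) g)"
    proof (rule lin_eqI_homog[where \<phi> = "\<lambda>m. SH (prepend (vec x) (vec u)) (prepend m g)", OF _ _ assms])
      fix y :: "int \<times> 'a" assume y: "fst y = d"
      show "SH (prepend (vec x) (vec u)) (prepend (vec y) g) = prepend (vec x) (SH (vec u) (prepend (vec y) g)) +
          prepend (vec y) (SH (tw d (prepend (vec x) (vec u))) g)"
        by (rule lin_eqI[where \<phi> = "\<lambda>g. SH (prepend (vec x) (vec u)) (prepend (vec y) g)"])
          (simp_all add: lin_rules, simp add: prepend_vec twist_vec y)
    qed (simp_all add: lin_rules)
  qed (simp_all add: lin_rules)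
qed (simp_all add: lin_rules)

lemma SH_prepend_vec:
  "SH (prepend l f) (prepend (vec y) g) = prepend l (SH f (prepend (vec y) g)) + prepend (vec y) (SH (tw (fst y) (prepend l f)) g)"
  by (rule SH_prepend) simp

lemma shuffle_commute: "shuffle u v = ks (word_degree u) (word_degree v) \<cdot> shuffle v u"
proof (induction u v rule: shuffle.induct)
  case (3 x u y v)
  show ?case
    unfolding shuffle.simps 3 by (simp add: fscale_simps ks_simps add_ac)
qed simp_all

lemma SH_commute:
  assumes f: "homw d f" and g: "homw e g"
  shows "SH f g = ks d e \<cdot> SH g f"
proof (rule lin_eqI_homog[where \<phi> = "\<lambda>f. SH f g", OF _ _ f])
  fix u :: "'a word" assume u: "word_degree u = d"
  show "SH (vec u) g = ks d e \<cdot> SH g (vec u)"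
    by (rule lin_eqI_homog[where \<phi> = "\<lambda>g. SH (vec u) g", OF _ _ g])
     (simp_all add: lin_rules shuffle_commute[of u] u)
qed (simp_all add: lin_rules)

text \<open>Both sides split into three terms according to whether \<open>x\<close>,
  \<open>y\<close> or \<open>z\<close> comes first; the terms agree by the induction hypotheses for
  words with one letter less.\<close>

lemma SH_assoc_words: "SH (SH (vec u) (vec v)) (vec w) = SH (vec u) (SH (vec v) (vec w))"
proof (induction "length u + length v + length w" arbitrary: u v w rule: less_induct)
  case less
  show ?case
  proof (cases "u = [] \<or> v = [] \<or> w = []")
    case True then show ?thesis by (auto simp del: bilinear_extension_single)
  next
    case False
    then obtain x u' y v' z w' where eq: "u = x # u'" "v = y # v'" "w = z # w'"
      by (auto simp: neq_Nil_conv)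
    define X Y Z U V Q :: "'a word \<Rightarrow>\<^sub>0 'b" where
      defs: "X = vec u" "Y = vec v" "Z = vec w" "U = vec u'" "V = vec v'" "Q = vec w'"
    have cls: "X = prepend (vec x) U" "Y = prepend (vec y) V" "Z = prepend (vec z) Q"
      by (simp_all add: defs eq prepend_vec)
    have homog: "homw (word_degree u) X" "homw (word_degree v) Y" "homw (word_degree w) Z"
      by (simp_all add: defs)
    have IH: "SH (SH U Y) Z = SH U (SH Y Z)" "SH (SH X V) Z = SH X (SH V Z)"
      "SH (SH X Y) Q = SH X (SH Y Q)"
      unfolding defs by (rule less; simp add: eq)+
    define s t r :: 'b where "s = ks (fst y) (word_degree u)" "t = ks (fst z) (word_degree v)"
      "r = ks (fst z) (word_degree u)"
    have XA: "SH X (prepend (vec y) G) = prepend (vec x) (SH U (prepend (vec y) G)) +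
         ks (fst y) (word_degree u) \<cdot> prepend (vec y) (SH X G)" for y G
      using SH_prepend_vec[of "vec x" U y G] unfolding cls(1)[symmetric] by (simp add: twist_homog[OF homog(1)])
    have XY: "SH X Y = prepend (vec x) (SH U Y) + s \<cdot> prepend (vec y) (SH X V)"
      unfolding cls(2) XA by (simp add: s_t_r_def)
    have YZ: "SH Y Z = prepend (vec y) (SH V Z) + t \<cdot> prepend (vec z) (SH Y Q)"
      using SH_prepend_vec[of "vec y" V z Q] unfolding cls(2,3)[symmetric]
      by (simp add: twist_homog[OF homog(2)] s_t_r_def)
    have "SH (SH X Y) Z = prepend (vec x) (SH (SH U Y) Z) + s \<cdot> prepend (vec y) (SH (SH X V) Z) +
        prepend (vec z) (SH (tw (fst z) (SH X Y)) Q)"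
      unfolding XY cls(3) by (simp add: SH_prepend_vec fscale_simps)
    also have "tw (fst z) (SH X Y) = (r * t) \<cdot> SH X Y"
      by (simp add: twist_homog[OF homog_SH[OF homog(1,2)]] ks_add_right s_t_r_def)
    also have "prepend (vec x) (SH (SH U Y) Z) + s \<cdot> prepend (vec y) (SH (SH X V) Z) +
        prepend (vec z) (SH ((r * t) \<cdot> SH X Y) Q) = SH X (SH Y Z)"
      unfolding YZ by (simp add: IH XA YZ fscale_simps s_t_r_def mult_ac)
    finally show ?thesis by (simp only: defs)
  qed
qed

lemma SH_assoc: "SH (SH f g) h = SH f (SH g h)"
proof (rule lin_eqI[where \<phi> = "\<lambda>f. SH (SH f g) h"])
  fix u
  show "SH (SH (vec u) g) h = SH (vec u) (SH g h)"
  proof (rule lin_eqI[where \<phi> = "\<lambda>g. SH (SH (vec u) g) h"])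
    fix v
    show "SH (SH (vec u) (vec v)) h = SH (vec u) (SH (vec v) h)"
      by (rule lin_eqI[where \<phi> = "\<lambda>h. SH (SH (vec u) (vec v)) h"], simp add: lin_rules, simp add: lin_rules)
       (rule SH_assoc_words)
  qed (simp_all add: lin_rules)
qed (simp_all add: lin_rules)

section \<open>The bracket of words\<close>

text \<open>A letter of \<open>u\<close> immediately followed by a letter of \<open>v\<close> is
  bracketed. In the third summand this pair stands in front: \<open>y\<close> has passed only
  \<open>u\<close>, and the remaining letters are shuffled freely. In the other two summands the
  pair lies behind the first letter.\<close>

fun shuffle_bracket :: "(int \<times> 'v \<Rightarrow> int \<times> 'v \<Rightarrow> (int \<times> 'v \<Rightarrow>\<^sub>0 'k::field_char_0)) \<Rightarrow>
    'v word \<Rightarrow> 'v word \<Rightarrow> ('v word \<Rightarrow>\<^sub>0 'k)" where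
  "shuffle_bracket lb [] v = 0"
| "shuffle_bracket lb (x # u) [] = 0"
| "shuffle_bracket lb (x # u) (y # v) = prepend (vec x) (shuffle_bracket lb u (y # v)) +
    ks (fst y) (fst x + word_degree u) \<cdot> prepend (vec y) (shuffle_bracket lb (x # u) v) +
    ks (fst y) (word_degree u) \<cdot> prepend (lb x y) (shuffle u v)"

lemma shuffle_bracket_Nil2 [simp]: "shuffle_bracket lb u [] = 0"
  by (cases u) simp_all

text \<open>Fitted to the derivation rule and the Jacobi identity: expanding by first letters takes
  one letter off one of the three words, so the total length decreases.\<close>

lemma three_words_induct:
  fixes u v w :: "'v word"
  assumes "\<And>v w. P [] v w" "\<And>u w. P u [] w" "\<And>u v. P u v []"
    and "\<And>x u y v z w. P u (y # v) (z # w) \<Longrightarrow> P (x # u) v (z # w) \<Longrightarrow> P (x # u) (y # v) w \<Longrightarrow>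
      P (x # u) (y # v) (z # w)"
  shows "P u v w"
proof (induction "length u + length v + length w" arbitrary: u v w rule: less_induct)
  case less
  show ?case
  proof (cases "u = [] \<or> v = [] \<or> w = []")
    case True then show ?thesis using assms(1,2,3) by auto
  next
    case False
    then obtain x u' y v' z w' where "u = x # u'" "v = y # v'" "w = z # w'"
      by (auto simp: neq_Nil_conv)
    then show ?thesis by (simp only:) (rule assms(4); rule less; simp)
  qed
qed

locale homog_bracket =
  fixes lb :: "int \<times> 'v \<Rightarrow> int \<times> 'v \<Rightarrow> (int \<times> 'v \<Rightarrow>\<^sub>0 'k::field_char_0)"
  assumes homl_lb: "homl (fst x + fst y) (lb x y)"
begin

abbreviation BB where "BB \<equiv> bilinear_extension (shuffle_bracket lb)"
abbreviation LL where "LL \<equiv> bilinear_extension lb"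

lemma homog_shuffle_bracket: "homw (word_degree u + word_degree v) (shuffle_bracket lb u v)"
proof (induction u v rule: shuffle.induct)
  case (3 x u y v)
  show ?case
    using homog_prepend[OF homog_vec[of fst x] 3(1)] homog_prepend[OF homog_vec[of fst y] 3(2)]
      homog_prepend[OF homl_lb[of x y] homog_shuffle[of u v]]
    by (simp add: algebra_simps)
qed simp_all

lemma homog_BB: "homw d f \<Longrightarrow> homw e g \<Longrightarrow> homw (d + e) (BB f g)"
  using homog_bilinear_extension[of word_degree d f e g word_degree 0 "shuffle_bracket lb"] homog_shuffle_bracket by auto

lemma BB_Nil [simp]: "BB (vec []) g = 0" "BB f (vec []) = 0"
proof -
  show "BB (vec []) g = 0" by (rule lin_eqI[of "\<lambda>g. BB (vec []) g"]) (simp_all add: lin_rules)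
  show "BB f (vec []) = 0" by (rule lin_eqI[of "\<lambda>f. BB f (vec [])"]) (simp_all add: lin_rules)
qed

lemma BB_prepend:
  assumes "homl d m"
  shows "BB (prepend l f) (prepend m g) = prepend l (BB f (prepend m g)) + prepend m (BB (tw d (prepend l f)) g) +
    prepend (LL l m) (SH (tw d f) g)"
proof (rule lin_eqI[where \<phi> = "\<lambda>l. BB (prepend l f) (prepend m g)"])
  fix x
  show "BB (prepend (vec x) f) (prepend m g) = prepend (vec x) (BB f (prepend m g)) + prepend m (BB (tw d (prepend (vec x) f)) g) +
    prepend (LL (vec x) m) (SH (tw d f) g)"
  proof (rule lin_eqI[where \<phi> = "\<lambda>f. BB (prepend (vec x) f) (prepend m g)"])
    fix u
    show "BB (prepend (vec x) (vec u)) (prepend m g) = prepend (vec x) (BB (vec u) (prepend m g)) +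
        prepend m (BB (tw d (prepend (vec x) (vec u))) g) + prepend (LL (vec x) m) (SH (tw d (vec u)) g)"
    proof (rule lin_eqI_homog[where \<phi> = "\<lambda>m. BB (prepend (vec x) (vec u)) (prepend m g)", OF _ _ assms])
      fix y :: "int \<times> 'v" assume y: "fst y = d"
      show "BB (prepend (vec x) (vec u)) (prepend (vec y) g) = prepend (vec x) (BB (vec u) (prepend (vec y) g)) +
          prepend (vec y) (BB (tw d (prepend (vec x) (vec u))) g) + prepend (LL (vec x) (vec y)) (SH (tw d (vec u)) g)"
        by (rule lin_eqI[where \<phi> = "\<lambda>g. BB (prepend (vec x) (vec u)) (prepend (vec y) g)"])
          (simp_all add: lin_rules, simp add: prepend_vec twist_vec y)
    qed (simp_all add: lin_rules)
  qed (simp_all add: lin_rules)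
qed (simp_all add: lin_rules)

lemmas BB_prepend_vec = BB_prepend[OF homog_vec]

text \<open>The letter bracketed with one of \<open>w\<close> belongs to \<open>u\<close> or to
  \<open>v\<close>. In the induction, terms beginning with \<open>x\<close>, \<open>y\<close>,
  \<open>z\<close> match by hypothesis, those beginning with \<open>lb x z\<close> or
  \<open>lb y z\<close> by associativity and commutativity of \<open>SH\<close>. The rule serves
  twice: in the Jacobi identity, and to see that brackets preserve the span of shuffle
  products.\<close>

lemma BB_SH_words:
  "BB (SH (vec u) (vec v)) (vec w) =
    ks (word_degree v) (word_degree w) \<cdot> SH (BB (vec u) (vec w)) (vec v) + SH (vec u) (BB (vec v) (vec w))"
proof (induction u v w rule: three_words_induct)
  case (4 x u y v z w)
  define X Y Z U V Q :: "'v word \<Rightarrow>\<^sub>0 'k" where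
    defs: "X = vec (x # u)" "Y = vec (y # v)" "Z = vec (z # w)" "U = vec u" "V = vec v" "Q = vec w"
  have cls: "X = prepend (vec x) U" "Y = prepend (vec y) V" "Z = prepend (vec z) Q"
    by (simp_all add: defs prepend_vec)
  have "homw (word_degree (x # u)) X" "homw (word_degree (y # v)) Y" "homw (word_degree (z # w)) Z"
    and homs: "homw (word_degree u) U" "homw (word_degree v) V" "homw (word_degree w) Q"
    unfolding defs by (rule homog_vec)+
  then have hom: "homw (fst x + word_degree u) X" "homw (fst y + word_degree v) Y"
    "homw (fst z + word_degree w) Z"
    by simp_all
  note IH = 4[folded defs]
  have rX: "SH X (prepend m G) = prepend (vec x) (SH U (prepend m G)) + ks d (fst x + word_degree u) \<cdot> prepend m (SH X G)"
    if "homl d m" for m d G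
    using SH_prepend[OF that, of "vec x" U G] unfolding cls(1)[symmetric] by (simp add: twist_homog[OF hom(1)])
  have XY: "SH X Y = prepend (vec x) (SH U Y) + ks (fst y) (fst x + word_degree u) \<cdot> prepend (vec y) (SH X V)"
    unfolding cls(2) by (simp add: rX[OF homog_vec])
  have XZ: "BB X Z = prepend (vec x) (BB U Z) + ks (fst z) (fst x + word_degree u) \<cdot> prepend (vec z) (BB X Q)
      + ks (fst z) (word_degree u) \<cdot> prepend (lb x z) (SH U Q)"
    using BB_prepend_vec[of "vec x" U z Q] unfolding cls(1,3)[symmetric]
    by (simp add: twist_homog[OF hom(1)] twist_homog[OF homs(1)])
  have YZ: "BB Y Z = prepend (vec y) (BB V Z) + ks (fst z) (fst y + word_degree v) \<cdot> prepend (vec z) (BB Y Q)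
      + ks (fst z) (word_degree v) \<cdot> prepend (lb y z) (SH V Q)"
    using BB_prepend_vec[of "vec y" V z Q] unfolding cls(2,3)[symmetric]
    by (simp add: twist_homog[OF hom(2)] twist_homog[OF homs(2)])
  have tXY: "tw d (SH X Y) = ks d (fst x + word_degree u + (fst y + word_degree v)) \<cdot> SH X Y" for d
    by (rule twist_homog homog_SH hom)+
  have tXZ: "tw d (BB X Z) = ks d (fst x + word_degree u + (fst z + word_degree w)) \<cdot> BB X Z" for d
    by (rule twist_homog homog_BB hom)+
  have tUY: "tw d (SH U Y) = ks d (word_degree u + (fst y + word_degree v)) \<cdot> SH U Y" for d
    by (rule twist_homog homog_SH hom homs)+
  have tXV: "tw d (SH X V) = ks d (fst x + word_degree u + word_degree v) \<cdot> SH X V" for d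
    by (rule twist_homog homog_SH hom homs)+
  have 1: "BB (SH X Y) Z = prepend (vec x) (BB (SH U Y) Z) +
      ks (fst y) (fst x + word_degree u) \<cdot> prepend (vec y) (BB (SH X V) Z) +
      prepend (vec z) (BB (tw (fst z) (SH X Y)) Q) +
      prepend (lb x z) (SH (tw (fst z) (SH U Y)) Q) +
      ks (fst y) (fst x + word_degree u) \<cdot> prepend (lb y z) (SH (tw (fst z) (SH X V)) Q)"
    unfolding XY cls(3) by (simp add: BB_prepend_vec fscale_simps)
  have 2: "SH (BB X Z) Y = prepend (vec x) (SH (BB U Z) Y) +
      ks (fst z) (fst x + word_degree u) \<cdot> prepend (vec z) (SH (BB X Q) Y) +
      ks (fst z) (word_degree u) \<cdot> prepend (lb x z) (SH (SH U Q) Y) +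
      prepend (vec y) (SH (tw (fst y) (BB X Z)) V)"
    unfolding XZ cls(2) by (simp add: SH_prepend_vec fscale_simps)
  have 3: "SH X (BB Y Z) = prepend (vec x) (SH U (BB Y Z)) +
      ks (fst y) (fst x + word_degree u) \<cdot> prepend (vec y) (SH X (BB V Z)) +
      (ks (fst z) (fst y + word_degree v) * ks (fst z) (fst x + word_degree u)) \<cdot> prepend (vec z) (SH X (BB Y Q)) +
      (ks (fst z) (word_degree v) * ks (fst y + fst z) (fst x + word_degree u)) \<cdot>
        prepend (lb y z) (SH X (SH V Q))"
    unfolding YZ by (simp add: rX[OF homog_vec] rX[OF homl_lb] fscale_simps mult_ac)
  \<comment> \<open>Behind \<open>lb x z\<close> the tails are \<open>SH (SH U Y) Q\<close> on the
    left and \<open>SH (SH U Q) Y\<close> on the right, so \<open>Q\<close> and \<open>Y\<close>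
    must be exchanged.\<close>
  have QY: "SH Q Y = ks (word_degree w) (fst y + word_degree v) \<cdot> SH Y Q"
    by (rule SH_commute homs hom)+
  show ?case
    unfolding defs[symmetric] 1 2 3 tXY tXZ tUY tXV
    by (simp add: IH QY SH_assoc fscale_simps ks_simps)
qed simp_all

lemma BB_SH:
  assumes g: "homw b g" and h: "homw c h"
  shows "BB (SH f g) h = ks b c \<cdot> SH (BB f h) g + SH f (BB g h)"
proof (rule lin_eqI[where \<phi> = "\<lambda>f. BB (SH f g) h"])
  fix u
  show "BB (SH (vec u) g) h = ks b c \<cdot> SH (BB (vec u) h) g + SH (vec u) (BB g h)"
  proof (rule lin_eqI_homog[where \<phi> = "\<lambda>g. BB (SH (vec u) g) h", OF _ _ g])
    fix v :: "'v word" assume v: "word_degree v = b"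
    show "BB (SH (vec u) (vec v)) h = ks b c \<cdot> SH (BB (vec u) h) (vec v) + SH (vec u) (BB (vec v) h)"
    proof (rule lin_eqI_homog[where \<phi> = "\<lambda>h. BB (SH (vec u) (vec v)) h", OF _ _ h])
      fix w :: "'v word" assume w: "word_degree w = c"
      show "BB (SH (vec u) (vec v)) (vec w) =
          ks b c \<cdot> SH (BB (vec u) (vec w)) (vec v) + SH (vec u) (BB (vec v) (vec w))"
        using BB_SH_words[of u v w] unfolding v w .
    qed (simp_all add: lin_rules)
  qed (simp_all add: lin_rules)
qed (simp_all add: lin_rules)

end

section \<open>Antisymmetry and the Jacobi identity on words\<close>

locale lie_letters = homog_bracket lb
  for lb :: "int \<times> 'v \<Rightarrow> int \<times> 'v \<Rightarrow> (int \<times> 'v \<Rightarrow>\<^sub>0 'k::field_char_0)" +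
  assumes lb_antisym: "lb x y = - (ks (fst x) (fst y) \<cdot> lb y x)"
    and lb_jacobi: "ks (fst x) (fst z) \<cdot> LL (lb x y) (vec z) + ks (fst y) (fst x) \<cdot> LL (lb y z) (vec x)
      + ks (fst z) (fst y) \<cdot> LL (lb z x) (vec y) = 0"
begin

lemma shuffle_bracket_antisym: "shuffle_bracket lb u v = - (ks (word_degree u) (word_degree v) \<cdot> shuffle_bracket lb v u)"
proof (induction u v rule: shuffle.induct)
  case (3 x u y v)
  show ?case
    unfolding shuffle_bracket.simps 3 lb_antisym[of x y] shuffle_commute[of u v]
    by (simp add: fscale_simps ks_simps add_ac)
qed simp_all

lemma BB_antisym:
  assumes f: "homw d f" and g: "homw e g"
  shows "BB f g = - (ks d e \<cdot> BB g f)"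
proof (rule lin_eqI_homog[where \<phi> = "\<lambda>f. BB f g", OF _ _ f])
  fix u :: "'v word" assume u: "word_degree u = d"
  show "BB (vec u) g = - (ks d e \<cdot> BB g (vec u))"
    by (rule lin_eqI_homog[where \<phi> = "\<lambda>g. BB (vec u) g", OF _ _ g])
     (simp_all add: lin_rules shuffle_bracket_antisym[of u] u)
qed (simp_all add: lin_rules)

text \<open>One expansion suffices for Jacobi, since the other two double brackets are its cyclic
  rotations. What stands behind \<open>lb x y\<close> is \<open>BB (SH U V) Z\<close>, already split
  by the derivation rule.\<close>

lemma BB_BB_Cons:
  fixes x y z u v w
  defines "X \<equiv> vec (x # u)" and "Y \<equiv> vec (y # v)" and "Z \<equiv> vec (z # w)"
    and "U \<equiv> vec u" and "V \<equiv> vec v" and "Q \<equiv> vec w"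
  shows "BB (BB X Y) Z = prepend (vec x) (BB (BB U Y) Z) +
      ks (fst y) (fst x + word_degree u) \<cdot> prepend (vec y) (BB (BB X V) Z) +
      ks (fst z) (fst x + word_degree u + (fst y + word_degree v)) \<cdot> prepend (vec z) (BB (BB X Y) Q) +
      ks (fst y) (word_degree u) \<cdot> prepend (lb x y)
        (ks (word_degree v) (fst z + word_degree w) \<cdot> SH (BB U Z) V + SH U (BB V Z)) +
      ks (fst z) (word_degree u + (fst y + word_degree v)) \<cdot> prepend (lb x z) (SH (BB U Y) Q) +
      (ks (fst y) (fst x + word_degree u) * ks (fst z) (fst x + word_degree u + word_degree v)) \<cdot>
        prepend (lb y z) (SH (BB X V) Q) +
      (ks (fst y) (word_degree u) * ks (fst z) (word_degree u + word_degree v)) \<cdot>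
        prepend (LL (lb x y) (vec z)) (SH (SH U V) Q)"
proof -
  have cls: "X = prepend (vec x) U" "Y = prepend (vec y) V" "Z = prepend (vec z) Q"
    by (simp_all add: assms prepend_vec)
  have "homw (word_degree (x # u)) X" "homw (word_degree (y # v)) Y" "homw (word_degree (z # w)) Z"
    and homs: "homw (word_degree u) U" "homw (word_degree v) V" "homw (word_degree w) Q"
    unfolding assms by (rule homog_vec)+
  then have hom: "homw (fst x + word_degree u) X" "homw (fst y + word_degree v) Y"
    "homw (fst z + word_degree w) Z"
    by simp_all
  have XY: "BB X Y = prepend (vec x) (BB U Y) + ks (fst y) (fst x + word_degree u) \<cdot> prepend (vec y) (BB X V)
      + ks (fst y) (word_degree u) \<cdot> prepend (lb x y) (SH U V)"
    using BB_prepend_vec[of "vec x" U y V] unfolding cls(1,2)[symmetric]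
    by (simp add: twist_homog[OF hom(1)] twist_homog[OF homs(1)])
  have tXY: "tw d (BB X Y) = ks d (fst x + word_degree u + (fst y + word_degree v)) \<cdot> BB X Y" for d
    by (rule twist_homog homog_BB hom)+
  have tUV: "tw d (SH U V) = ks d (word_degree u + word_degree v) \<cdot> SH U V" for d
    by (rule twist_homog homog_SH homs)+
  have tUY: "tw d (BB U Y) = ks d (word_degree u + (fst y + word_degree v)) \<cdot> BB U Y" for d
    by (rule twist_homog homog_BB hom homs)+
  have tXV: "tw d (BB X V) = ks d (fst x + word_degree u + word_degree v) \<cdot> BB X V" for d
    by (rule twist_homog homog_BB hom homs)+
  have "BB (BB X Y) Z = prepend (vec x) (BB (BB U Y) Z) +
      ks (fst y) (fst x + word_degree u) \<cdot> prepend (vec y) (BB (BB X V) Z) +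
      prepend (vec z) (BB (tw (fst z) (BB X Y)) Q) +
      ks (fst y) (word_degree u) \<cdot> prepend (lb x y) (BB (SH U V) Z) +
      prepend (lb x z) (SH (tw (fst z) (BB U Y)) Q) +
      ks (fst y) (fst x + word_degree u) \<cdot> prepend (lb y z) (SH (tw (fst z) (BB X V)) Q) +
      ks (fst y) (word_degree u) \<cdot> prepend (LL (lb x y) (vec z)) (SH (tw (fst z) (SH U V)) Q)"
    unfolding XY cls(3) by (simp add: BB_prepend_vec fscale_simps)
  then show ?thesis
    unfolding tXY tUV tUY tXV BB_SH[OF homs(2) hom(3)] by (simp add: fscale_simps)
qed

text \<open>Sorting by first letter: behind \<open>x\<close>, \<open>y\<close>, \<open>z\<close> the
  induction hypotheses apply; behind a double bracket of letters, the Jacobi identity of letters,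
  with a common shuffle of the three tails; behind a simple bracket such as \<open>lb x y\<close>,
  the two summands of the derivation rule cancel against the one term that each of the other two
  rotations contributes.\<close>

lemma jacobi_words:
  fixes u v w :: "'v word"
  shows "ks (word_degree u) (word_degree w) \<cdot> BB (BB (vec u) (vec v)) (vec w) +
    ks (word_degree v) (word_degree u) \<cdot> BB (BB (vec v) (vec w)) (vec u) +
    ks (word_degree w) (word_degree v) \<cdot> BB (BB (vec w) (vec u)) (vec v) = 0"
proof (induction u v w rule: three_words_induct)
  case (4 x u y v z w)
  define X Y Z U V Q :: "'v word \<Rightarrow>\<^sub>0 'k" where
    defs: "X = vec (x # u)" "Y = vec (y # v)" "Z = vec (z # w)" "U = vec u" "V = vec v" "Q = vec w"
  have "homw (word_degree (x # u)) X" "homw (word_degree (y # v)) Y" "homw (word_degree (z # w)) Z"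
    and homs: "homw (word_degree u) U" "homw (word_degree v) V" "homw (word_degree w) Q"
    unfolding defs by (rule homog_vec)+
  then have hom: "homw (fst x + word_degree u) X" "homw (fst y + word_degree v) Y"
    "homw (fst z + word_degree w) Z"
    by simp_all
  \<comment> \<open>Solves a cyclic sum for its first term, so that the hypotheses become rewrite
    rules; the coefficient \<open>s\<close> is its own inverse.\<close>
  have solve: "f = - (s \<cdot> t \<cdot> g) - s \<cdot> r \<cdot> h" if "s \<cdot> f + t \<cdot> g + r \<cdot> h = 0" "s * s = 1"
    for f g h :: "'w \<Rightarrow>\<^sub>0 'k" and s t r
  proof -
    have "s \<cdot> (s \<cdot> f + t \<cdot> g + r \<cdot> h) = 0" using that(1) by simp
    then have "f + s \<cdot> t \<cdot> g + s \<cdot> r \<cdot> h = 0"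
      by (simp add: fscale_simps that(2))
    then show ?thesis by (simp add: eq_neg_iff_add_eq_0 algebra_simps)
  qed
  note IH = 4[folded defs, THEN solve[OF _ ks_square]]
  note J = lb_jacobi[of x z y, THEN solve[OF _ ks_square]]
  note rules = BB_BB_Cons[of x u y v z w, folded defs] BB_BB_Cons[of y v z w x u, folded defs]
    BB_BB_Cons[of z w x u y v, folded defs]
  \<comment> \<open>Fixed instances of antisymmetry, and in \<open>C\<close> of commutativity, bring
    each pair into one chosen order; the general laws would loop as rewrite rules.\<close>
  note A = BB_antisym[OF hom(3) homs(1)] BB_antisym[OF hom(1) homs(2)] BB_antisym[OF hom(2) homs(3)]
    lb_antisym[of y x] lb_antisym[of z y] lb_antisym[of x z]
  note C = SH_commute[OF homog_BB[OF homs(2) hom(3)] homs(1)]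
    SH_commute[OF homog_BB[OF homs(3) hom(1)] homs(2)] SH_commute[OF homog_BB[OF homs(1) hom(2)] homs(3)]
    SH_commute[OF homog_SH[OF homs(2) homs(3)] homs(1)] SH_commute[OF homs(3) homog_SH[OF homs(1) homs(2)]]
  show ?case
    unfolding defs[symmetric] rules unfolding IH J unfolding A
    by (simp add: C[unfolded SH_assoc] SH_assoc fscale_simps ks_simps)
qed simp_all

lemma jacobi:
  assumes f: "homw a f" and g: "homw b g" and h: "homw c h"
  shows "ks a c \<cdot> BB (BB f g) h + ks b a \<cdot> BB (BB g h) f + ks c b \<cdot> BB (BB h f) g = 0"
proof (rule lin_eqI_homog[where \<psi> = "\<lambda>f. 0" and
    \<phi> = "\<lambda>f. ks a c \<cdot> BB (BB f g) h + ks b a \<cdot> BB (BB g h) f + ks c b \<cdot> BB (BB h f) g", OF _ _ f])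
  fix u :: "'v word" assume u: "word_degree u = a"
  let ?u = "vec u :: 'v word \<Rightarrow>\<^sub>0 'k"
  show "ks a c \<cdot> BB (BB ?u g) h + ks b a \<cdot> BB (BB g h) ?u + ks c b \<cdot> BB (BB h ?u) g = 0"
  proof (rule lin_eqI_homog[where \<psi> = "\<lambda>f. 0" and
      \<phi> = "\<lambda>g. ks a c \<cdot> BB (BB ?u g) h + ks b a \<cdot> BB (BB g h) ?u + ks c b \<cdot> BB (BB h ?u) g", OF _ _ g])
    fix v :: "'v word" assume v: "word_degree v = b"
    let ?v = "vec v :: 'v word \<Rightarrow>\<^sub>0 'k"
    show "ks a c \<cdot> BB (BB ?u ?v) h + ks b a \<cdot> BB (BB ?v h) ?u + ks c b \<cdot> BB (BB h ?u) ?v = 0"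
    proof (rule lin_eqI_homog[where \<psi> = "\<lambda>f. 0" and
        \<phi> = "\<lambda>h. ks a c \<cdot> BB (BB ?u ?v) h + ks b a \<cdot> BB (BB ?v h) ?u + ks c b \<cdot> BB (BB h ?u) ?v", OF _ _ h])
      fix w :: "'v word" assume w: "word_degree w = c"
      show "ks a c \<cdot> BB (BB ?u ?v) (vec w) + ks b a \<cdot> BB (BB ?v (vec w)) ?u +
          ks c b \<cdot> BB (BB (vec w) ?u) ?v = 0"
        using jacobi_words[of u w v] unfolding u v w .
    qed (simp_all add: lin_rules)
  qed (simp_all add: lin_rules)
qed (simp_all add: lin_rules)

end

section \<open>The operator \<open>\<mu>\<close> on words\<close>

text \<open>Kept apart from the rest of \<mu>: when \<mu> meets a shuffle product, the term that
  multiplies the first two letters needs an analysis of its own.\<close>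

fun merge_head :: "(int \<times> 'v \<Rightarrow> int \<times> 'v \<Rightarrow> (int \<times> 'v \<Rightarrow>\<^sub>0 'k::field_char_0)) \<Rightarrow>
    int \<times> 'v \<Rightarrow> 'v word \<Rightarrow> ('v word \<Rightarrow>\<^sub>0 'k)" where
  "merge_head m2 x [] = 0"
| "merge_head m2 x (y # w) = prepend (m2 x y) (vec w)"

fun merge_mu :: "(int \<times> 'v \<Rightarrow> int \<times> 'v \<Rightarrow> (int \<times> 'v \<Rightarrow>\<^sub>0 'k::field_char_0)) \<Rightarrow>
    'v word \<Rightarrow> ('v word \<Rightarrow>\<^sub>0 'k)" where
  "merge_mu m2 [] = 0"
| "merge_mu m2 (x # w) = merge_head m2 x w + ks 1 (fst x) \<cdot> prepend (vec x) (merge_mu m2 w)"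

definition Merge_head where
  "Merge_head m2 l f = linear_extension (\<lambda>x. linear_extension (merge_head m2 x) f) l"

lemma lin_Merge_head [simp]: "lin (\<lambda>l. Merge_head m2 l f)" "lin (Merge_head m2 l)"
  unfolding Merge_head_def by (simp_all add: lin_linear_extension_param)

lemmas Merge_head_lin [simp] = linD[OF lin_Merge_head(1)] linD[OF lin_Merge_head(2)]
lemmas Merge_head_rules = lin_rules lin_compose[OF lin_Merge_head(1)] lin_compose[OF lin_Merge_head(2)]

lemma Merge_head_prepend: "Merge_head m2 l (prepend m g) = prepend (bilinear_extension m2 l m) g"
proof (rule lin_eqI[where \<phi> = "\<lambda>l. Merge_head m2 l (prepend m g)"])
  fix x
  show "Merge_head m2 (vec x) (prepend m g) = prepend (bilinear_extension m2 (vec x) m) g"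
  proof (rule lin_eqI[where \<phi> = "\<lambda>m. Merge_head m2 (vec x) (prepend m g)"])
    fix y
    show "Merge_head m2 (vec x) (prepend (vec y) g) = prepend (bilinear_extension m2 (vec x) (vec y)) g"
      by (rule lin_eqI[where \<phi> = "\<lambda>g. Merge_head m2 (vec x) (prepend (vec y) g)"])
        (simp_all add: Merge_head_rules, simp add: prepend_vec Merge_head_def)
  qed (simp_all add: Merge_head_rules)
qed (simp_all add: Merge_head_rules)

lemma Merge_head_Nil [simp]: "Merge_head m2 l (vec []) = 0"
  by (simp add: Merge_head_def linear_extension_def)

locale homog_product =
  fixes m2 :: "int \<times> 'v \<Rightarrow> int \<times> 'v \<Rightarrow> (int \<times> 'v \<Rightarrow>\<^sub>0 'k::field_char_0)"
  assumes homl_m2: "homl (fst x + fst y + 1) (m2 x y)"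
begin

abbreviation M where "M \<equiv> linear_extension (merge_mu m2)"
abbreviation MM where "MM \<equiv> bilinear_extension m2"

lemma M_prepend:
  assumes "homl d l"
  shows "M (prepend l f) = Merge_head m2 l f + ks 1 d \<cdot> prepend l (M f)"
proof (rule lin_eqI_homog[where \<phi> = "\<lambda>l. M (prepend l f)", OF _ _ assms])
  fix x :: "int \<times> 'v" assume "fst x = d"
  then show "M (prepend (vec x) f) = Merge_head m2 (vec x) f + ks 1 d \<cdot> prepend (vec x) (M f)"
    by (intro lin_eqI[where \<phi> = "\<lambda>f. M (prepend (vec x) f)", of _ f])
      (simp_all add: Merge_head_rules, simp add: prepend_vec Merge_head_def)
qed (simp_all add: Merge_head_rules)

lemma homog_merge_head: "homw (fst x + word_degree w + 1) (merge_head m2 x w)"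
proof (cases w)
  case (Cons y v)
  then show ?thesis
    using homog_prepend[OF homl_m2[of x y] homog_vec[of word_degree v]] by (simp add: algebra_simps)
qed simp

lemma homog_Merge_head:
  assumes l: "homl d l" and f: "homw e f"
  shows "homw (d + e + 1) (Merge_head m2 l f)"
  unfolding Merge_head_def
proof (rule homog_linear_extension[OF l], rule homog_linear_extension[OF f])
  fix x :: "int \<times> 'v" and w :: "'v word"
  assume "fst x = d" "word_degree w = e"
  then show "homw (d + e + 1) (merge_head m2 x w)" using homog_merge_head[of x w] by simp
qed

lemma homog_merge_mu: "homw (word_degree w + 1) (merge_mu m2 w)"
proof (induction w)
  case (Cons x w)
  then show ?case
    using homog_merge_head[of x w] homog_prepend[OF homog_vec[of fst x] Cons] by (simp add: algebra_simps)
qed simp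

lemma homog_M: "homw d f \<Longrightarrow> homw (d + 1) (M f)"
  by (rule homog_linear_extension) (use homog_merge_mu in auto)

end

text \<open>The degree shift changes the shape of the laws of the product: commutativity becomes
  antisymmetry, and associativity the vanishing of a sum, as for an operation of degree 1.
  \<open>m2_leibniz\<close> has the product in the first argument of the bracket, as it arises when
  \<mu> acts on the left word.\<close>

locale dg_letters = lie_letters lb + homog_product m2
  for lb m2 :: "int \<times> 'v \<Rightarrow> int \<times> 'v \<Rightarrow> (int \<times> 'v \<Rightarrow>\<^sub>0 'k::field_char_0)" +
  assumes m2_antisym: "m2 x y = - (ks (fst x) (fst y) \<cdot> m2 y x)"
    and m2_assoc: "MM (m2 x y) (vec z) + ks 1 (fst x) \<cdot> MM (vec x) (m2 y z) = 0"
    and m2_leibniz: "LL (m2 x y) (vec z) =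
      MM (vec x) (lb y z) + ks (fst z) (fst y) \<cdot> MM (lb x z) (vec y)"
begin

text \<open>Products at disjoint places cancel because \<mu> is odd; overlapping ones in front give
  \<open>(x y) z\<close> and \<open>x (y z)\<close>, which cancel by \<open>m2_assoc\<close>; the
  remaining terms lie behind \<open>x\<close> and vanish by induction.\<close>

lemma M_M_words: "M (M (vec w)) = 0"
proof (induction w)
  case (Cons x w)
  have 1: "M (vec (x # w)) = Merge_head m2 (vec x) (vec w) + ks 1 (fst x) \<cdot> prepend (vec x) (M (vec w))"
    unfolding prepend_vec[symmetric] by (rule M_prepend) simp
  show ?case
  proof (cases w)
    case Nil
    then show ?thesis unfolding 1 by simp
  next
    case w: (Cons y g)
    have *: "Merge_head m2 (m2 x y) (vec g) + ks 1 (fst x) \<cdot> Merge_head m2 (vec x) (Merge_head m2 (vec y) (vec g)) = 0"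
    proof (cases g)
      case (Cons z h)
      show ?thesis
        using arg_cong[OF m2_assoc[of x y z], of "\<lambda>l. prepend l (vec h)"]
        unfolding Cons prepend_vec[symmetric] Merge_head_prepend by simp
    qed simp
    have 2: "M (vec w) = Merge_head m2 (vec y) (vec g) + ks 1 (fst y) \<cdot> prepend (vec y) (M (vec g))"
      unfolding w prepend_vec[symmetric] by (rule M_prepend) simp
    have 3: "Merge_head m2 (vec x) (vec w) = prepend (m2 x y) (vec g)"
      unfolding w prepend_vec[symmetric] Merge_head_prepend by simp
    have 4: "Merge_head m2 (vec x) (M (vec w)) =
        Merge_head m2 (vec x) (Merge_head m2 (vec y) (vec g)) + ks 1 (fst y) \<cdot> prepend (m2 x y) (M (vec g))"
      unfolding 2 by (simp add: Merge_head_prepend)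
    have "M (M (vec (x # w))) = Merge_head m2 (m2 x y) (vec g) + ks 1 (fst x) \<cdot> Merge_head m2 (vec x) (Merge_head m2 (vec y) (vec g))"
      unfolding 1 3
      by (simp only: linear_extension_add linear_extension_scale M_prepend[OF homl_m2]
        M_prepend[OF homog_vec[of fst x]] Cons.IH 4)
        (simp add: fscale_simps ks_simps)
    then show ?thesis using * by simp
  qed
qed simp

lemma M_M: "M (M f) = 0"
  by (rule lin_eqI[where \<psi> = "\<lambda>f. 0" and \<phi> = "\<lambda>f. M (M f)"])
    (simp add: Merge_head_rules, simp, rule M_M_words)

text \<open>\<open>x\<close> is multiplied with the first letter of a shuffle, which comes from
  \<open>u\<close> or is \<open>y\<close>. The former case is the shuffle of
  \<open>Merge_head m2 (vec x) (vec u)\<close> with \<open>y # v\<close>, less the terms in which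
  \<open>y\<close> would precede the product.\<close>

lemma Merge_head_SH_prepend:
  "Merge_head m2 (vec x) (SH (vec u) (vec (y # v))) = SH (Merge_head m2 (vec x) (vec u)) (vec (y # v))
    - ks (fst y) (fst x + word_degree u + 1) \<cdot> prepend (vec y) (SH (Merge_head m2 (vec x) (vec u)) (vec v))
    + ks (fst y) (word_degree u) \<cdot> prepend (m2 x y) (SH (vec u) (vec v))"
proof (cases u)
  case Nil
  have "Merge_head m2 (vec x) (vec (y # v)) = prepend (m2 x y) (vec v)"
    unfolding prepend_vec[symmetric] Merge_head_prepend by simp
  then show ?thesis by (simp add: Nil del: bilinear_extension_single)
next
  case (Cons z w)
  have 1: "Merge_head m2 (vec x) (vec u) = prepend (m2 x z) (vec w)"
    unfolding Cons prepend_vec[symmetric] Merge_head_prepend by simp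
  have 2: "SH (vec u) (vec (y # v)) = prepend (vec z) (SH (vec w) (vec (y # v))) +
      ks (fst y) (word_degree u) \<cdot> prepend (vec y) (SH (vec u) (vec v))"
    unfolding Cons by simp
  have 3: "SH (prepend (m2 x z) (vec w)) (vec (y # v)) = prepend (m2 x z) (SH (vec w) (vec (y # v))) +
      ks (fst y) (fst x + word_degree u + 1) \<cdot> prepend (vec y) (SH (prepend (m2 x z) (vec w)) (vec v))"
    using SH_prepend_vec[of "m2 x z" "vec w" y "vec v"]
    by (simp add: prepend_vec twist_homog[OF homog_prepend[OF homl_m2 homog_vec]] Cons add_ac
      del: bilinear_extension_single)
  show ?thesis unfolding 1 3 unfolding 2 by (simp add: Merge_head_prepend del: bilinear_extension_single) simp
qed

text \<open>Here graded commutativity enters: products of a letter of \<open>u\<close> with a letter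
  of \<open>v\<close> occur in both orders and cancel by \<open>m2_antisym\<close>, which leaves the
  products inside \<open>u\<close> and inside \<open>v\<close>. The same argument underlies the
  Harrison complex of a commutative algebra.\<close>

lemma M_SH_words:
  "M (SH (vec u) (vec v)) = SH (M (vec u)) (vec v) + ks 1 (word_degree u) \<cdot> SH (vec u) (M (vec v))"
proof (induction u v rule: shuffle.induct)
  case (3 x u y v)
  define X Y U V :: "'v word \<Rightarrow>\<^sub>0 'k" where
    defs: "X = vec (x # u)" "Y = vec (y # v)" "U = vec u" "V = vec v"
  have cls: "X = prepend (vec x) U" "Y = prepend (vec y) V"
    by (simp_all add: defs prepend_vec)
  have "homw (word_degree (x # u)) X" "homw (word_degree (y # v)) Y"
    and homs: "homw (word_degree u) U" "homw (word_degree v) V"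
    unfolding defs by (rule homog_vec)+
  then have hom: "homw (fst x + word_degree u) X" "homw (fst y + word_degree v) Y"
    by simp_all
  note IH = 3[folded defs]
  have MX: "M X = Merge_head m2 (vec x) U + ks 1 (fst x) \<cdot> prepend (vec x) (M U)"
    unfolding cls by (rule M_prepend) simp
  have MY: "M Y = Merge_head m2 (vec y) V + ks 1 (fst y) \<cdot> prepend (vec y) (M V)"
    unfolding cls by (rule M_prepend) simp
  have XA: "SH X (prepend (vec y) G) = prepend (vec x) (SH U (prepend (vec y) G)) +
      ks (fst y) (fst x + word_degree u) \<cdot> prepend (vec y) (SH X G)" for y G
    using SH_prepend_vec[of "vec x" U y G] unfolding cls(1)[symmetric] by (simp add: twist_homog[OF hom(1)])
  have XY: "SH X Y = prepend (vec x) (SH U Y) + ks (fst y) (fst x + word_degree u) \<cdot> prepend (vec y) (SH X V)"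
    unfolding cls(2) by (rule XA)
  have MUY: "SH (prepend (vec x) (M U)) Y = prepend (vec x) (SH (M U) Y) +
      ks (fst y) (fst x + word_degree u + 1) \<cdot> prepend (vec y) (SH (prepend (vec x) (M U)) V)"
    unfolding cls(2) SH_prepend_vec
    by (simp add: twist_homog[OF homog_prepend[OF homog_vec homog_M[OF homs(1)]]] add_ac)
  have H1: "Merge_head m2 (vec x) (SH U Y) = SH (Merge_head m2 (vec x) U) Y
    - ks (fst y) (fst x + word_degree u + 1) \<cdot> prepend (vec y) (SH (Merge_head m2 (vec x) U) V)
    + ks (fst y) (word_degree u) \<cdot> prepend (m2 x y) (SH U V)"
    unfolding defs by (rule Merge_head_SH_prepend)
  \<comment> \<open>Commuting the factors makes the word that starts with \<open>x\<close> the
    second one, so that \<open>Merge_head_SH_prepend\<close> applies with the roles of the two words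
    exchanged.\<close>
  have "Merge_head m2 (vec y) (SH X V) = ks (fst x + word_degree u) (word_degree v) \<cdot> Merge_head m2 (vec y) (SH V X)"
    unfolding SH_commute[OF hom(1) homs(2)] by simp
  also have "Merge_head m2 (vec y) (SH V X) = SH (Merge_head m2 (vec y) V) X
    - ks (fst x) (fst y + word_degree v + 1) \<cdot> prepend (vec x) (SH (Merge_head m2 (vec y) V) U)
    + ks (fst x) (word_degree v) \<cdot> prepend (m2 y x) (SH V U)"
    unfolding defs by (rule Merge_head_SH_prepend)
  finally have H2: "Merge_head m2 (vec y) (SH X V) = ks (fst x + word_degree u) (word_degree v) \<cdot>
    (SH (Merge_head m2 (vec y) V) X
    - ks (fst x) (fst y + word_degree v + 1) \<cdot> prepend (vec x) (SH (Merge_head m2 (vec y) V) U)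
    + ks (fst x) (word_degree v) \<cdot> prepend (m2 y x) (SH V U))" .
  note C = SH_commute[OF homog_Merge_head[OF homog_vec[of fst y] homs(2)] hom(1)]
    SH_commute[OF homog_Merge_head[OF homog_vec[of fst y] homs(2)] homs(1)] SH_commute[OF homs(2,1)]
  have "M (SH X Y) = Merge_head m2 (vec x) (SH U Y) + ks 1 (fst x) \<cdot> prepend (vec x) (M (SH U Y)) +
      ks (fst y) (fst x + word_degree u) \<cdot>
        (Merge_head m2 (vec y) (SH X V) + ks 1 (fst y) \<cdot> prepend (vec y) (M (SH X V)))"
    unfolding XY by (simp add: M_prepend[OF homog_vec])
  also have "\<dots> = SH (M X) Y + ks 1 (fst x + word_degree u) \<cdot> SH X (M Y)"
    unfolding H1 H2 IH C m2_antisym[of y x]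
    by (simp add: MX MY XA MUY fscale_simps ks_simps)
  finally show ?case by (simp add: defs del: bilinear_extension_single linear_extension_single)
qed simp_all

text \<open>The terms of \<open>Merge_head l (SH u V)\<close> in which \<open>l\<close> is multiplied with the first letter of \<open>u\<close>.\<close>

fun Merge_left where
  "Merge_left l [] V = 0"
| "Merge_left l (x # u) V = prepend (MM l (vec x)) (SH (vec u) V)"

lemma Merge_left_scale: "Merge_left (c \<cdot> l) u V = c \<cdot> Merge_left l u V" "Merge_left (- l) u V = - Merge_left l u V"
  by (cases u; simp)+

text \<open>The first letter of the shuffle comes from \<open>u\<close> or from \<open>v\<close>.
  Unlike \<open>Merge_head_SH_prepend\<close>, this splitting is symmetric, as needed for a
  bracketed letter followed by a shuffle of both tails.\<close>

lemma Merge_head_SH: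
  "Merge_head m2 l (SH (vec u) (vec v)) =
    Merge_left l u (vec v) + ks (word_degree u) (word_degree v) \<cdot> Merge_left l v (vec u)"
proof (cases "u = [] \<or> v = []")
  case True
  have "Merge_head m2 l (vec w) = Merge_left l w (vec [])" for w
    by (cases w) (simp_all add: Merge_head_prepend flip: prepend_vec del: bilinear_extension_single)
  then show ?thesis using True by (auto simp del: bilinear_extension_single)
next
  case False
  then obtain x u' y v' where eq: "u = x # u'" "v = y # v'"
    by (auto simp: neq_Nil_conv)
  have "SH (vec u) (vec v) = prepend (vec x) (SH (vec u') (vec v)) +
      ks (fst y) (word_degree u) \<cdot> prepend (vec y) (SH (vec u) (vec v'))"
    unfolding eq by simp
  also have "SH (vec u) (vec v') = ks (word_degree u) (word_degree v') \<cdot> SH (vec v') (vec u)"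
    by (rule SH_commute homog_vec)+
  finally have 1: "SH (vec u) (vec v) = prepend (vec x) (SH (vec u') (vec v)) +
      ks (fst y) (word_degree u) \<cdot> prepend (vec y) (ks (word_degree u) (word_degree v') \<cdot> SH (vec v') (vec u))" .
  have 2: "Merge_left l u (vec v) = prepend (MM l (vec x)) (SH (vec u') (vec v))"
    "Merge_left l v (vec u) = prepend (MM l (vec y)) (SH (vec v') (vec u))"
    "word_degree v = fst y + word_degree v'"
    by (simp_all add: eq del: bilinear_extension_single)
  show ?thesis
    unfolding 1 2 by (simp add: Merge_head_prepend fscale_simps ks_simps del: bilinear_extension_single)
qed

text \<open>As for shuffles, with one new effect: if \<open>u\<close> begins with \<open>z\<close>,
  the product of \<open>x\<close> and \<open>z\<close> may be bracketed with \<open>y\<close>. The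
  Leibniz rule yields \<open>x [z, y]\<close>, which occurs on the left, and
  \<open>[x, y] z\<close>, which does not and is removed by the \<open>Merge_left\<close>
  term.\<close>

lemma Merge_head_BB_prepend:
  "Merge_head m2 (vec x) (BB (vec u) (vec (y # v))) = BB (Merge_head m2 (vec x) (vec u)) (vec (y # v))
    - ks (fst y) (fst x + word_degree u + 1) \<cdot> prepend (vec y) (BB (Merge_head m2 (vec x) (vec u)) (vec v))
    + ks (fst y) (word_degree u) \<cdot> prepend (m2 x y) (BB (vec u) (vec v))
    - ks (fst y) (word_degree u) \<cdot> Merge_left (lb x y) u (vec v)"
proof (cases u)
  case Nil
  then show ?thesis by (simp del: bilinear_extension_single)
next
  case (Cons z w)
  have 1: "Merge_head m2 (vec x) (vec u) = prepend (m2 x z) (vec w)"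
    unfolding Cons prepend_vec[symmetric] Merge_head_prepend by simp
  have 2: "BB (vec u) (vec (y # v)) = prepend (vec z) (BB (vec w) (vec (y # v))) +
      ks (fst y) (word_degree u) \<cdot> prepend (vec y) (BB (vec u) (vec v)) +
      ks (fst y) (word_degree w) \<cdot> prepend (lb z y) (SH (vec w) (vec v))"
    unfolding Cons by simp
  have 3: "BB (prepend (m2 x z) (vec w)) (vec (y # v)) = prepend (m2 x z) (BB (vec w) (vec (y # v))) +
      ks (fst y) (fst x + word_degree u + 1) \<cdot> prepend (vec y) (BB (prepend (m2 x z) (vec w)) (vec v)) +
      ks (fst y) (word_degree w) \<cdot> prepend (LL (m2 x z) (vec y)) (SH (vec w) (vec v))"
    using BB_prepend_vec[of "m2 x z" "vec w" y "vec v"]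
    by (simp add: prepend_vec twist_homog[OF homog_prepend[OF homl_m2 homog_vec]] twist_vec Cons add_ac
      del: bilinear_extension_single)
  show ?thesis unfolding 1 3 unfolding 2 m2_leibniz
    by (simp add: Merge_head_prepend Cons fscale_simps ks_simps del: bilinear_extension_single) simp
qed

text \<open>Mixed products of \<open>x\<close> and \<open>y\<close> cancel by antisymmetry as in
  \<open>M_SH_words\<close>. The \<open>Merge_left\<close> corrections of \<open>H1\<close> and
  \<open>H2\<close> cancel against the terms in \<open>H3\<close>, where \<mu> multiplies the letter
  \<open>lb x y\<close> with its right neighbour.\<close>

lemma M_BB_words:
  "M (BB (vec u) (vec v)) = BB (M (vec u)) (vec v) + ks 1 (word_degree u) \<cdot> BB (vec u) (M (vec v))"
proof (induction u v rule: shuffle.induct)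
  case (3 x u y v)
  define X Y U V :: "'v word \<Rightarrow>\<^sub>0 'k" where
    defs: "X = vec (x # u)" "Y = vec (y # v)" "U = vec u" "V = vec v"
  have cls: "X = prepend (vec x) U" "Y = prepend (vec y) V"
    by (simp_all add: defs prepend_vec)
  have "homw (word_degree (x # u)) X" "homw (word_degree (y # v)) Y"
    and homs: "homw (word_degree u) U" "homw (word_degree v) V"
    unfolding defs by (rule homog_vec)+
  then have hom: "homw (fst x + word_degree u) X" "homw (fst y + word_degree v) Y"
    by simp_all
  note IH = 3[folded defs]
  have IHS: "M (SH U V) = SH (M U) V + ks 1 (word_degree u) \<cdot> SH U (M V)"
    unfolding defs by (rule M_SH_words)
  have MX: "M X = Merge_head m2 (vec x) U + ks 1 (fst x) \<cdot> prepend (vec x) (M U)"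
    unfolding cls by (rule M_prepend) simp
  have MY: "M Y = Merge_head m2 (vec y) V + ks 1 (fst y) \<cdot> prepend (vec y) (M V)"
    unfolding cls by (rule M_prepend) simp
  have XA: "BB X (prepend (vec y) G) = prepend (vec x) (BB U (prepend (vec y) G)) +
      ks (fst y) (fst x + word_degree u) \<cdot> prepend (vec y) (BB X G) +
      ks (fst y) (word_degree u) \<cdot> prepend (lb x y) (SH U G)" for y G
    using BB_prepend_vec[of "vec x" U y G] unfolding cls(1)[symmetric]
    by (simp add: twist_homog[OF hom(1)] twist_homog[OF homs(1)])
  have XY: "BB X Y = prepend (vec x) (BB U Y) + ks (fst y) (fst x + word_degree u) \<cdot> prepend (vec y) (BB X V) +
      ks (fst y) (word_degree u) \<cdot> prepend (lb x y) (SH U V)"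
    unfolding cls(2) by (rule XA)
  have MUY: "BB (prepend (vec x) (M U)) Y = prepend (vec x) (BB (M U) Y) +
      ks (fst y) (fst x + word_degree u + 1) \<cdot> prepend (vec y) (BB (prepend (vec x) (M U)) V) +
      ks (fst y) (word_degree u + 1) \<cdot> prepend (lb x y) (SH (M U) V)"
    unfolding cls(2) BB_prepend_vec
    by (simp add: twist_homog[OF homog_prepend[OF homog_vec homog_M[OF homs(1)]]] twist_homog[OF homog_M[OF homs(1)]] add_ac)
  have H1: "Merge_head m2 (vec x) (BB U Y) = BB (Merge_head m2 (vec x) U) Y
    - ks (fst y) (fst x + word_degree u + 1) \<cdot> prepend (vec y) (BB (Merge_head m2 (vec x) U) V)
    + ks (fst y) (word_degree u) \<cdot> prepend (m2 x y) (BB U V)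
    - ks (fst y) (word_degree u) \<cdot> Merge_left (lb x y) u V"
    unfolding defs by (rule Merge_head_BB_prepend)
  have "Merge_head m2 (vec y) (BB X V) = - (ks (fst x + word_degree u) (word_degree v) \<cdot> Merge_head m2 (vec y) (BB V X))"
    unfolding BB_antisym[OF hom(1) homs(2)] by simp
  also have "Merge_head m2 (vec y) (BB V X) = BB (Merge_head m2 (vec y) V) X
    - ks (fst x) (fst y + word_degree v + 1) \<cdot> prepend (vec x) (BB (Merge_head m2 (vec y) V) U)
    + ks (fst x) (word_degree v) \<cdot> prepend (m2 y x) (BB V U)
    - ks (fst x) (word_degree v) \<cdot> Merge_left (lb y x) v U"
    unfolding defs by (rule Merge_head_BB_prepend)
  finally have H2: "Merge_head m2 (vec y) (BB X V) = - (ks (fst x + word_degree u) (word_degree v) \<cdot>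
    (BB (Merge_head m2 (vec y) V) X
    - ks (fst x) (fst y + word_degree v + 1) \<cdot> prepend (vec x) (BB (Merge_head m2 (vec y) V) U)
    + ks (fst x) (word_degree v) \<cdot> prepend (m2 y x) (BB V U)
    - ks (fst x) (word_degree v) \<cdot> Merge_left (lb y x) v U))" .
  have H3: "Merge_head m2 (lb x y) (SH U V) = Merge_left (lb x y) u V + ks (word_degree u) (word_degree v) \<cdot> Merge_left (lb x y) v U"
    unfolding defs by (rule Merge_head_SH)
  note C = BB_antisym[OF homog_Merge_head[OF homog_vec[of fst y] homs(2)] hom(1)]
    BB_antisym[OF homog_Merge_head[OF homog_vec[of fst y] homs(2)] homs(1)] BB_antisym[OF homs(2,1)]
  have "M (BB X Y) = Merge_head m2 (vec x) (BB U Y) + ks 1 (fst x) \<cdot> prepend (vec x) (M (BB U Y)) +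
      ks (fst y) (fst x + word_degree u) \<cdot>
        (Merge_head m2 (vec y) (BB X V) + ks 1 (fst y) \<cdot> prepend (vec y) (M (BB X V))) +
      ks (fst y) (word_degree u) \<cdot>
        (Merge_head m2 (lb x y) (SH U V) + ks 1 (fst x + fst y) \<cdot> prepend (lb x y) (M (SH U V)))"
    unfolding XY by (simp add: M_prepend[OF homog_vec] M_prepend[OF homl_lb])
  also have "\<dots> = BB (M X) Y + ks 1 (fst x + word_degree u) \<cdot> BB X (M Y)"
    unfolding H1 H2 H3 IH IHS C m2_antisym[of y x] lb_antisym[of y x] Merge_left_scale
    by (simp add: MX MY XA MUY fscale_simps ks_simps)
  finally show ?case by (simp add: defs del: bilinear_extension_single linear_extension_single)
qed (simp_all del: bilinear_extension_single linear_extension_single, simp_all)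

lemma M_SH:
  assumes f: "homw a f"
  shows "M (SH f g) = SH (M f) g + ks 1 a \<cdot> SH f (M g)"
proof (rule lin_eqI_homog[where \<phi> = "\<lambda>f. M (SH f g)", OF _ _ f])
  fix u :: "'v word" assume u: "word_degree u = a"
  show "M (SH (vec u) g) = SH (M (vec u)) g + ks 1 a \<cdot> SH (vec u) (M g)"
  proof (rule lin_eqI[where \<phi> = "\<lambda>g. M (SH (vec u) g)"])
    show "M (SH (vec u) (vec v)) = SH (M (vec u)) (vec v) + ks 1 a \<cdot> SH (vec u) (M (vec v))" for v
      using M_SH_words[of u v] unfolding u .
  qed (simp_all add: lin_rules)
qed (simp_all add: lin_rules)

lemma M_BB:
  assumes f: "homw a f"
  shows "M (BB f g) = BB (M f) g + ks 1 a \<cdot> BB f (M g)"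
proof (rule lin_eqI_homog[where \<phi> = "\<lambda>f. M (BB f g)", OF _ _ f])
  fix u :: "'v word" assume u: "word_degree u = a"
  show "M (BB (vec u) g) = BB (M (vec u)) g + ks 1 a \<cdot> BB (vec u) (M g)"
  proof (rule lin_eqI[where \<phi> = "\<lambda>g. M (BB (vec u) g)"])
    show "M (BB (vec u) (vec v)) = BB (M (vec u)) (vec v) + ks 1 a \<cdot> BB (vec u) (M (vec v))" for v
      using M_BB_words[of u v] unfolding u .
  qed (simp_all add: lin_rules)
qed (simp_all add: lin_rules)

end

section \<open>Sums over \<open>Bat\<close> as recursions\<close>

text \<open>Turns sortedness of a sublist into an order of positions; this gives the monotonicity of
  the permutation recovered from a shuffle.\<close>

lemma sorted_wrt_filter_nth:
  assumes "sorted_wrt R (filter P zs)" "j < i" "i < length zs" "P (zs ! j)" "P (zs ! i)"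
  shows "R (zs ! j) (zs ! i)"
proof -
  have "filter P zs = filter P (take i zs) @ zs ! i # filter P (drop (Suc i) zs)"
    using arg_cong[OF id_take_nth_drop[OF assms(3)], of "filter P"]
    by (simp only: filter_append filter.simps assms(5) if_True)
  moreover have "zs ! j \<in> set (filter P (take i zs))"
    using assms(2,3,4) by (auto simp: in_set_conv_nth intro!: exI[of _ j])
  ultimately show ?thesis using assms(1) by (auto simp: sorted_wrt_append)
qed

text \<open>\<open>\<sigma>\<close> sends a letter to its new place, so its inverse lists the
  letters in their new order; monotonicity on the two blocks says that each block keeps its original
  order in this list. In contrast to \<open>Bat\<close>, \<open>shuffles\<close> is recursive in the
  first elements.\<close>

lemma bij_betw_Bat_shuffles:
  "bij_betw (\<lambda>\<sigma>. map (inv_into UNIV \<sigma>) [0..<p + q]) (Bat p q) (shuffles [0..<p] [p..<p + q])"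
proof (rule bij_betwI')
  fix \<sigma> \<tau> assume "\<sigma> \<in> Bat p q" "\<tau> \<in> Bat p q"
  then have perm: "\<sigma> permutes {..<p + q}" "\<tau> permutes {..<p + q}"
    by (auto simp: Bat_def)
  show "(map (inv_into UNIV \<sigma>) [0..<p + q] = map (inv_into UNIV \<tau>) [0..<p + q]) \<longleftrightarrow> \<sigma> = \<tau>"
  proof
    assume *: "map (inv_into UNIV \<sigma>) [0..<p + q] = map (inv_into UNIV \<tau>) [0..<p + q]"
    have "inv_into UNIV \<sigma> i = inv_into UNIV \<tau> i" for i
    proof (cases "i < p + q")
      case False
      then show ?thesis
        using permutes_inv[OF perm(1)] permutes_inv[OF perm(2)] by (simp add: permutes_not_in)
    qed (use * in simp)
    then have "inv_into UNIV \<sigma> = inv_into UNIV \<tau>" by blast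
    then show "\<sigma> = \<tau>" by (metis perm permutes_inv_inv)
  qed simp
next
  fix \<sigma> assume "\<sigma> \<in> Bat p q"
  then have perm: "\<sigma> permutes {..<p + q}" and mono: "strict_mono_on {..<p} \<sigma>" "strict_mono_on {p..<p + q} \<sigma>"
    by (auto simp: Bat_def)
  define \<pi> where "\<pi> = inv_into UNIV \<sigma>"
  have \<pi>: "\<pi> permutes {..<p + q}" and \<sigma>\<pi>: "\<sigma> (\<pi> i) = i" for i
    using perm by (simp_all add: \<pi>_def permutes_inv permutes_inverses(1))
  define zs where "zs = map \<pi> [0..<p + q]"
  have zs: "distinct zs" "set zs = {0..<p + q}"
    using permutes_inj_on[OF \<pi>] permutes_image[OF \<pi>]
    by (simp_all add: zs_def distinct_map lessThan_atLeast0)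
  have *: "sorted (filter P zs)" if "\<And>a b. P a \<Longrightarrow> P b \<Longrightarrow> b < a \<Longrightarrow> a < p + q \<Longrightarrow> \<sigma> b < \<sigma> a" for P
  proof -
    have "sorted_wrt (\<lambda>i j. \<pi> i \<le> \<pi> j) (filter (P \<circ> \<pi>) [0..<p + q])"
    proof (rule sorted_wrt_mono_rel[of _ "(<)"])
      fix i j assume ij: "i \<in> set (filter (P \<circ> \<pi>) [0..<p + q])" "j \<in> set (filter (P \<circ> \<pi>) [0..<p + q])" "i < j"
      show "\<pi> i \<le> \<pi> j"
      proof (rule ccontr)
        assume "\<not> \<pi> i \<le> \<pi> j"
        then have "\<sigma> (\<pi> j) < \<sigma> (\<pi> i)"
          using ij permutes_in_image[OF \<pi>, of i] by (intro that) auto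
        then show False using \<open>i < j\<close> by (simp add: \<sigma>\<pi>)
      qed
    qed (intro sorted_wrt_filter, simp)
    then show ?thesis by (simp add: zs_def filter_map sorted_wrt_map)
  qed
  have "filter (\<lambda>i. i < p) zs = [0..<p]"
    using zs by (intro sorted_distinct_set_unique *) (auto intro: strict_mono_onD[OF mono(1)])
  moreover have "filter (\<lambda>i. \<not> i < p) zs = [p..<p + q]"
    using zs by (intro sorted_distinct_set_unique *) (auto intro: strict_mono_onD[OF mono(2)])
  ultimately show "map (inv_into UNIV \<sigma>) [0..<p + q] \<in> shuffles [0..<p] [p..<p + q]"
    using partition_in_shuffles[of zs "\<lambda>i. i < p"] by (simp add: zs_def \<pi>_def)
next
  fix zs assume zs: "zs \<in> shuffles [0..<p] [p..<p + q]"
  have disj: "set [0..<p] \<inter> set [p..<p + q] = {}"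
    by auto
  note dist = distinct_disjoint_shuffles[OF distinct_upt distinct_upt disj zs]
  have len: "length zs = p + q" and set: "set zs = {..<p + q}"
    using length_shuffles[OF zs] set_shuffles[OF zs] by auto
  note filter = filter_shuffles_disjoint1[OF disj zs]
  have sorted: "sorted_wrt (<) (filter (\<lambda>x. x \<in> set [0..<p]) zs)"
    "sorted_wrt (<) (filter (\<lambda>x. x \<notin> set [0..<p]) zs)"
    unfolding filter by simp_all
  define \<pi> where "\<pi> = (\<lambda>i. if i < p + q then zs ! i else i)"
  have "bij_betw ((!) zs) {..<p + q} {..<p + q}"
    by (rule bij_betw_nth[OF dist]) (simp_all add: len set)
  then have "bij_betw \<pi> {..<p + q} {..<p + q}"
    using bij_betw_cong[of "{..<p + q}" \<pi> "(!) zs" "{..<p + q}"] by (simp add: \<pi>_def)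
  then have \<pi>: "\<pi> permutes {..<p + q}"
    by (rule bij_imp_permutes) (simp add: \<pi>_def)
  define \<sigma> where "\<sigma> = inv_into UNIV \<pi>"
  have \<sigma>: "\<sigma> permutes {..<p + q}" and inv: "inv_into UNIV \<sigma> = \<pi>" and \<pi>\<sigma>: "\<pi> (\<sigma> a) = a" for a
    using \<pi> by (simp_all add: \<sigma>_def permutes_inv permutes_inv_inv permutes_inverses(1))
  have mono: "\<sigma> a < \<sigma> b" if "sorted_wrt (<) (filter P zs)" "P a" "P b" "a < b" "b < p + q" for P a b
  proof (rule ccontr)
    have lt: "\<sigma> a < p + q" "\<sigma> b < p + q"
      using permutes_in_image[OF \<sigma>, of a] permutes_in_image[OF \<sigma>, of b] that by auto
    then have nth: "zs ! \<sigma> a = a" "zs ! \<sigma> b = b"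
      using \<pi>\<sigma>[of a] \<pi>\<sigma>[of b] by (auto simp: \<pi>_def)
    assume "\<not> \<sigma> a < \<sigma> b"
    moreover have "\<sigma> a \<noteq> \<sigma> b" using \<pi>\<sigma>[of a] \<pi>\<sigma>[of b] that by auto
    ultimately have "\<sigma> b < \<sigma> a" by simp
    from sorted_wrt_filter_nth[OF that(1) this] have "b < a"
      using lt nth that len by auto
    then show False using that by simp
  qed
  have "\<sigma> \<in> Bat p q"
    unfolding Bat_def using \<sigma> mono[OF sorted(1)] mono[OF sorted(2)]
    by (auto intro!: strict_mono_onI)
  moreover have "zs = map (inv_into UNIV \<sigma>) [0..<p + q]"
    unfolding inv using len by (intro nth_equalityI) (auto simp: \<pi>_def)
  ultimately show "\<exists>\<sigma>\<in>Bat p q. zs = map (inv_into UNIV \<sigma>) [0..<p + q]" by blast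
qed

text \<open>The Koszul sign in recursive form: \<open>z\<close> has overtaken exactly the smaller
  entries that still follow it.\<close>

fun shuffle_sign :: "(nat \<Rightarrow> int) \<Rightarrow> nat list \<Rightarrow> 'k::field_char_0" where
  "shuffle_sign d [] = 1"
| "shuffle_sign d (z # zs) = (\<Prod>y | y \<in> set zs \<and> y < z. ks (d z) (d y)) * shuffle_sign d zs"

lemma shuffle_sign_prod:
  assumes "distinct zs"
  shows "(\<Prod>(k, l) | k < l \<and> l < length zs \<and> zs ! l < zs ! k. ks (d (zs ! k)) (d (zs ! l))) =
    (shuffle_sign d zs :: 'k::field_char_0)"
  using assms
proof (induction zs)
  case (Cons z zs)
  let ?I = "\<lambda>zs. {(k, l). k < l \<and> l < length zs \<and> zs ! l < zs ! k}"
  let ?A = "{l. l < length zs \<and> zs ! l < z}"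
  let ?f = "\<lambda>(k, l). ks (d ((z # zs) ! k)) (d ((z # zs) ! l)) :: 'k"
  have fin: "finite (?I zs)"
    by (rule finite_subset[of _ "{..<length zs} \<times> {..<length zs}"]) auto
  have eq: "?I (z # zs) = Pair 0 ` Suc ` ?A \<union> map_prod Suc Suc ` ?I zs"
  proof (rule Set.set_eqI)
    fix e :: "nat \<times> nat"
    obtain k l where "e = (k, l)" by (cases e)
    then show "e \<in> ?I (z # zs) \<longleftrightarrow> e \<in> Pair 0 ` Suc ` ?A \<union> map_prod Suc Suc ` ?I zs"
      by (cases k; cases l) (auto simp: image_iff)
  qed
  have "prod ?f (?I (z # zs)) = prod ?f (Pair 0 ` Suc ` ?A) * prod ?f (map_prod Suc Suc ` ?I zs)"
    unfolding eq using fin by (intro prod.union_disjoint) auto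
  also have "prod ?f (Pair 0 ` Suc ` ?A) = (\<Prod>l\<in>?A. ks (d z) (d (zs ! l)))"
    by (simp add: prod.reindex inj_on_def)
  also have "\<dots> = (\<Prod>y | y \<in> set zs \<and> y < z. ks (d z) (d y))"
    using Cons.prems by (intro prod.reindex_bij_betw bij_betw_imageI)
      (auto simp: inj_on_def nth_eq_iff_index_eq in_set_conv_nth)
  also have "prod ?f (map_prod Suc Suc ` ?I zs) = shuffle_sign d zs"
    using Cons by (subst prod.reindex) (auto simp: inj_on_def case_prod_unfold)
  finally show ?case by simp
qed simp

lemma shuffle_sign_cong:
  "(\<And>z. z \<in> set zs \<Longrightarrow> d z = e z) \<Longrightarrow> shuffle_sign d zs = shuffle_sign e zs"
  by (induction zs) (simp_all cong: conj_cong prod.cong_simp)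

lemma shuffle_sign_sorted: "sorted_wrt (<) zs \<Longrightarrow> shuffle_sign d zs = 1"
proof (induction zs)
  case (Cons z zs)
  then have "{y. y \<in> set zs \<and> y < z} = {}" by force
  then show ?case using Cons by (simp del: Collect_empty_eq)
qed simp

lemma ks_sum: "finite A \<Longrightarrow> (\<Prod>y\<in>A. ks a (d y)) = ks a (\<Sum>y\<in>A. d y)"
  by (induction A rule: finite_induct) (simp_all add: ks_add_right)

lemma word_degree_map: "distinct is \<Longrightarrow> word_degree (map f is) = (\<Sum>i\<in>set is. fst (f i))"
  by (simp add: word_degree_def comp_def sum_list_distinct_conv_sum_set)

text \<open>Invariant of the recursion on \<open>[0..<p]\<close> and \<open>[p..<p + q]\<close>:
  both lists remain increasing and all of \<open>is\<close> lies below all of \<open>js\<close>, so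
  the inversions caused by a first entry are known.\<close>

definition split_sorted :: "nat list \<Rightarrow> nat list \<Rightarrow> bool" where
  "split_sorted is js \<longleftrightarrow> sorted_wrt (<) (is @ js)"

lemma split_sorted_Cons:
  assumes "split_sorted (i # is) (j # js)"
  shows "split_sorted is (j # js)" "split_sorted (i # is) js" "split_sorted is js" "i \<noteq> j"
    "\<And>k. k \<in> set is \<union> set (j # js) \<Longrightarrow> i < k" "\<And>k. k \<in> set js \<Longrightarrow> j < k"
    "\<And>k. k \<in> set (i # is) \<Longrightarrow> k < j" "distinct (i # is)"
  using assms by (auto simp: split_sorted_def sorted_wrt_append strict_sorted_iff)

lemma shuffle_sign_Cons_left:
  assumes "split_sorted (i # is) (j # js)" "zs \<in> shuffles is (j # js)"
  shows "shuffle_sign d (i # zs) = shuffle_sign d zs"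
proof -
  have "{y. y \<in> set zs \<and> y < i} = {}"
    using split_sorted_Cons(5)[OF assms(1)] set_shuffles[OF assms(2)] by force
  then show ?thesis by (simp del: Collect_empty_eq)
qed

text \<open>The smaller entries that \<open>j\<close> overtakes are exactly those of
  \<open>is\<close>, and their degrees add up to the degree of the word they spell.\<close>

lemma shuffle_sign_Cons_right:
  assumes "sorted_wrt (<) (is @ j # js)" "zs \<in> shuffles is js"
  shows "shuffle_sign (fst \<circ> f) (j # zs) =
    ks (fst (f j)) (word_degree (map f is)) * shuffle_sign (fst \<circ> f) zs"
proof -
  have "{y. y \<in> set zs \<and> y < j} = set is"
    using assms(1) set_shuffles[OF assms(2)] by (force simp: sorted_wrt_append)
  moreover have "distinct is"
    using assms(1) by (simp add: sorted_wrt_append strict_sorted_iff)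
  ultimately show ?thesis by (simp add: ks_sum word_degree_map)
qed

lemma sum_shuffles_Cons:
  assumes "i \<noteq> j"
  shows "(\<Sum>zs\<in>shuffles (i # is) (j # js). F zs) =
    (\<Sum>zs\<in>shuffles is (j # js). F (i # zs)) + (\<Sum>zs\<in>shuffles (i # is) js. F (j # zs))"
  using assms by (simp, subst sum.union_disjoint) (auto simp: sum.reindex)

lemma sum_shuffles_eq_shuffle:
  fixes f :: "nat \<Rightarrow> int \<times> 'v"
  assumes "split_sorted is js"
  shows "(\<Sum>zs\<in>shuffles is js. shuffle_sign (fst \<circ> f) zs \<cdot> vec (map f zs)) =
    (shuffle (map f is) (map f js) :: _ \<Rightarrow>\<^sub>0 'k::field_char_0)"
  using assms
proof (induction "is" js rule: shuffles.induct)
  case (1 js)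
  then show ?case by (simp add: split_sorted_def shuffle_sign_sorted)
next
  case (2 "is")
  then show ?case by (simp add: split_sorted_def shuffle_sign_sorted del: shuffle_sign.simps)
next
  case (3 i "is" j js)
  note s = split_sorted_Cons[OF 3(3)]
  have A: "(\<Sum>zs\<in>shuffles is (j # js). shuffle_sign (fst \<circ> f) (i # zs) \<cdot> vec (map f (i # zs))) =
      prepend (vec (f i)) (\<Sum>zs\<in>shuffles is (j # js). shuffle_sign (fst \<circ> f) zs \<cdot> vec (map f zs) :: _ \<Rightarrow>\<^sub>0 'k)"
    unfolding lin_sum[OF lin_prepend(2)]
    by (intro sum.cong refl) (simp add: shuffle_sign_Cons_left[OF 3(3)] prepend_vec del: shuffle_sign.simps)
  have B: "(\<Sum>zs\<in>shuffles (i # is) js. shuffle_sign (fst \<circ> f) (j # zs) \<cdot> vec (map f (j # zs))) =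
      ks (fst (f j)) (word_degree (map f (i # is))) \<cdot>
      prepend (vec (f j)) (\<Sum>zs\<in>shuffles (i # is) js. shuffle_sign (fst \<circ> f) zs \<cdot> vec (map f zs) :: _ \<Rightarrow>\<^sub>0 'k)"
    unfolding lin_sum[OF lin_prepend(2)] fscale.scale_sum_right
    using 3(3) by (intro sum.cong refl)
      (subst shuffle_sign_Cons_right, auto simp: split_sorted_def prepend_vec simp del: shuffle_sign.simps)
  show ?case
    unfolding sum_shuffles_Cons[OF s(4)] A B 3(1)[OF s(1)] 3(2)[OF s(2)] by simp
qed

section \<open>The relations \<open>bat\<close> as recursive shuffle products\<close>

lemma sum_Bat_eq_sum_shuffles:
  "(\<Sum>\<sigma>\<in>Bat p q. F (map (inv_into UNIV \<sigma>) [0..<p + q])) = (\<Sum>zs\<in>shuffles [0..<p] [p..<p + q]. F zs)"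
  by (rule sum.reindex_bij_betw[OF bij_betw_Bat_shuffles])

lemma koszul_eq_shuffle_sign:
  assumes "inj_on \<pi> {..<length as}"
  shows "koszul as \<pi> = shuffle_sign ((!) as) (map \<pi> [0..<length as])"
proof -
  have *: "distinct (map \<pi> [0..<length as])"
    using assms by (simp add: distinct_map lessThan_atLeast0)
  show ?thesis
    unfolding shuffle_sign_prod[OF *, of "(!) as", symmetric] koszul_def ks_def
    by (rule prod.cong) auto
qed

lemma split_sorted_upt: "split_sorted [0..<p] [p..<p + q]"
  by (auto simp: split_sorted_def sorted_wrt_append)

lemma map_nth_append:
  "map ((!) (u @ v)) [0..<length u] = u" "map ((!) (u @ v)) [length u..<length u + length v] = v"
  by (auto intro!: nth_equalityI simp: nth_append)

lemma Bat_inv: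
  assumes "\<sigma> \<in> Bat (length u) (length v)"
  shows "permute_list (inv_into UNIV \<sigma>) (u @ v) =
      map ((!) (u @ v)) (map (inv_into UNIV \<sigma>) [0..<length u + length v])" (is ?A)
    and "koszul (map fst (u @ v)) (inv_into UNIV \<sigma>) =
      shuffle_sign (fst \<circ> (!) (u @ v)) (map (inv_into UNIV \<sigma>) [0..<length u + length v])" (is ?B)
proof -
  have p: "inv_into UNIV \<sigma> permutes {..<length u + length v}"
    using assms by (simp add: Bat_def permutes_inv)
  show ?A by (simp add: permute_list_def comp_def)
  have "inj_on (inv_into UNIV \<sigma>) {..<length (map fst (u @ v))}"
    by (rule permutes_inj_on[OF p])
  note koszul_eq_shuffle_sign[OF this]
  also have "shuffle_sign ((!) (map fst (u @ v))) (map (inv_into UNIV \<sigma>) [0..<length (map fst (u @ v))]) =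
      shuffle_sign (fst \<circ> (!) (u @ v)) (map (inv_into UNIV \<sigma>) [0..<length (map fst (u @ v))])"
  proof (rule shuffle_sign_cong)
    fix z assume "z \<in> set (map (inv_into UNIV \<sigma>) [0..<length (map fst (u @ v))])"
    then obtain i where "z = inv_into UNIV \<sigma> i" "i < length u + length v"
      by auto
    then have "z < length (u @ v)"
      using permutes_in_image[OF p, of i] by simp
    then show "map fst (u @ v) ! z = (fst \<circ> (!) (u @ v)) z"
      by (simp del: map_append)
  qed
  finally show ?B by simp
qed

lemma bat_eq_shuffle: "bat u v = shuffle u v"
proof -
  let ?F = "\<lambda>zs. shuffle_sign (fst \<circ> (!) (u @ v)) zs \<cdot> vec (map ((!) (u @ v)) zs)"
  have "bat u v = (\<Sum>\<sigma>\<in>Bat (length u) (length v). ?F (map (inv_into UNIV \<sigma>) [0..<length u + length v]))"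
    unfolding bat_def Let_def
    by (intro sum.cong refl, simp only: Bat_inv) (simp add: single_eq_fscale_vec[symmetric])
  also have "\<dots> = (\<Sum>zs\<in>shuffles [0..<length u] [length u..<length u + length v]. ?F zs)"
    by (rule sum_Bat_eq_sum_shuffles[where F = ?F])
  finally show ?thesis
    unfolding sum_shuffles_eq_shuffle[OF split_sorted_upt] map_nth_append .
qed

text \<open>\<open>P\<close> marks the positions of the first of the two shuffled words.\<close>

fun merges :: "('l \<Rightarrow> 'l \<Rightarrow> 'l) \<Rightarrow> (nat \<Rightarrow> bool) \<Rightarrow> (nat \<Rightarrow> 'l) \<Rightarrow> nat list \<Rightarrow> ('l list \<Rightarrow>\<^sub>0 'k::field_char_0)" where
  "merges m P f (a # b # zs) = (if P a \<and> \<not> P b then vec (m (f a) (f b) # map f zs) else 0) +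
    prepend (vec (f a)) (merges m P f (b # zs))"
| "merges m P f _ = 0"

section \<open>The bracket of words as a recursion\<close>

lemma merge_0: "merge m 0 (x # y # w) = m x y # w"
  by (simp add: merge_def)

lemma merge_Suc: "merge m (Suc k) (x # w) = x # merge m k w"
  by (simp add: merge_def)

lemma Collect_Suc_length_Cons:
  "{k. Suc k < length (a # b # zs) \<and> Q k} =
    (if Q 0 then {0} else {}) \<union> Suc ` {k. Suc k < length (b # zs) \<and> Q (Suc k)}"
proof (rule Set.set_eqI)
  fix k show "k \<in> {k. Suc k < length (a # b # zs) \<and> Q k} \<longleftrightarrow>
    k \<in> (if Q 0 then {0} else {}) \<union> Suc ` {k. Suc k < length (b # zs) \<and> Q (Suc k)}"
    by (cases k) (auto simp: image_iff)
qed

lemma sum_merge_eq_merges: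
  "(\<Sum>k | Suc k < length zs \<and> P (zs ! k) \<and> \<not> P (zs ! Suc k). vec (merge m k (map f zs))) =
    (merges m P f zs :: _ \<Rightarrow>\<^sub>0 'k::field_char_0)"
proof (induction m P f zs rule: merges.induct)
  case (1 m P f a b zs)
  let ?I = "{k. Suc k < length (b # zs) \<and> P ((b # zs) ! k) \<and> \<not> P ((b # zs) ! Suc k)}"
  have fin: "finite ?I" by (rule finite_subset[of _ "{..length (b # zs)}"]) auto
  have "(\<Sum>k | Suc k < length (a # b # zs) \<and> P ((a # b # zs) ! k) \<and> \<not> P ((a # b # zs) ! Suc k).
      vec (merge m k (map f (a # b # zs)))) =
    (\<Sum>k\<in>(if P a \<and> \<not> P b then {0} else {}). vec (merge m k (map f (a # b # zs)))) +
    (\<Sum>k\<in>Suc ` ?I. vec (merge m k (map f (a # b # zs))) :: _ \<Rightarrow>\<^sub>0 'k)"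
    unfolding Collect_Suc_length_Cons using fin by (subst sum.union_disjoint) auto
  also have "(\<Sum>k\<in>Suc ` ?I. vec (merge m k (map f (a # b # zs)))) =
      prepend (vec (f a)) (\<Sum>k\<in>?I. vec (merge m k (map f (b # zs))))"
    unfolding lin_sum[OF lin_prepend(2)] by (simp add: sum.reindex merge_Suc prepend_vec)
  also have "(\<Sum>k\<in>(if P a \<and> \<not> P b then {0} else {}). vec (merge m k (map f (a # b # zs)))) =
      (if P a \<and> \<not> P b then vec (m (f a) (f b) # map f zs) else 0)"
    by (simp add: merge_0)
  finally show ?case by (simp only: 1 merges.simps)
qed simp_all

lemma merges_eq_0: "(\<forall>z\<in>set zs. P z) \<or> (\<forall>z\<in>set zs. \<not> P z) \<Longrightarrow> merges m P f zs = 0"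
  by (induction m P f zs rule: merges.induct) auto

lemma sum_merges_eq_shuffle_bracket:
  fixes f :: "nat \<Rightarrow> int \<times> 'v"
  assumes "split_sorted is js" "\<forall>i\<in>set is. P i" "\<forall>j\<in>set js. \<not> P j"
  shows "(\<Sum>zs\<in>shuffles is js. shuffle_sign (fst \<circ> f) zs \<cdot> merges m P f zs) =
    (shuffle_bracket (\<lambda>x y. vec (m x y)) (map f is) (map f js) :: _ \<Rightarrow>\<^sub>0 'k::field_char_0)"
  using assms
proof (induction "is" js rule: shuffles.induct)
  case (1 js)
  then show ?case by (simp add: merges_eq_0)
next
  case (2 "is")
  then show ?case by (simp add: merges_eq_0)
next
  case (3 i "is" j js)
  note s = split_sorted_Cons[OF 3(3)]
  \<comment> \<open>The summand of \<open>merges\<close> for the list \<open>i # zs\<close> in which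
    \<open>i\<close> is bracketed with its neighbour \<open>hd zs\<close>; it vanishes if the
    neighbour belongs to \<open>is\<close> as well. The other summands lie behind
    \<open>i\<close>.\<close>
  define T :: "nat list \<Rightarrow> _ \<Rightarrow>\<^sub>0 'k" where
    "T zs = (if P (hd zs) then 0 else vec (m (f i) (f (hd zs)) # map f (tl zs)))" for zs
  let ?s = "\<lambda>zs. shuffle_sign (fst \<circ> f) zs :: 'k"
  have left: "?s (i # zs) \<cdot> merges m P f (i # zs) = ?s zs \<cdot> T zs + prepend (vec (f i)) (?s zs \<cdot> merges m P f zs)"
    if zs: "zs \<in> shuffles is (j # js)" for zs
  proof -
    obtain b r where "zs = b # r" using zs by (cases zs) auto
    then show ?thesis
      unfolding shuffle_sign_Cons_left[OF 3(3) zs]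
      using 3(4) by (simp add: T_def fscale_simps del: shuffle_sign.simps)
  qed
  have right: "?s (j # zs) \<cdot> merges m P f (j # zs) =
      ks (fst (f j)) (word_degree (map f (i # is))) \<cdot> prepend (vec (f j)) (?s zs \<cdot> merges m P f zs)"
    if zs: "zs \<in> shuffles (i # is) js" for zs
  proof -
    obtain b r where "zs = b # r" using zs by (cases zs) auto
    have "sorted_wrt (<) ((i # is) @ j # js)" using 3(3) by (simp add: split_sorted_def)
    note sign = shuffle_sign_Cons_right[OF this zs, of f]
    show ?thesis
      unfolding sign using 3(5) \<open>zs = b # r\<close> by (simp del: shuffle_sign.simps)
  qed
  have T: "(\<Sum>zs\<in>shuffles is (j # js). ?s zs \<cdot> T zs) =
    ks (fst (f j)) (word_degree (map f is)) \<cdot> prepend (vec (m (f i) (f j))) (shuffle (map f is) (map f js))"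
  proof -
    have sub: "(#) j ` shuffles is js \<subseteq> shuffles is (j # js)"
      by (rule Cons_shuffles_subset2)
    \<comment> \<open>Only lists with \<open>j\<close> right behind \<open>i\<close> survive.
      Dropping \<open>j\<close> leaves an arbitrary shuffle of \<open>is\<close> and
      \<open>js\<close>, the origin of the unrestricted \<open>shuffle u v\<close> in
      \<open>shuffle_bracket\<close>.\<close>
    have "?s zs \<cdot> T zs = 0" if "zs \<in> shuffles is (j # js) - (#) j ` shuffles is js" for zs
    proof -
      have "P (hd zs)"
        using that 3(4) by (cases zs; cases "is") (auto simp: Cons_in_shuffles_iff)
      then show ?thesis by (simp add: T_def)
    qed
    then have "(\<Sum>zs\<in>shuffles is (j # js). ?s zs \<cdot> T zs) = (\<Sum>zs\<in>(#) j ` shuffles is js. ?s zs \<cdot> T zs)"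
      using sub by (intro sum.mono_neutral_right) auto
    also have "\<dots> = (\<Sum>zs\<in>shuffles is js. ?s (j # zs) \<cdot> T (j # zs))"
      by (simp add: sum.reindex del: shuffle_sign.simps)
    also have "\<dots> = (\<Sum>zs\<in>shuffles is js. ks (fst (f j)) (word_degree (map f is)) \<cdot>
        prepend (vec (m (f i) (f j))) (?s zs \<cdot> vec (map f zs)))"
    proof (intro sum.cong refl)
      fix zs assume zs: "zs \<in> shuffles is js"
      have "sorted_wrt (<) (is @ j # js)" using 3(3) by (simp add: split_sorted_def)
      note sign = shuffle_sign_Cons_right[OF this zs, of f]
      show "?s (j # zs) \<cdot> T (j # zs) =
          ks (fst (f j)) (word_degree (map f is)) \<cdot> prepend (vec (m (f i) (f j))) (?s zs \<cdot> vec (map f zs))"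
        unfolding sign using 3(5) by (simp add: T_def prepend_vec del: shuffle_sign.simps)
    qed
    finally show ?thesis
      unfolding fscale.scale_sum_right[symmetric] lin_sum[OF lin_prepend(2), symmetric]
        sum_shuffles_eq_shuffle[OF s(3)] .
  qed
  have main: "(\<Sum>zs\<in>shuffles (i # is) (j # js). ?s zs \<cdot> merges m P f zs) =
      (\<Sum>zs\<in>shuffles is (j # js). ?s zs \<cdot> T zs) +
      prepend (vec (f i)) (\<Sum>zs\<in>shuffles is (j # js). ?s zs \<cdot> merges m P f zs) +
      ks (fst (f j)) (word_degree (map f (i # is))) \<cdot>
        prepend (vec (f j)) (\<Sum>zs\<in>shuffles (i # is) js. ?s zs \<cdot> merges m P f zs)"
    unfolding sum_shuffles_Cons[OF s(4)] lin_sum[OF lin_prepend(2)] fscale.scale_sum_right[symmetric]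
      sum.distrib[symmetric]
    by (simp only: left right lin_sum[OF lin_prepend(2)] fscale.scale_sum_right sum.distrib cong: sum.cong)
  have IH: "(\<Sum>zs\<in>shuffles is (j # js). ?s zs \<cdot> merges m P f zs) =
      shuffle_bracket (\<lambda>x y. vec (m x y)) (map f is) (map f (j # js))"
    "(\<Sum>zs\<in>shuffles (i # is) js. ?s zs \<cdot> merges m P f zs) =
      shuffle_bracket (\<lambda>x y. vec (m x y)) (map f (i # is)) (map f js)"
    using 3(4,5) by (intro 3(1,2) s; simp)+
  show ?case
    unfolding main T IH by (simp add: add_ac)
qed

lemma bracket_word_eq_shuffle_bracket: "bracket_word br u v = shuffle_bracket (\<lambda>x y. vec (letter_bracket br x y)) u v"
proof -
  let ?m = "letter_bracket br" and ?n = "length u + length v" and ?P = "\<lambda>i. i < length u"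
  let ?F = "\<lambda>zs. shuffle_sign (fst \<circ> (!) (u @ v)) zs \<cdot>
    (\<Sum>k | Suc k < length zs \<and> ?P (zs ! k) \<and> \<not> ?P (zs ! Suc k). vec (merge ?m k (map ((!) (u @ v)) zs)))"
  have "bracket_word br u v = (\<Sum>\<sigma>\<in>Bat (length u) (length v). ?F (map (inv_into UNIV \<sigma>) [0..<?n]))"
    unfolding bracket_word_def Let_def
  proof (intro sum.cong refl)
    fix \<sigma> assume \<sigma>: "\<sigma> \<in> Bat (length u) (length v)"
    let ?\<pi> = "inv_into UNIV \<sigma>"
    have I: "{k. Suc k < ?n \<and> ?\<pi> k < length u \<and> length u \<le> ?\<pi> (Suc k)} =
      {k. Suc k < length (map ?\<pi> [0..<?n]) \<and> ?P (map ?\<pi> [0..<?n] ! k) \<and> \<not> ?P (map ?\<pi> [0..<?n] ! Suc k)}"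
      by auto
    show "(\<Sum>k | Suc k < ?n \<and> ?\<pi> k < length u \<and> length u \<le> ?\<pi> (Suc k).
        Poly_Mapping.single (merge ?m k (permute_list ?\<pi> (u @ v))) (koszul (map fst (u @ v)) ?\<pi>)) =
      ?F (map ?\<pi> [0..<?n])"
      unfolding I Bat_inv[OF \<sigma>] fscale.scale_sum_right by (simp only: single_eq_fscale_vec[symmetric])
  qed
  also have "\<dots> = (\<Sum>zs\<in>shuffles [0..<length u] [length u..<?n]. ?F zs)"
    by (rule sum_Bat_eq_sum_shuffles[where F = ?F])
  also have "\<dots> = shuffle_bracket (\<lambda>x y. vec (?m x y)) (map ((!) (u @ v)) [0..<length u])
      (map ((!) (u @ v)) [length u..<?n])"
    unfolding sum_merge_eq_merges[where P = ?P] by (rule sum_merges_eq_shuffle_bracket[OF split_sorted_upt]) auto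
  finally show ?thesis unfolding map_nth_append .
qed

section \<open>The operator \<mu> on words as a recursion\<close>

lemma prepend_single: "prepend (vec x) (Poly_Mapping.single w c) = Poly_Mapping.single (x # w) c"
  by (simp add: prepend_def fscale_single)

lemma mu_word_eq_merge_mu:
  fixes V :: "('k::field_char_0, 'v) module"
  shows "\<mu>_word V wedge w = merge_mu (\<lambda>x y. vec (\<mu>2 V wedge x y)) w"
proof (induction w)
  case (Cons x w)
  let ?m = "\<mu>2 V wedge"
  let ?f = "\<lambda>w j. Poly_Mapping.single (merge ?m j w) ((-1) powi word_degree (take j w)) :: _ \<Rightarrow>\<^sub>0 'k"
  show ?case
  proof (cases w)
    case w: (Cons y v)
    have I: "{j. Suc j < length (x # w)} = {0} \<union> Suc ` {j. Suc j < length w}"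
      unfolding w using Collect_Suc_length_Cons[of x y v "\<lambda>_. True"] by simp
    have fin: "finite {j. Suc j < length w}"
      by (rule finite_subset[of _ "{..length w}"]) auto
    have "\<mu>_word V wedge (x # w) = ?f (x # w) 0 + (\<Sum>j | Suc j < length w. ?f (x # w) (Suc j))"
      unfolding \<mu>_word_def I using fin by (subst sum.union_disjoint) (auto simp: sum.reindex)
    also have "?f (x # w) 0 = merge_head (\<lambda>x y. vec (?m x y)) x w"
      by (simp add: w merge_0 prepend_vec)
    also have "(\<Sum>j | Suc j < length w. ?f (x # w) (Suc j)) = ks 1 (fst x) \<cdot> prepend (vec x) (\<mu>_word V wedge w)"
      unfolding \<mu>_word_def lin_sum[OF lin_prepend(2)] fscale.scale_sum_right
      by (intro sum.cong refl)
        (simp add: merge_Suc prepend_single fscale_single ks_def power_int_add)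
    finally show ?thesis by (simp add: Cons.IH)
  qed (simp add: \<mu>_word_def)
qed (simp add: \<mu>_word_def)

section \<open>Linear relations between letters\<close>

definition part :: "('w \<Rightarrow> int) \<Rightarrow> int \<Rightarrow> ('w \<Rightarrow>\<^sub>0 'k::field_char_0) \<Rightarrow> ('w \<Rightarrow>\<^sub>0 'k)" where
  "part D d = linear_extension (\<lambda>w. if D w = d then vec w else 0)"

lemma lin_part [simp]: "lin (part D d)"
  by (simp add: part_def)

lemmas part_lin [simp] = linD[OF lin_part]

lemma part_vec: "part D d (vec w) = (if D w = d then vec w else 0)"
  by (simp add: part_def)

lemma homog_part [simp]: "homog D d (part D d f)"
  by (induction f rule: poly_mapping_span_induct) (auto simp: part_vec)

lemma part_homog: "homog D d f \<Longrightarrow> part D e f = (if d = e then f else 0)"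
  by (cases "d = e"; rule lin_eqI_homog[where \<phi> = "part D e" and D = D and d = d])
    (auto simp: part_vec)

lemma keys_part: "Poly_Mapping.keys (part D d f) \<subseteq> Poly_Mapping.keys f"
proof -
  have "Poly_Mapping.lookup (part D d f) w = (if D w = d then Poly_Mapping.lookup f w else 0)" for w
    by (induction f rule: poly_mapping_span_induct)
      (auto simp: lookup_add part_vec lookup_single when_def)
  then show ?thesis by (auto simp: in_keys_iff split: if_splits)
qed

lemma sum_part:
  assumes "finite I" "\<And>w. w \<in> Poly_Mapping.keys f \<Longrightarrow> D w \<in> I"
  shows "(\<Sum>d\<in>I. part D d f) = f"
proof (rule lin_eqI[where \<phi> = "\<lambda>f. \<Sum>d\<in>I. part D d f"])
  show "lin (\<lambda>f. \<Sum>d\<in>I. part D d f)"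
    by (auto simp: lin_def sum.distrib fscale.scale_sum_right)
  show "(\<Sum>d\<in>I. part D d (vec w)) = vec w" if "w \<in> Poly_Mapping.keys f" for w
    using assms(1) assms(2)[OF that] by (simp add: part_vec)
qed simp

text \<open>For a projection \<open>g\<close> onto \<open>S\<close>, the map \<open>f - g f\<close>
  has all required properties except degree 0. Placing it between homogeneous parts and summing over
  the degrees repairs this and keeps the rest, because \<open>S\<close> is graded.\<close>

lemma exists_homogeneous_projection:
  fixes S :: "('l \<Rightarrow>\<^sub>0 'k::field_char_0) set"
  assumes S: "fscale.subspace S" and part: "\<And>d r. r \<in> S \<Longrightarrow> part D d r \<in> S"
  shows "\<exists>n. lin n \<and> (\<forall>r\<in>S. n r = 0) \<and> (\<forall>f. f - n f \<in> S) \<and> (\<forall>l. homog D (D l) (n (vec l)))"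
proof -
  interpret vector_space_pair "fscale :: 'k \<Rightarrow> ('l \<Rightarrow>\<^sub>0 'k) \<Rightarrow> _" "fscale :: 'k \<Rightarrow> ('l \<Rightarrow>\<^sub>0 'k) \<Rightarrow> _"
    by unfold_locales
  have "Vector_Spaces.linear fscale fscale (\<lambda>x :: 'l \<Rightarrow>\<^sub>0 'k. x)"
    by (rule fscale.linear_ident)
  \<comment> \<open>A left inverse, on \<open>S\<close>, of the identity map is a projection onto
    \<open>S\<close>.\<close>
  from linear_exists_left_inverse_on[OF this S] obtain g where g: "g ` UNIV \<subseteq> S" "Vector_Spaces.linear fscale fscale g" "\<And>v. v \<in> S \<Longrightarrow> g v = v"
    by (auto simp: inj_on_def)
  interpret g: Vector_Spaces.linear fscale fscale g by (rule g(2))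
  have lg: "lin g"
    by (simp add: lin_def g.add g.scale)
  define n where "n = linear_extension (\<lambda>l. part D (D l) (vec l - g (vec l)))"
  have "f - n f \<in> S" for f
  proof (induction f rule: poly_mapping_span_induct)
    case (2 f h)
    then show ?case using fscale.subspace_add[OF S] by (force simp: n_def algebra_simps)
  next
    case (3 c f)
    then show ?case using fscale.subspace_scale[OF S 3, of c] by (simp add: n_def fscale_simps)
  next
    case (4 l)
    show ?case using g(1) part by (auto simp: n_def part_vec)
  qed (simp add: n_def fscale.subspace_0[OF S])
  \<comment> \<open>\<open>n\<close> is given on basis vectors; this description by parts shows that
    it kills \<open>S\<close>, since the parts of an element of \<open>S\<close> are fixed by
    \<open>g\<close>.\<close>
  moreover have "n f = (\<Sum>d\<in>D ` Poly_Mapping.keys f. part D d (part D d f - g (part D d f)))" for f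
  proof -
    let ?I = "D ` Poly_Mapping.keys f"
    have "n h = (\<Sum>d\<in>?I. part D d (part D d h - g (part D d h)))" if "Poly_Mapping.keys h \<subseteq> Poly_Mapping.keys f" for h
    proof (rule lin_eqI[where \<phi> = n])
      show "lin (\<lambda>h. \<Sum>d\<in>?I. part D d (part D d h - g (part D d h)))"
        by (auto simp: lin_def linD[OF lg] sum.distrib[symmetric] fscale.scale_sum_right fscale_simps algebra_simps
          intro!: sum.cong)
      fix l assume "l \<in> Poly_Mapping.keys h"
      then have l: "D l \<in> ?I" using that by auto
      have "(\<Sum>d\<in>?I. part D d (part D d (vec l) - g (part D d (vec l)))) =
          (\<Sum>d\<in>?I. if d = D l then part D (D l) (vec l - g (vec l)) else 0)"
        by (intro sum.cong refl) (auto simp: part_vec linD[OF lg])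
      then show "n (vec l) = (\<Sum>d\<in>?I. part D d (part D d (vec l) - g (part D d (vec l))))"
        using l by (simp add: n_def)
    qed (simp add: n_def)
    then show ?thesis by simp
  qed
  then have "n r = 0" if "r \<in> S" for r
    using part[OF that] g(3) by simp
  moreover have "homog D (D l) (n (vec l))" for l
    unfolding n_def by (simp del: part_lin)
  moreover have "lin n"
    by (simp add: n_def)
  ultimately show ?thesis by blast
qed

section \<open>Letters of a Gerstenhaber algebra and their linear relations\<close>

context gerstenhaber_algebra
begin

lemma scalars_simps [simp]:
  "carrier (scalars :: 'k ring) = UNIV" "add scalars = (+)" "zero scalars = 0"
  "mult scalars = (*)" "one scalars = 1"
  by (simp_all add: scalars_def)

lemma grade_closed:
  "x \<in> grade i \<Longrightarrow> x \<in> carrier V"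
  "x \<in> grade i \<Longrightarrow> y \<in> grade i \<Longrightarrow> x \<oplus>\<^bsub>V\<^esub> y \<in> grade i"
  "x \<in> grade i \<Longrightarrow> c \<odot>\<^bsub>V\<^esub> x \<in> grade i"
  using submoduleE[OF grade_submodule[of i]] by auto

lemma zero_grade: "\<zero>\<^bsub>V\<^esub> \<in> grade i"
  using submoduleE(2)[OF grade_submodule[of i]] grade_closed(2,3)[of _ i]
  by (metis all_not_in_conv a_inv_closed grade_closed(1) r_neg submoduleE(3)[OF grade_submodule[of i]])

lemma shift_closed:
  "x \<in> shift grade i \<Longrightarrow> x \<in> carrier V"
  "x \<in> shift grade i \<Longrightarrow> y \<in> shift grade i \<Longrightarrow> x \<oplus>\<^bsub>V\<^esub> y \<in> shift grade i"
  "x \<in> shift grade i \<Longrightarrow> c \<odot>\<^bsub>V\<^esub> x \<in> shift grade i"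
  "\<zero>\<^bsub>V\<^esub> \<in> shift grade i"
  by (simp_all add: shift_def grade_closed zero_grade)

lemma br_closed: "x \<in> shift grade a \<Longrightarrow> y \<in> shift grade b \<Longrightarrow> br x y \<in> shift grade (a + b)"
  using graded_lie_algebra.br_degree[OF shifted_lie] .

lemma wedge_closed: "x \<in> shift grade a \<Longrightarrow> y \<in> shift grade b \<Longrightarrow> wedge x y \<in> shift grade (a + b + 1)"
  using wedge_degree[of x "a + 1" y "b + 1"] by (simp add: shift_def add_ac)

lemma bilinearD:
  assumes "bilinear_operation V m" "x \<in> carrier V" "y \<in> carrier V" "z \<in> carrier V"
  shows "m (x \<oplus>\<^bsub>V\<^esub> y) z = m x z \<oplus>\<^bsub>V\<^esub> m y z" "m (c \<odot>\<^bsub>V\<^esub> x) z = c \<odot>\<^bsub>V\<^esub> m x z"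
    "m z (x \<oplus>\<^bsub>V\<^esub> y) = m z x \<oplus>\<^bsub>V\<^esub> m z y" "m z (c \<odot>\<^bsub>V\<^esub> x) = c \<odot>\<^bsub>V\<^esub> m z x" "m x z \<in> carrier V"
  using assms by (auto simp: bilinear_operation_def linear_operator_def)

lemma br_bil: "bilinear_operation V br"
  using graded_lie_algebra.br_bilinear[OF shifted_lie] .

definition valid :: "int \<times> 'v \<Rightarrow> bool" where
  "valid l \<longleftrightarrow> snd l \<in> shift grade (fst l)"

text \<open>Pairs \<open>(a, x)\<close> with \<open>x\<close> not of degree \<open>a\<close> are set to zero, so that identities between
  letters hold for all pairs.\<close>

inductive_set letter_gens :: "(int \<times> 'v \<Rightarrow>\<^sub>0 'k) set" where
  add: "x \<in> shift grade a \<Longrightarrow> y \<in> shift grade a \<Longrightarrow>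
    vec (a, x \<oplus>\<^bsub>V\<^esub> y) - vec (a, x) - vec (a, y) \<in> letter_gens"
| scale: "x \<in> shift grade a \<Longrightarrow> vec (a, c \<odot>\<^bsub>V\<^esub> x) - c \<cdot> vec (a, x) \<in> letter_gens"
| invalid: "\<not> valid l \<Longrightarrow> vec l \<in> letter_gens"

abbreviation "letter_rels \<equiv> fscale.span letter_gens"

lemma part_letter_rels: "r \<in> letter_rels \<Longrightarrow> part fst d r \<in> letter_rels"
proof (erule span_induct_lin)
  fix r assume "r \<in> letter_gens"
  then show "part fst d r \<in> letter_rels"
  proof cases
    case (add x a y)
    then show ?thesis
      using letter_gens.add[OF add(2,3)] by (auto simp: part_vec fscale.span_zero fscale.span_base)
  next
    case (scale x a c)
    then show ?thesis
      using letter_gens.scale[OF scale(2), of c] by (auto simp: part_vec fscale.span_zero fscale.span_base)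
  next
    case (invalid l)
    then show ?thesis
      using letter_gens.invalid[OF invalid(2)] by (auto simp: part_vec fscale.span_zero fscale.span_base)
  qed
qed simp_all

text \<open>Any map with these properties serves. The second and third make its kernel equal to
  \<open>letter_rels\<close>, so that \<open>rep\<close> selects one combination from each
  coset.\<close>

definition rep :: "(int \<times> 'v \<Rightarrow>\<^sub>0 'k) \<Rightarrow> (int \<times> 'v \<Rightarrow>\<^sub>0 'k)" where
  "rep = (SOME n. lin n \<and> (\<forall>r\<in>letter_rels. n r = 0) \<and> (\<forall>f. f - n f \<in> letter_rels) \<and>
    (\<forall>l. homog fst (fst l) (n (vec l))))"

lemma rep:
  "lin rep" "r \<in> letter_rels \<Longrightarrow> rep r = 0" "f - rep f \<in> letter_rels"
  "homog fst (fst l) (rep (vec l))"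
  using someI_ex[OF exists_homogeneous_projection[OF fscale.subspace_span part_letter_rels]]
  unfolding rep_def[symmetric] by blast+

lemmas rep_lin = linD[OF rep(1)]

lemma rep_eqI: "f - g \<in> letter_rels \<Longrightarrow> rep f = rep g"
  using rep(2)[of "f - g"] by (simp add: rep_lin)

lemma rep_add: "x \<in> shift grade a \<Longrightarrow> y \<in> shift grade a \<Longrightarrow>
    rep (vec (a, x \<oplus>\<^bsub>V\<^esub> y)) = rep (vec (a, x)) + rep (vec (a, y))"
  using rep_eqI[OF fscale.span_base[OF letter_gens.add[of x a y]], unfolded rep_lin]
    rep(2)[OF fscale.span_base[OF letter_gens.add[of x a y]]] by (simp add: rep_lin algebra_simps)

lemma rep_scale: "x \<in> shift grade a \<Longrightarrow> rep (vec (a, c \<odot>\<^bsub>V\<^esub> x)) = c \<cdot> rep (vec (a, x))"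
  using rep(2)[OF fscale.span_base[OF letter_gens.scale[of x a c]]] by (simp add: rep_lin)

lemma rep_zero: "rep (vec (a, \<zero>\<^bsub>V\<^esub>)) = 0"
proof -
  have "rep (vec (a, 0 \<odot>\<^bsub>V\<^esub> \<zero>\<^bsub>V\<^esub>)) = 0"
    by (subst rep_scale) (simp_all add: shift_closed)
  moreover have "(0::'k) \<odot>\<^bsub>V\<^esub> \<zero>\<^bsub>V\<^esub> = \<zero>\<^bsub>V\<^esub>"
    using smult_r_null[of 0] by simp
  ultimately show ?thesis by simp
qed

text \<open>Invalid letters are relations, so an operation compatible with the relations has to
  vanish on them modulo relations, whereas their raw bracket might happen to be a valid
  letter.\<close>

definition lb :: "int \<times> 'v \<Rightarrow> int \<times> 'v \<Rightarrow> (int \<times> 'v \<Rightarrow>\<^sub>0 'k)" where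
  "lb x y = (if valid x \<and> valid y then vec (letter_bracket br x y) else 0)"

definition m2 :: "int \<times> 'v \<Rightarrow> int \<times> 'v \<Rightarrow> (int \<times> 'v \<Rightarrow>\<^sub>0 'k)" where
  "m2 x y = (if valid x \<and> valid y then vec (\<mu>2 V wedge x y) else 0)"

lemma lb_valid: "a \<in> shift grade i \<Longrightarrow> b \<in> shift grade j \<Longrightarrow> lb (i, a) (j, b) = vec (i + j, br a b)"
  by (simp add: lb_def valid_def letter_bracket_def)

lemma m2_valid: "a \<in> shift grade i \<Longrightarrow> b \<in> shift grade j \<Longrightarrow>
    m2 (i, a) (j, b) = vec (i + j + 1, ks 1 i \<odot>\<^bsub>V\<^esub> wedge a b)"
  by (simp add: m2_def valid_def \<mu>2_def ks_def)

lemma lb_invalid: "\<not> valid x \<or> \<not> valid y \<Longrightarrow> lb x y = 0"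
  by (auto simp: lb_def)

lemma m2_invalid: "\<not> valid x \<or> \<not> valid y \<Longrightarrow> m2 x y = 0"
  by (auto simp: m2_def)

text \<open>Bilinearity in \<open>V\<close> carries linear relations between letters to linear
  relations. Bracket and product are treated together: \<open>s\<close> is the degree of the result
  and \<open>c\<close> the sign, which is 1 for the bracket and \<open>ks 1\<close> for the
  product.\<close>

lemma letter_op_rels:
  assumes bil: "bilinear_operation V m"
    and closed: "\<And>x y a b. x \<in> shift grade a \<Longrightarrow> y \<in> shift grade b \<Longrightarrow> m x y \<in> shift grade (s a b)"
    and op: "\<And>x y a b. x \<in> shift grade a \<Longrightarrow> y \<in> shift grade b \<Longrightarrow>
      rep (F (a, x) (b, y)) = c a \<cdot> rep (vec (s a b, m x y))"
      "\<And>x y. \<not> valid x \<or> \<not> valid y \<Longrightarrow> F x y = 0"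
    and r: "r \<in> letter_rels"
  shows "rep (bilinear_extension F r f) = 0" "rep (bilinear_extension F f r) = 0"
proof -
  have sub: "fscale.subspace {0 :: _ \<Rightarrow>\<^sub>0 'k}"
    by (simp add: fscale.subspace_def)
  have 1: "rep (bilinear_extension F r (vec z)) = 0" for z
  proof -
    have "(\<lambda>r. rep (bilinear_extension F r (vec z))) r \<in> {0}" using r sub
    proof (rule span_induct_lin)
      show "lin (\<lambda>r. rep (bilinear_extension F r (vec z)))"
        by (rule lin_compose[OF rep(1)]) simp
      fix r assume "r \<in> letter_gens"
      then show "rep (bilinear_extension F r (vec z)) \<in> {0}"
      proof (cases, goal_cases)
        case (1 x a y)
        then show ?case
          by (cases "valid z"; cases z)
           (simp_all add: rep_lin op bilinearD[OF bil] shift_closed closed rep_add valid_def fscale_simps)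
      next
        case (2 x a c)
        then show ?case
          by (cases "valid z"; cases z)
           (simp_all add: rep_lin op bilinearD[OF bil, of x x] shift_closed closed rep_scale valid_def fscale_simps mult.commute)
      qed (simp add: op rep_lin)
    qed
    then show ?thesis by simp
  qed
  have 2: "rep (bilinear_extension F (vec z) r) = 0" for z
  proof -
    have "(\<lambda>r. rep (bilinear_extension F (vec z) r)) r \<in> {0}" using r sub
    proof (rule span_induct_lin)
      show "lin (\<lambda>r. rep (bilinear_extension F (vec z) r))"
        by (rule lin_compose[OF rep(1)]) simp
      fix r assume "r \<in> letter_gens"
      then show "rep (bilinear_extension F (vec z) r) \<in> {0}"
      proof (cases, goal_cases)
        case (1 x a y)
        then show ?case
          by (cases "valid z"; cases z)
           (simp_all add: rep_lin op bilinearD[OF bil] shift_closed closed rep_add valid_def fscale_simps)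
      next
        case (2 x a c)
        then show ?case
          by (cases "valid z"; cases z)
           (simp_all add: rep_lin op bilinearD[OF bil, of x x] shift_closed closed rep_scale valid_def fscale_simps mult.commute)
      qed (simp add: op rep_lin)
    qed
    then show ?thesis by simp
  qed
  show "rep (bilinear_extension F r f) = 0"
    by (rule lin_eqI[where \<psi> = "\<lambda>f. 0" and \<phi> = "\<lambda>f. rep (bilinear_extension F r f)"])
      (simp_all add: 1 lin_compose[OF rep(1)])
  show "rep (bilinear_extension F f r) = 0"
    by (rule lin_eqI[where \<psi> = "\<lambda>f. 0" and \<phi> = "\<lambda>f. rep (bilinear_extension F f r)"])
      (simp_all add: 2 lin_compose[OF rep(1)])
qed

lemma rep_lb: "x \<in> shift grade a \<Longrightarrow> y \<in> shift grade b \<Longrightarrow> rep (lb (a, x) (b, y)) = 1 \<cdot> rep (vec (a + b, br x y))"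
  by (simp add: lb_valid)

lemma rep_m2: "x \<in> shift grade a \<Longrightarrow> y \<in> shift grade b \<Longrightarrow>
    rep (m2 (a, x) (b, y)) = ks 1 a \<cdot> rep (vec (a + b + 1, wedge x y))"
  by (simp add: m2_valid rep_scale wedge_closed)

lemma lb_rels:
  assumes "r \<in> letter_rels"
  shows "rep (bilinear_extension lb r f) = 0" "rep (bilinear_extension lb f r) = 0"
  by (rule letter_op_rels[where F = lb and m = br and s = "(+)" and c = "\<lambda>_. 1"];
      fact br_bil br_closed rep_lb lb_invalid assms)+

lemma m2_rels:
  assumes "r \<in> letter_rels"
  shows "rep (bilinear_extension m2 r f) = 0" "rep (bilinear_extension m2 f r) = 0"
  by (rule letter_op_rels[where F = m2 and m = wedge and s = "\<lambda>a b. a + b + 1" and c = "ks 1"];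
      fact wedge_bilinear wedge_closed rep_m2 m2_invalid assms)+

section \<open>The normalised letter operations and their exact identities\<close>

abbreviation "lbn x y \<equiv> rep (lb x y)"
abbreviation "m2n x y \<equiv> rep (m2 x y)"

lemma rep_lbn: "bilinear_extension lbn f g = rep (bilinear_extension lb f g)"
  by (simp add: bilinear_extension_def linear_extension_def lin_sum[OF rep(1)] rep_lin)

lemma rep_m2n: "bilinear_extension m2n f g = rep (bilinear_extension m2 f g)"
  by (simp add: bilinear_extension_def linear_extension_def lin_sum[OF rep(1)] rep_lin)

lemma lb_rep: "rep (bilinear_extension lb (rep f) g) = rep (bilinear_extension lb f g)"
    "rep (bilinear_extension lb f (rep g)) = rep (bilinear_extension lb f g)"
  using lb_rels(1)[OF rep(3)[of f], of g] lb_rels(2)[OF rep(3)[of g], of f] by (simp_all add: rep_lin)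

lemma m2_rep: "rep (bilinear_extension m2 (rep f) g) = rep (bilinear_extension m2 f g)"
    "rep (bilinear_extension m2 f (rep g)) = rep (bilinear_extension m2 f g)"
  using m2_rels(1)[OF rep(3)[of f], of g] m2_rels(2)[OF rep(3)[of g], of f] by (simp_all add: rep_lin)

lemma lb_invalid_right: "\<not> valid z \<Longrightarrow> bilinear_extension lb f (vec z) = 0"
  by (rule lin_eqI[where \<psi> = "\<lambda>f. 0" and \<phi> = "\<lambda>f. bilinear_extension lb f (vec z)"]) (simp_all add: lb_invalid)

lemma m2_invalid_right: "\<not> valid z \<Longrightarrow> bilinear_extension m2 f (vec z) = 0"
  by (rule lin_eqI[where \<psi> = "\<lambda>f. 0" and \<phi> = "\<lambda>f. bilinear_extension m2 f (vec z)"]) (simp_all add: m2_invalid)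

lemma m2_invalid_left: "\<not> valid z \<Longrightarrow> bilinear_extension m2 (vec z) f = 0"
  by (rule lin_eqI[where \<psi> = "\<lambda>f. 0" and \<phi> = "\<lambda>f. bilinear_extension m2 (vec z) f"]) (simp_all add: m2_invalid)

lemma br_antisym_rep:
  assumes "x \<in> shift grade a" "y \<in> shift grade b"
  shows "br x y = (- ks a b) \<odot>\<^bsub>V\<^esub> br y x"
  using graded_lie_algebra.br_antisym[OF shifted_lie assms] by (simp add: ks_def)

lemma homog_lbn: "homl (fst x + fst y) (lbn x y)"
  using rep(4)[of "letter_bracket br x y"]
  by (auto simp: lb_def rep_lin letter_bracket_def case_prod_unfold)

lemma homog_m2n: "homl (fst x + fst y + 1) (m2n x y)"
  using rep(4)[of "\<mu>2 V wedge x y"] by (auto simp: m2_def rep_lin \<mu>2_def case_prod_unfold)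

lemma lbn_antisym: "lbn x y = - (ks (fst x) (fst y) \<cdot> lbn y x)"
proof (cases "valid x \<and> valid y")
  case True
  obtain a u b v where xy: "x = (a, u)" "y = (b, v)" by (cases x; cases y)
  have uv: "u \<in> shift grade a" "v \<in> shift grade b" using True by (simp_all add: xy valid_def)
  show ?thesis
    unfolding xy using uv
    by (simp add: lb_valid br_antisym_rep[OF uv] rep_scale[OF br_closed] rep_scale[OF br_closed[of v b u a, unfolded add.commute[of b]]] add.commute[of b])
qed (auto simp: lb_invalid rep_lin)

lemma lbn_jacobi:
  "ks (fst x) (fst z) \<cdot> bilinear_extension lbn (lbn x y) (vec z) +
    ks (fst y) (fst x) \<cdot> bilinear_extension lbn (lbn y z) (vec x) +
    ks (fst z) (fst y) \<cdot> bilinear_extension lbn (lbn z x) (vec y) = 0"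
proof (cases "valid x \<and> valid y \<and> valid z")
  case True
  obtain a u b v c w where eq: "x = (a, u)" "y = (b, v)" "z = (c, w)" by (cases x; cases y; cases z)
  have v: "u \<in> shift grade a" "v \<in> shift grade b" "w \<in> shift grade c"
    using True by (simp_all add: eq valid_def)
  define d where "d = a + b + c"
  have prepend: "br (br u v) w \<in> shift grade d" "br (br v w) u \<in> shift grade d" "br (br w u) v \<in> shift grade d"
    using br_closed[OF br_closed[OF v(1,2)] v(3)] br_closed[OF br_closed[OF v(2,3)] v(1)]
      br_closed[OF br_closed[OF v(3,1)] v(2)] by (simp_all add: d_def add_ac)
  have "ks a c \<cdot> rep (vec (d, br (br u v) w)) + ks b a \<cdot> rep (vec (d, br (br v w) u)) +
      ks c b \<cdot> rep (vec (d, br (br w u) v)) =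
    rep (vec (d, ks a c \<odot>\<^bsub>V\<^esub> br (br u v) w \<oplus>\<^bsub>V\<^esub> ks b a \<odot>\<^bsub>V\<^esub> br (br v w) u
      \<oplus>\<^bsub>V\<^esub> ks c b \<odot>\<^bsub>V\<^esub> br (br w u) v))"
    by (simp add: rep_add rep_scale shift_closed prepend)
  also have "\<dots> = 0"
    using graded_lie_algebra.br_jacobi[OF shifted_lie v] by (simp add: ks_def rep_zero)
  finally show ?thesis
    unfolding rep_lbn lb_rep eq
    by (simp add: lb_valid v br_closed) (simp add: d_def add_ac)
next
  case False
  then show ?thesis
    unfolding rep_lbn lb_rep by (auto simp: lb_invalid lb_invalid_right rep_lin)
qed

text \<open>In the unshifted degrees \<open>a + 1\<close> and \<open>b + 1\<close>, commutativity
  gives the exponent \<open>a b + a + b + 1\<close>; the factors in \<open>\<mu>2\<close> absorb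
  \<open>a + b\<close> and leave the minus sign.\<close>

lemma m2n_antisym: "m2n x y = - (ks (fst x) (fst y) \<cdot> m2n y x)"
proof (cases "valid x \<and> valid y")
  case True
  obtain a u b v where xy: "x = (a, u)" "y = (b, v)" by (cases x; cases y)
  have uv: "u \<in> shift grade a" "v \<in> shift grade b" using True by (simp_all add: xy valid_def)
  have "wedge u v = ks (a + 1) (b + 1) \<odot>\<^bsub>V\<^esub> wedge v u"
    using wedge_commute[of u "a + 1" v "b + 1"] uv by (simp add: shift_def ks_def)
  moreover have "wedge v u \<in> shift grade (a + b + 1)"
    using wedge_closed[OF uv(2,1)] by (simp add: add_ac)
  ultimately show ?thesis
    unfolding xy by (simp add: rep_m2 uv rep_scale fscale_simps ks_simps add.commute[of b a])
qed (auto simp: m2_invalid rep_lin)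

text \<open>The sign exponents are \<open>(a + b + 1) + a\<close> for the first product and,
  including the prefactor, \<open>a + a + b\<close> for the second; they differ by 1.\<close>

lemma m2n_assoc:
  "bilinear_extension m2n (m2n x y) (vec z) + ks 1 (fst x) \<cdot> bilinear_extension m2n (vec x) (m2n y z) = 0"
proof (cases "valid x \<and> valid y \<and> valid z")
  case True
  obtain a u b v c w where eq: "x = (a, u)" "y = (b, v)" "z = (c, w)" by (cases x; cases y; cases z)
  have v: "u \<in> shift grade a" "v \<in> shift grade b" "w \<in> shift grade c"
    using True by (simp_all add: eq valid_def)
  define e where "e = rep (vec (a + b + c + 2, wedge (wedge u v) w))"
  have W: "wedge (wedge u v) w \<in> shift grade (a + (b + (c + 2)))"
    using wedge_closed[OF wedge_closed[OF v(1,2)] v(3)] by (simp add: add_ac)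
  have "rep (bilinear_extension m2 (m2 x y) (vec z)) = (ks 1 (a + b + 1) * ks 1 a) \<cdot> e"
    using bilinearD(2)[OF wedge_bilinear, of "wedge u v" "wedge u v" w] wedge_closed[OF v(1,2)] v
    by (simp add: eq m2_valid shift_closed wedge_closed) (simp add: e_def add_ac rep_scale shift_closed W)
  moreover have "rep (bilinear_extension m2 (vec x) (m2 y z)) = (ks 1 a * ks 1 b) \<cdot> e"
    using bilinearD(4)[OF wedge_bilinear, of "wedge v w" "wedge v w" u] wedge_closed[OF v(2,3)] v
    by (simp add: eq m2_valid shift_closed wedge_closed flip: wedge_assoc)
      (simp add: e_def add_ac rep_scale shift_closed W)
  ultimately show ?thesis
    unfolding rep_m2n m2_rep by (simp add: fscale_simps ks_simps eq)
next
  case False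
  then show ?thesis
    unfolding rep_m2n m2_rep by (auto simp: m2_invalid m2_invalid_right m2_invalid_left rep_lin)
qed

text \<open>The Leibniz rule of the algebra has the product in the second argument; antisymmetry,
  applied to the outer bracket and to both inner ones, turns it round.\<close>

lemma m2n_leibniz:
  "bilinear_extension lbn (m2n x y) (vec z) =
    bilinear_extension m2n (vec x) (lbn y z) + ks (fst z) (fst y) \<cdot> bilinear_extension m2n (lbn x z) (vec y)"
proof (cases "valid x \<and> valid y \<and> valid z")
  case True
  obtain a u b v c w where eq: "x = (a, u)" "y = (b, v)" "z = (c, w)" by (cases x; cases y; cases z)
  have v: "u \<in> shift grade a" "v \<in> shift grade b" "w \<in> shift grade c"
    using True by (simp_all add: eq valid_def)
  note carr = shift_closed(1)[OF v(1)] shift_closed(1)[OF v(2)] shift_closed(1)[OF v(3)]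
  define d where "d = a + b + c + 1"
  have prepend: "wedge u (br v w) \<in> shift grade d" "wedge (br u w) v \<in> shift grade d"
    "br w (wedge u v) \<in> shift grade d"
    using wedge_closed[OF v(1) br_closed[OF v(2,3)]] wedge_closed[OF br_closed[OF v(1,3)] v(2)]
      br_closed[OF v(3) wedge_closed[OF v(1,2)]] by (simp_all add: d_def add_ac)
  note brcl = shift_closed(1)[OF br_closed[OF v(1,3)]] shift_closed(1)[OF br_closed[OF v(2,3)]]
  have 1: "br w (wedge u v) = (- ks c a) \<odot>\<^bsub>V\<^esub> wedge (br u w) v \<oplus>\<^bsub>V\<^esub>
      ks (a + 1) c \<odot>\<^bsub>V\<^esub> ((- ks c b) \<odot>\<^bsub>V\<^esub> wedge u (br v w))"
    using leibniz[of w "c + 1" u "a + 1" v "b + 1"] v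
      br_antisym_rep[OF v(3,1)] br_antisym_rep[OF v(3,2)]
      bilinearD(2)[OF wedge_bilinear brcl(1) brcl(1) carr(2)]
      bilinearD(4)[OF wedge_bilinear brcl(2) brcl(2) carr(1)]
    by (simp add: shift_def ks_def)
  have "rep (vec (d, br w (wedge u v))) = - (ks c a \<cdot> rep (vec (d, wedge (br u w) v))) -
      (ks (a + 1) c * ks c b) \<cdot> rep (vec (d, wedge u (br v w)))"
    unfolding 1 by (simp add: rep_add rep_scale shift_closed prepend fscale_simps)
  moreover have "rep (vec (d, br (wedge u v) w)) = - (ks (a + b + 1) c \<cdot> rep (vec (d, br w (wedge u v))))"
    unfolding br_antisym_rep[OF wedge_closed[OF v(1,2)] v(3)] by (simp add: rep_scale prepend)
  moreover have "rep (bilinear_extension lb (m2 x y) (vec z)) = ks 1 a \<cdot> rep (vec (d, br (wedge u v) w))"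
  proof -
    have "br (ks 1 a \<odot>\<^bsub>V\<^esub> wedge u v) w = ks 1 a \<odot>\<^bsub>V\<^esub> br (wedge u v) w"
      using bilinearD(2)[OF br_bil] wedge_closed[OF v(1,2)] carr by (simp add: shift_closed)
    moreover have "br (wedge u v) w \<in> shift grade d"
      using br_closed[OF wedge_closed[OF v(1,2)] v(3)] by (simp add: d_def add_ac)
    ultimately show ?thesis
      using lb_valid[OF shift_closed(3)[OF wedge_closed[OF v(1,2)]] v(3), of "ks 1 a"] v
      by (simp add: eq m2_valid rep_scale) (simp add: d_def add_ac rep_scale)
  qed
  moreover have "rep (bilinear_extension m2 (vec x) (lb y z)) = ks 1 a \<cdot> rep (vec (d, wedge u (br v w)))"
    using v by (simp add: eq lb_valid rep_m2 br_closed) (simp add: d_def add_ac)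
  moreover have "rep (bilinear_extension m2 (lb x z) (vec y)) = ks 1 (a + c) \<cdot> rep (vec (d, wedge (br u w) v))"
    using v by (simp add: eq lb_valid rep_m2 br_closed) (simp add: d_def add_ac)
  ultimately show ?thesis
    unfolding rep_lbn rep_m2n lb_rep m2_rep by (simp add: eq fscale_simps ks_simps)
next
  case False
  then show ?thesis
    unfolding rep_m2n m2_rep rep_lbn lb_rep
    by (auto simp: lb_invalid lb_invalid_right m2_invalid m2_invalid_right m2_invalid_left rep_lin)
qed

lemma dg_letters_rep: "dg_letters lbn m2n"
  by unfold_locales (fact homog_lbn homog_m2n lbn_antisym lbn_jacobi m2n_antisym m2n_assoc m2n_leibniz)+

end

section \<open>Multilinear extension to words\<close>

context gerstenhaber_algebra
begin

interpretation L: dg_letters lbn m2n by (rule dg_letters_rep)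

text \<open>The letter operation as it enters the bracket on \<open>H\<close>. Its agreement with
  \<open>lb\<close> is guaranteed on valid letters, which is why \<open>Rep_shuffle_bracket\<close>
  speaks of valid words.\<close>

definition lb0 :: "int \<times> 'v \<Rightarrow> int \<times> 'v \<Rightarrow> (int \<times> 'v \<Rightarrow>\<^sub>0 'k)" where
  "lb0 x y = vec (letter_bracket br x y)"

definition m20 :: "int \<times> 'v \<Rightarrow> int \<times> 'v \<Rightarrow> (int \<times> 'v \<Rightarrow>\<^sub>0 'k)" where
  "m20 x y = vec (\<mu>2 V wedge x y)"

abbreviation BB0 where "BB0 \<equiv> bilinear_extension (shuffle_bracket lb0)"
abbreviation M0 where "M0 \<equiv> linear_extension (merge_mu m20)"

lemma homog_lb0: "homog_bracket lb0"
proof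
  show "homl (fst x + fst y) (lb0 x y)" for x y
    using homog_vec[of fst "letter_bracket br x y"] by (simp add: lb0_def letter_bracket_def case_prod_unfold)
qed

lemma homog_m20: "homog_product m20"
proof
  show "homl (fst x + fst y + 1) (m20 x y)" for x y
    using homog_vec[of fst "\<mu>2 V wedge x y"] by (simp add: m20_def \<mu>2_def case_prod_unfold)
qed

fun rep_word :: "'v word \<Rightarrow> ('v word \<Rightarrow>\<^sub>0 'k)" where
  "rep_word [] = vec []"
| "rep_word (l # w) = prepend (rep (vec l)) (rep_word w)"

abbreviation Rep where "Rep \<equiv> linear_extension rep_word"

lemma homog_rep_word: "homw (word_degree w) (rep_word w)"
proof (induction w)
  case Nil show ?case using homog_vec[of word_degree "[]"] by simp
next
  case (Cons l w) then show ?case using homog_prepend[OF rep(4)] by simp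
qed

lemma homog_Rep: "homw d f \<Longrightarrow> homw d (Rep f)"
  by (rule homog_linear_extension) (use homog_rep_word in auto)

lemmas lin_rules_rep = lin_rules lin_compose[OF rep(1)]

lemma Rep_prepend: "Rep (prepend l f) = prepend (rep l) (Rep f)"
proof (rule lin_eqI[where \<phi> = "\<lambda>l. Rep (prepend l f)"])
  show "Rep (prepend (vec x) f) = prepend (rep (vec x)) (Rep f)" for x
    by (rule lin_eqI[where \<phi> = "\<lambda>f. Rep (prepend (vec x) f)"]) (simp_all add: lin_rules_rep, simp add: prepend_vec)
qed (simp_all add: lin_rules_rep)

text \<open>Signs in a shuffle depend only on degrees, which \<open>rep\<close> preserves letter by
  letter.\<close>

lemma Rep_shuffle: "Rep (shuffle u v) = SH (rep_word u) (rep_word v)"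
proof (induction u v rule: shuffle.induct)
  case (3 x u y v)
  have "SH (rep_word (x # u)) (rep_word (y # v)) =
      prepend (rep (vec x)) (SH (rep_word u) (rep_word (y # v))) +
      prepend (rep (vec y)) (SH (tw (fst y) (rep_word (x # u))) (rep_word v))"
    unfolding rep_word.simps by (rule SH_prepend[OF rep(4)])
  then show ?case
    unfolding shuffle.simps twist_homog[OF homog_rep_word]
    by (simp add: Rep_prepend 3 del: rep_word.simps bilinear_extension_single)
qed (simp_all del: bilinear_extension_single)

lemma Rep_SH: "Rep (SH f g) = SH (Rep f) (Rep g)"
proof (rule lin_eqI[where \<phi> = "\<lambda>f. Rep (SH f g)"])
  show "Rep (SH (vec u) g) = SH (Rep (vec u)) (Rep g)" for u
    by (rule lin_eqI[where \<phi> = "\<lambda>g. Rep (SH (vec u) g)"])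
      (simp_all add: lin_rules_rep Rep_shuffle)
qed (simp_all add: lin_rules_rep)

definition valid_word :: "'v word \<Rightarrow> bool" where
  "valid_word w \<longleftrightarrow> (\<forall>l\<in>set w. valid l)"

lemma valid_word_simps [simp]: "valid_word []" "valid_word (l # w) \<longleftrightarrow> valid l \<and> valid_word w"
  "valid_word (u @ w) \<longleftrightarrow> valid_word u \<and> valid_word w"
  by (auto simp: valid_word_def)

lemma words_iff: "w \<in> words grade \<longleftrightarrow> w \<noteq> [] \<and> valid_word w"
  by (auto simp: words_def valid_word_def valid_def)

lemma rep_lb0: "valid x \<Longrightarrow> valid y \<Longrightarrow> rep (lb0 x y) = L.LL (rep (vec x)) (rep (vec y))"
  unfolding rep_lbn lb_rep by (simp add: lb0_def lb_def)

lemma rep_m20: "valid x \<Longrightarrow> valid y \<Longrightarrow> rep (m20 x y) = L.MM (rep (vec x)) (rep (vec y))"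
  unfolding rep_m2n m2_rep by (simp add: m20_def m2_def)

lemma Rep_shuffle_bracket: "valid_word u \<Longrightarrow> valid_word v \<Longrightarrow> Rep (shuffle_bracket lb0 u v) = L.BB (rep_word u) (rep_word v)"
proof (induction u v rule: shuffle.induct)
  case (3 x u y v)
  have "L.BB (rep_word (x # u)) (rep_word (y # v)) =
      prepend (rep (vec x)) (L.BB (rep_word u) (rep_word (y # v))) +
      prepend (rep (vec y)) (L.BB (tw (fst y) (rep_word (x # u))) (rep_word v)) +
      prepend (L.LL (rep (vec x)) (rep (vec y))) (SH (tw (fst y) (rep_word u)) (rep_word v))"
    unfolding rep_word.simps by (rule L.BB_prepend[OF rep(4)])
  then show ?case
    using 3 unfolding shuffle_bracket.simps twist_homog[OF homog_rep_word]
    by (simp add: Rep_prepend Rep_shuffle rep_lb0 del: rep_word.simps bilinear_extension_single)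
qed (simp_all del: bilinear_extension_single)

lemma Rep_merge_mu: "valid_word w \<Longrightarrow> Rep (merge_mu m20 w) = L.M (rep_word w)"
proof (induction w)
  case (Cons x w)
  have 1: "L.M (rep_word (x # w)) =
      Merge_head m2n (rep (vec x)) (rep_word w) + ks 1 (fst x) \<cdot> prepend (rep (vec x)) (L.M (rep_word w))"
    unfolding rep_word.simps by (rule L.M_prepend[OF rep(4)])
  have 2: "Rep (merge_head m20 x w) = Merge_head m2n (rep (vec x)) (rep_word w)"
  proof (cases w)
    case (Cons y v)
    then show ?thesis
      using \<open>valid_word (x # w)\<close> by (simp add: Rep_prepend rep_m20 Merge_head_prepend)
  qed simp
  show ?case unfolding 1 using Cons 2 by (simp add: Rep_prepend del: rep_word.simps)
qed simp

lemma Rep_BB: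
  assumes "\<And>u. u \<in> Poly_Mapping.keys f \<Longrightarrow> valid_word u" "\<And>v. v \<in> Poly_Mapping.keys g \<Longrightarrow> valid_word v"
  shows "Rep (BB0 f g) = L.BB (Rep f) (Rep g)"
proof (rule lin_eqI[where \<phi> = "\<lambda>f. Rep (BB0 f g)"])
  show "Rep (BB0 (vec u) g) = L.BB (Rep (vec u)) (Rep g)" if "u \<in> Poly_Mapping.keys f" for u
    by (rule lin_eqI[where \<phi> = "\<lambda>g. Rep (BB0 (vec u) g)"])
      (simp_all add: lin_rules_rep Rep_shuffle_bracket assms that)
qed (simp_all add: lin_rules_rep)

lemma Rep_M:
  assumes "\<And>u. u \<in> Poly_Mapping.keys f \<Longrightarrow> valid_word u"
  shows "Rep (M0 f) = L.M (Rep f)"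
  by (rule lin_eqI[where \<phi> = "\<lambda>f. Rep (M0 f)"]) (simp_all add: lin_rules_rep Rep_merge_mu assms)

lemma Rep_multilinear: "r \<in> multilinear_relations V grade \<Longrightarrow> Rep r = 0"
proof -
  have add: "rep_word (u @ (a, x \<oplus>\<^bsub>V\<^esub> y) # v) = rep_word (u @ (a, x) # v) + rep_word (u @ (a, y) # v)"
    if "x \<in> shift grade a" "y \<in> shift grade a" for u v a x y
    using that by (induction u) (simp_all add: rep_add)
  have scale: "rep_word (u @ (a, c \<odot>\<^bsub>V\<^esub> x) # v) = c \<cdot> rep_word (u @ (a, x) # v)"
    if "x \<in> shift grade a" for u v a x c
    using that by (induction u) (simp_all add: rep_scale)
  assume "r \<in> multilinear_relations V grade"
  then show ?thesis
    by (auto simp: multilinear_relations_def words_iff valid_def add scale)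
qed

section \<open>The kernel of the multilinear extension\<close>

abbreviation "multi_rels \<equiv> fscale.span (multilinear_relations V grade)"

lemma multi_gens:
  assumes "valid_word u" "valid_word v" "x \<in> shift grade a"
  shows "y \<in> shift grade a \<Longrightarrow> vec (u @ (a, x \<oplus>\<^bsub>V\<^esub> y) # v) - vec (u @ (a, x) # v)
      - vec (u @ (a, y) # v) \<in> multilinear_relations V grade"
    and "vec (u @ (a, c \<odot>\<^bsub>V\<^esub> x) # v) - Poly_Mapping.single (u @ (a, x) # v) c \<in> multilinear_relations V grade"
  unfolding multilinear_relations_def
   apply (rule UnI1, rule CollectI, rule exI[of _ u], rule exI[of _ v], rule exI[of _ a], rule exI[of _ x],
      rule exI[of _ y])
  subgoal using assms by (simp add: words_iff valid_def)
  apply (rule UnI2, rule CollectI, rule exI[of _ u], rule exI[of _ v], rule exI[of _ a], rule exI[of _ c],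
      rule exI[of _ x])
  subgoal using assms by (simp add: words_iff valid_def)
  done

lemma multilinear_relations_cases:
  assumes "r \<in> multilinear_relations V grade"
  obtains (add) u v a x y where "valid_word u" "valid_word v" "x \<in> shift grade a" "y \<in> shift grade a"
      "r = vec (u @ (a, x \<oplus>\<^bsub>V\<^esub> y) # v) - vec (u @ (a, x) # v) - vec (u @ (a, y) # v)"
    | (scale) u v a x c where "valid_word u" "valid_word v" "x \<in> shift grade a"
      "r = vec (u @ (a, c \<odot>\<^bsub>V\<^esub> x) # v) - Poly_Mapping.single (u @ (a, x) # v) c"
  using assms unfolding multilinear_relations_def
proof (elim UnE CollectE exE conjE, goal_cases)
  case (1 u v a x y)
  show ?case by (rule 1(1)[of u v x a y]) (use 1 in \<open>simp_all add: words_iff valid_def\<close>)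
next
  case (2 u v a c x)
  show ?case by (rule 2(2)[of u v x a c]) (use 2 in \<open>simp_all add: words_iff valid_def\<close>)
qed

lemma prepend_multi_rels:
  assumes "valid l" "r \<in> multi_rels"
  shows "prepend (vec l) r \<in> multi_rels"
  using assms(2) fscale.subspace_span lin_prepend(2)
proof (rule span_induct_lin)
  fix r assume "r \<in> multilinear_relations V grade"
  then show "prepend (vec l) r \<in> multi_rels"
  proof (cases rule: multilinear_relations_cases)
    case (add u v a x y)
    then show ?thesis
      using fscale.span_base[OF multi_gens(1)[of "l # u" v x a y]] assms(1) by (simp add: prepend_vec)
  next
    case (scale u v a x c)
    then show ?thesis
      using fscale.span_base[OF multi_gens(2)[of "l # u" v x a c]] assms(1) by (simp add: prepend_single)
  qed
qed

text \<open>The values of \<open>rep\<close> may involve invalid letters, but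
  \<open>multilinear_relations\<close> speaks of valid words only; setting invalid words to zero
  brings \<open>Rep f\<close> back to combinations of valid ones.\<close>

definition drop_invalid :: "('w \<Rightarrow> bool) \<Rightarrow> ('w \<Rightarrow>\<^sub>0 'k) \<Rightarrow> ('w \<Rightarrow>\<^sub>0 'k)" where
  "drop_invalid P = linear_extension (\<lambda>w. if P w then vec w else 0)"

lemma lin_drop_invalid [simp]: "lin (drop_invalid P)"
  by (simp add: drop_invalid_def)

lemmas drop_invalid_lin [simp] = linD[OF lin_drop_invalid]

lemma drop_invalid_vec: "drop_invalid P (vec w) = (if P w then vec w else 0)"
  by (simp add: drop_invalid_def)

lemma drop_invalid_prepend: "drop_invalid valid_word (prepend l f) = prepend (drop_invalid valid l) (drop_invalid valid_word f)"
proof (rule lin_eqI[where \<phi> = "\<lambda>l. drop_invalid valid_word (prepend l f)"])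
  show "drop_invalid valid_word (prepend (vec x) f) = prepend (drop_invalid valid (vec x)) (drop_invalid valid_word f)" for x
    by (rule lin_eqI[where \<phi> = "\<lambda>f. drop_invalid valid_word (prepend (vec x) f)"])
      (simp_all add: lin_rules lin_compose[OF lin_drop_invalid], simp add: prepend_vec drop_invalid_vec)
qed (simp_all add: lin_rules lin_compose[OF lin_drop_invalid])

text \<open>A generator of \<open>letter_rels\<close>, put in front of a valid word, is a
  multilinear relation in the first letter, or is removed as invalid.\<close>

lemma prepend_letter_rels:
  assumes "r \<in> letter_rels"
  shows "prepend (drop_invalid valid r) (drop_invalid valid_word f) \<in> multi_rels"
proof (induction f rule: poly_mapping_span_induct)
  case (4 w)
  show ?case
  proof (cases "valid_word w")
    case True
    have "(\<lambda>r. prepend (drop_invalid valid r) (vec w)) r \<in> multi_rels"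
      using assms fscale.subspace_span
    proof (rule span_induct_lin)
      show "lin (\<lambda>r. prepend (drop_invalid valid r) (vec w))"
        by (simp add: lin_rules)
      fix r assume "r \<in> letter_gens"
      then show "prepend (drop_invalid valid r) (vec w) \<in> multi_rels"
      proof cases
        case (add x a y)
        then show ?thesis
          using fscale.span_base[OF multi_gens(1)[of "[]" w x a y]] True
          by (simp add: drop_invalid_vec valid_def shift_closed prepend_vec)
      next
        case (scale x a c)
        then show ?thesis
          using fscale.span_base[OF multi_gens(2)[of "[]" w x a c]] True
          by (simp add: drop_invalid_vec valid_def shift_closed prepend_vec single_eq_fscale_vec[of "(a, x) # w" c])
      qed (simp add: drop_invalid_vec fscale.span_zero)
    qed
    then show ?thesis using True by (simp add: drop_invalid_vec)
  qed (simp add: drop_invalid_vec fscale.span_zero)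
qed (simp_all add: fscale.span_zero fscale.span_add fscale.span_scale)

text \<open>The letters are replaced by their images under \<open>rep\<close> one at a time, and
  each replacement changes the result by a multilinear relation.\<close>

lemma Rep_word_diff: "valid_word w \<Longrightarrow> drop_invalid valid_word (rep_word w) - vec w \<in> multi_rels"
proof (induction w)
  case Nil
  show ?case by (simp add: drop_invalid_vec fscale.span_zero)
next
  case (Cons l w)
  have "drop_invalid valid_word (rep_word (l # w)) - vec (l # w) =
      prepend (vec l) (drop_invalid valid_word (rep_word w) - vec w) -
      prepend (drop_invalid valid (vec l - rep (vec l))) (drop_invalid valid_word (rep_word w))"
    using Cons.prems by (simp add: drop_invalid_prepend drop_invalid_vec prepend_vec)
  also have "\<dots> \<in> multi_rels"
    using Cons.prems
    by (intro fscale.span_diff[OF prepend_multi_rels[OF _ Cons.IH] prepend_letter_rels[OF rep(3)]]) simp_all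
  finally show ?case .
qed

lemma Rep_eq_0_imp_multi_rels:
  assumes f: "\<And>w. w \<in> Poly_Mapping.keys f \<Longrightarrow> valid_word w" and "Rep f = 0"
  shows "f \<in> multi_rels"
proof -
  have "drop_invalid valid_word (Rep f) - f \<in> multi_rels"
  proof (rule poly_mapping_span_induct[where P = "\<lambda>f. drop_invalid valid_word (Rep f) - f \<in> multi_rels"])
    show "drop_invalid valid_word (Rep (f + g)) - (f + g) \<in> multi_rels"
      if "drop_invalid valid_word (Rep f) - f \<in> multi_rels" "drop_invalid valid_word (Rep g) - g \<in> multi_rels" for f g
      using fscale.span_add[OF that] by (simp add: algebra_simps)
    show "drop_invalid valid_word (Rep (c \<cdot> f)) - c \<cdot> f \<in> multi_rels"
      if "drop_invalid valid_word (Rep f) - f \<in> multi_rels" for c f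
      using fscale.span_scale[OF that, of c] by (simp add: fscale_simps)
    show "drop_invalid valid_word (Rep (vec w)) - vec w \<in> multi_rels" if "w \<in> Poly_Mapping.keys f" for w
      using Rep_word_diff[OF f[OF that]] by simp
  qed (simp add: fscale.span_zero)
  from fscale.span_neg[OF this] show ?thesis using assms(2) by simp
qed

end

section \<open>The quotient\<close>

definition keys_all :: "('w \<Rightarrow> bool) \<Rightarrow> ('w \<Rightarrow>\<^sub>0 'k::field_char_0) \<Rightarrow> bool" where
  "keys_all P f \<longleftrightarrow> (\<forall>w\<in>Poly_Mapping.keys f. P w)"

lemma keys_all_simps [simp]: "keys_all P 0" "keys_all P (vec w) \<longleftrightarrow> P w"
  by (simp_all add: keys_all_def)

lemma keys_all_add [simp]: "keys_all P f \<Longrightarrow> keys_all P g \<Longrightarrow> keys_all P (f + g)"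
  using keys_add[of f g] by (auto simp: keys_all_def)

lemma keys_all_scale [simp]: "keys_all P f \<Longrightarrow> keys_all P (c \<cdot> f)"
  using keys_fscale_subset[of c f] by (auto simp: keys_all_def)

lemma subspace_keys_all: "fscale.subspace {f. keys_all P f}"
  by (auto simp: fscale.subspace_def)

lemma keys_all_sum: "(\<And>i. i \<in> I \<Longrightarrow> keys_all P (F i)) \<Longrightarrow> keys_all P (\<Sum>i\<in>I. F i)"
  by (induction I rule: infinite_finite_induct) auto

lemma keys_all_linear_extension:
  "keys_all P f \<Longrightarrow> (\<And>w. P w \<Longrightarrow> keys_all Q (F w)) \<Longrightarrow> keys_all Q (linear_extension F f)"
  unfolding linear_extension_def by (intro keys_all_sum keys_all_scale) (auto simp: keys_all_def[of P])

lemma keys_all_mono: "keys_all P f \<Longrightarrow> (\<And>w. P w \<Longrightarrow> Q w) \<Longrightarrow> keys_all Q f"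
  by (auto simp: keys_all_def)

context gerstenhaber_algebra
begin

interpretation L: dg_letters lbn m2n by (rule dg_letters_rep)
interpretation B: homog_bracket lb0 by (rule homog_lb0)
interpretation P: homog_product m20 by (rule homog_m20)

abbreviation "\<F> \<equiv> free_space grade :: ('v word \<Rightarrow>\<^sub>0 'k) set"
abbreviation "\<S> \<equiv> relations V grade"

lemma free_iff: "f \<in> \<F> \<longleftrightarrow> keys_all (\<lambda>w. w \<noteq> [] \<and> valid_word w) f"
  by (auto simp: free_space_def keys_all_def words_iff)

lemma subspace_free: "fscale.subspace \<F>"
proof -
  have "\<F> = {f. keys_all (\<lambda>w. w \<noteq> [] \<and> valid_word w) f}"
    using free_iff by blast
  then show ?thesis using subspace_keys_all by simp
qed

lemmas free_closed = fscale.subspace_0[OF subspace_free] fscale.subspace_add[OF subspace_free]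
  fscale.subspace_scale[OF subspace_free] fscale.subspace_diff[OF subspace_free]
  fscale.subspace_neg[OF subspace_free] fscale.subspace_sum[OF subspace_free]

lemma free_valid: "f \<in> \<F> \<Longrightarrow> keys_all valid_word f"
  by (auto simp: free_iff intro: keys_all_mono)

lemma prepend_free: "valid x \<Longrightarrow> keys_all valid_word f \<Longrightarrow> prepend (vec x) f \<in> \<F>"
  unfolding free_iff by (auto simp: prepend_def intro: keys_all_linear_extension)

lemma shuffle_valid: "valid_word u \<Longrightarrow> valid_word v \<Longrightarrow> keys_all valid_word (shuffle u v :: _ \<Rightarrow>\<^sub>0 'k)"
proof (induction u v rule: shuffle.induct)
  case (3 x u y v)
  then show ?case by (auto intro!: keys_all_add keys_all_scale free_valid[OF prepend_free])
qed simp_all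

lemma shuffle_free: "u \<in> words grade \<Longrightarrow> v \<in> words grade \<Longrightarrow> shuffle u v \<in> \<F>"
  by (cases "(u, v)" rule: shuffle.cases)
    (auto simp: words_iff intro!: free_closed prepend_free shuffle_valid simp del: shuffle.simps simp add: shuffle.simps(3))

lemma valid_ops:
  "valid x \<Longrightarrow> valid y \<Longrightarrow> valid (letter_bracket br x y)"
  "valid x \<Longrightarrow> valid y \<Longrightarrow> valid (\<mu>2 V wedge x y)"
  by (auto simp: valid_def letter_bracket_def \<mu>2_def case_prod_unfold intro!: br_closed shift_closed wedge_closed)

lemma shuffle_bracket_free: "valid_word u \<Longrightarrow> valid_word v \<Longrightarrow> shuffle_bracket lb0 u v \<in> \<F>"
proof (induction u v rule: shuffle.induct)
  case (3 x u y v)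
  show ?case
    unfolding shuffle_bracket.simps lb0_def[of x y] using 3(3,4)
    by (intro free_closed(2,3) prepend_free valid_ops shuffle_valid free_valid[OF 3(1)] free_valid[OF 3(2)]) simp_all
qed (simp_all add: free_closed)

lemma merge_mu_free: "valid_word w \<Longrightarrow> merge_mu m20 w \<in> \<F>"
proof (induction w)
  case (Cons x w)
  have "merge_head m20 x w \<in> \<F>"
    using Cons.prems by (cases w) (auto intro!: free_closed(1) prepend_free valid_ops simp: m20_def)
  then show ?case
    unfolding merge_mu.simps using Cons.prems
    by (intro free_closed(2,3) prepend_free free_valid[OF Cons.IH]) simp_all
qed (simp add: free_closed)

lemma BB0_free: "f \<in> \<F> \<Longrightarrow> g \<in> \<F> \<Longrightarrow> BB0 f g \<in> \<F>"
  unfolding bilinear_extension_def free_iff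
  by (erule keys_all_linear_extension, erule keys_all_linear_extension)
    (use shuffle_bracket_free in \<open>auto simp: free_iff\<close>)

lemma M0_free: "f \<in> \<F> \<Longrightarrow> M0 f \<in> \<F>"
  unfolding free_iff by (erule keys_all_linear_extension) (use merge_mu_free in \<open>auto simp: free_iff\<close>)

lemma relations_eq: "\<S> = fscale.span (multilinear_relations V grade \<union>
    {shuffle u v | u v. u \<in> words grade \<and> v \<in> words grade})"
  by (simp add: relations_def bat_eq_shuffle)

lemma subspace_relations: "fscale.subspace \<S>"
  by (simp add: relations_eq)

lemmas relations_closed = fscale.subspace_0[OF subspace_relations] fscale.subspace_add[OF subspace_relations]
  fscale.subspace_scale[OF subspace_relations] fscale.subspace_diff[OF subspace_relations]
  fscale.subspace_neg[OF subspace_relations] fscale.subspace_sum[OF subspace_relations]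

lemma shuffle_relations: "u \<in> words grade \<Longrightarrow> v \<in> words grade \<Longrightarrow> shuffle u v \<in> \<S>"
  unfolding relations_eq by (rule fscale.span_base) auto

lemma relations_induct:
  assumes "r \<in> \<S>" "fscale.subspace T" "lin \<phi>" "\<And>r. r \<in> multilinear_relations V grade \<Longrightarrow> \<phi> r \<in> T"
    and "\<And>u v. u \<in> words grade \<Longrightarrow> v \<in> words grade \<Longrightarrow> \<phi> (shuffle u v) \<in> T"
  shows "\<phi> r \<in> T"
  using assms(1)[unfolded relations_eq] assms(2,3)
  by (rule span_induct_lin) (use assms(4,5) in auto)

lemma multilinear_free:
  assumes "r \<in> multilinear_relations V grade"
  shows "r \<in> \<F>"
  using assms
proof (cases rule: multilinear_relations_cases)
  case (add u v a x y)
  then show ?thesis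
    by (auto intro!: free_closed(4) simp: free_iff[of "vec _"] valid_def shift_closed)
next
  case (scale u v a x c)
  then show ?thesis
    by (auto intro!: free_closed(3,4) simp: free_iff[of "vec _"] valid_def shift_closed
        single_eq_fscale_vec[of "u @ (a, x) # v" c])
qed

lemma relations_free: "r \<in> \<S> \<Longrightarrow> r \<in> \<F>"
  by (rule relations_induct[where \<phi> = "\<lambda>r. r", OF _ subspace_free])
    (simp_all add: multilinear_free shuffle_free)

text \<open>The transfer principle: an identity that is exact after \<open>Rep\<close> holds in the
  quotient for the raw operations.\<close>

lemma Rep_eq_imp_relations:
  assumes "f \<in> \<F>" "g \<in> \<F>" "Rep f = Rep g"
  shows "f - g \<in> \<S>"
proof -
  have "f - g \<in> multi_rels"
    using free_valid[OF free_closed(4)[OF assms(1,2)]] assms(3)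
    by (intro Rep_eq_0_imp_multi_rels) (auto simp: keys_all_def)
  then show ?thesis
    unfolding relations_eq using fscale.span_mono by blast
qed

lemma Rep_eq_imp_mem:
  "f \<in> \<F> \<Longrightarrow> g \<in> \<S> \<Longrightarrow> Rep f = Rep g \<Longrightarrow> f \<in> \<S>"
  using Rep_eq_imp_relations[of f g] relations_closed(2)[of "f - g" g] relations_free[of g] by simp

text \<open>The elements of \<open>\<F>\<close> contain no empty word. Since that word is the unit
  of \<open>SH\<close>, admitting it would make every element a relation.\<close>

lemma SH_relations: "f \<in> \<F> \<Longrightarrow> g \<in> \<F> \<Longrightarrow> SH f g \<in> \<S>"
proof -
  assume f: "f \<in> \<F>" and g: "g \<in> \<F>"
  show "SH f g \<in> \<S>"
  proof (rule poly_mapping_span_induct[where P = "\<lambda>f. SH f g \<in> \<S>"])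
    fix u assume u: "u \<in> Poly_Mapping.keys f"
    show "SH (vec u) g \<in> \<S>"
    proof (rule poly_mapping_span_induct[where P = "\<lambda>g. SH (vec u) g \<in> \<S>"])
      fix v assume "v \<in> Poly_Mapping.keys g"
      then show "SH (vec u) (vec v) \<in> \<S>"
        using u f g by (auto simp: free_space_def intro!: shuffle_relations)
    qed (simp_all add: relations_closed)
  qed (simp_all add: relations_closed)
qed

lemma Rep_BB0: "f \<in> \<F> \<Longrightarrow> g \<in> \<F> \<Longrightarrow> Rep (BB0 f g) = L.BB (Rep f) (Rep g)"
  using free_valid[of f] free_valid[of g] by (intro Rep_BB) (auto simp: keys_all_def)

lemma Rep_M0: "f \<in> \<F> \<Longrightarrow> Rep (M0 f) = L.M (Rep f)"
  using free_valid[of f] by (intro Rep_M) (auto simp: keys_all_def)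

section \<open>Compatibility of \<mu> and the bracket with the relations\<close>

lemma vec_free: "w \<in> words grade \<Longrightarrow> vec w \<in> \<F>"
  by (simp add: free_iff words_iff)

lemma free_keysD: "f \<in> \<F> \<Longrightarrow> w \<in> Poly_Mapping.keys f \<Longrightarrow> w \<in> words grade"
  by (auto simp: free_space_def)

text \<open>Multilinear relations are annihilated by \<open>Rep\<close>; a shuffle product goes, by
  the derivation rule, to a combination of shuffle products whose factors again lie in
  \<open>\<F>\<close>.\<close>

lemma M0_relations:
  assumes "r \<in> \<S>"
  shows "M0 r \<in> \<S>"
proof (rule relations_induct[where \<phi> = M0, OF assms subspace_relations lin_linear_extension])
  fix r assume r: "r \<in> multilinear_relations V grade"
  show "M0 r \<in> \<S>"
    by (rule Rep_eq_imp_mem[OF M0_free relations_closed(1)])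
      (simp_all add: multilinear_free[OF r] Rep_M0 Rep_multilinear[OF r])
next
  fix u v assume uv: "u \<in> words grade" "v \<in> words grade"
  let ?u = "vec u :: _ \<Rightarrow>\<^sub>0 'k" and ?v = "vec v :: _ \<Rightarrow>\<^sub>0 'k"
  show "M0 (shuffle u v) \<in> \<S>"
  proof (rule Rep_eq_imp_mem)
    show "SH (M0 ?u) ?v + ks 1 (word_degree u) \<cdot> SH ?u (M0 ?v) \<in> \<S>"
      by (intro relations_closed SH_relations M0_free vec_free uv)
    show "Rep (M0 (shuffle u v)) = Rep (SH (M0 ?u) ?v + ks 1 (word_degree u) \<cdot> SH ?u (M0 ?v))"
      using uv by (simp add: Rep_M0 shuffle_free Rep_shuffle Rep_SH L.M_SH[OF homog_rep_word] Rep_merge_mu words_iff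
          del: bilinear_extension_single)
  qed (intro M0_free shuffle_free uv)
qed

lemma BB0_relations_left:
  assumes r: "r \<in> \<S>" and g: "g \<in> \<F>"
  shows "BB0 r g \<in> \<S>"
proof (rule poly_mapping_span_induct[where P = "\<lambda>g. BB0 r g \<in> \<S>"])
  fix w assume "w \<in> Poly_Mapping.keys g"
  then have w: "w \<in> words grade" using g by (rule free_keysD[rotated])
  let ?w = "vec w :: _ \<Rightarrow>\<^sub>0 'k"
  show "BB0 r ?w \<in> \<S>"
  proof (rule relations_induct[where \<phi> = "\<lambda>r. BB0 r ?w", OF r subspace_relations lin_bilinear_extension(1)])
    fix r assume r: "r \<in> multilinear_relations V grade"
    show "BB0 r ?w \<in> \<S>"
      by (rule Rep_eq_imp_mem[OF BB0_free relations_closed(1)])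
        (simp_all add: multilinear_free[OF r] Rep_BB0 Rep_multilinear[OF r] vec_free w)
  next
    fix u v assume uv: "u \<in> words grade" "v \<in> words grade"
    let ?u = "vec u :: _ \<Rightarrow>\<^sub>0 'k" and ?v = "vec v :: _ \<Rightarrow>\<^sub>0 'k"
    let ?g = "ks (word_degree v) (word_degree w) \<cdot> SH (BB0 ?u ?w) ?v + SH ?u (BB0 ?v ?w)"
    show "BB0 (shuffle u v) ?w \<in> \<S>"
    proof (rule Rep_eq_imp_mem)
      show "?g \<in> \<S>"
        by (intro relations_closed SH_relations BB0_free vec_free uv w)
      show "Rep (BB0 (shuffle u v) ?w) = Rep ?g"
        using uv w by (simp add: Rep_BB0 shuffle_free vec_free Rep_shuffle Rep_SH L.BB_SH[OF homog_rep_word homog_rep_word]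
            del: bilinear_extension_single)
    qed (intro BB0_free shuffle_free vec_free uv w)
  qed
qed (simp_all add: relations_closed)

lemma BB0_antisym:
  assumes "f \<in> \<F>" "g \<in> \<F>" "homw a f" "homw b g"
  shows "BB0 f g - (- ks a b) \<cdot> BB0 g f \<in> \<S>"
  by (rule Rep_eq_imp_relations)
    (use assms in \<open>auto intro!: free_closed BB0_free simp: Rep_BB0 fscale_simps
      L.BB_antisym[OF homog_Rep[OF assms(3)] homog_Rep[OF assms(4)]]\<close>)

lemma homog_single: "D w = d \<Longrightarrow> homog D d (Poly_Mapping.single w c)"
  by (simp add: homog_def)

lemma homog_diff: "homog D d f \<Longrightarrow> homog D d g \<Longrightarrow> homog D d (f - g)"
  using homog_add[of D d f "(-1) \<cdot> g"] homog_scale[of D d g "-1"] by simp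

lemma homog_multilinear:
  assumes "r \<in> multilinear_relations V grade"
  obtains d where "homw d r"
  using assms
proof (cases rule: multilinear_relations_cases)
  case (add u v a x y)
  then have "homw (word_degree (u @ (a, x) # v)) r"
    by (auto intro!: homog_diff homog_single)
  then show ?thesis by (rule that)
next
  case (scale u v a x c)
  then have "homw (word_degree (u @ (a, x) # v)) r"
    by (auto intro!: homog_diff homog_single)
  then show ?thesis by (rule that)
qed

text \<open>Antisymmetry moves the relation to the left argument. As it holds for homogeneous
  elements, it is applied to the generators of the relations, which are homogeneous.\<close>

lemma BB0_relations_right:
  assumes f: "f \<in> \<F>" and r: "r \<in> \<S>"
  shows "BB0 f r \<in> \<S>"
proof (rule poly_mapping_span_induct[where P = "\<lambda>f. BB0 f r \<in> \<S>"])
  fix w assume "w \<in> Poly_Mapping.keys f"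
  then have w: "vec w \<in> \<F>" using f by (intro vec_free free_keysD)
  have *: "BB0 (vec w) r \<in> \<S>" if "r \<in> \<S>" "homw d r" for r d
  proof -
    have "BB0 (vec w) r - (- ks (word_degree w) d) \<cdot> BB0 r (vec w) \<in> \<S>"
      by (rule BB0_antisym[OF w relations_free[OF that(1)] homog_vec that(2)])
    from relations_closed(2)[OF this
      relations_closed(3)[OF BB0_relations_left[OF that(1) w], of "- ks (word_degree w) d"]]
    show ?thesis by simp
  qed
  show "BB0 (vec w) r \<in> \<S>"
  proof (rule relations_induct[where \<phi> = "\<lambda>r. BB0 (vec w) r", OF r subspace_relations lin_bilinear_extension(2)])
    fix r assume r: "r \<in> multilinear_relations V grade"
    then obtain d where "homw d r" by (rule homog_multilinear)
    moreover have "r \<in> \<S>" unfolding relations_eq using r by (intro fscale.span_base) simp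
    ultimately show "BB0 (vec w) r \<in> \<S>" by (intro *)
  next
    fix u v assume "u \<in> words grade" "v \<in> words grade"
    then show "BB0 (vec w) (shuffle u v) \<in> \<S>" by (intro *[OF _ homog_shuffle] shuffle_relations)
  qed
qed (simp_all add: relations_closed)

text \<open>The generators are homogeneous, so the relations form a graded subspace; uniqueness of
  the decomposition of \<open>H\<close> into degrees rests on this.\<close>

lemma part_relations:
  assumes "r \<in> \<S>"
  shows "part word_degree d r \<in> \<S>"
proof (rule relations_induct[where \<phi> = "part word_degree d", OF assms subspace_relations lin_part])
  fix r assume r: "r \<in> multilinear_relations V grade"
  then obtain e where "homw e r" by (rule homog_multilinear)
  moreover have "r \<in> \<S>" unfolding relations_eq using r by (intro fscale.span_base) simp
  ultimately show "part word_degree d r \<in> \<S>" by (simp add: part_homog relations_closed)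
next
  fix u v assume "u \<in> words grade" "v \<in> words grade"
  then show "part word_degree d (shuffle u v) \<in> \<S>"
    by (simp add: part_homog[OF homog_shuffle] relations_closed shuffle_relations)
qed

lemma part_free: "f \<in> \<F> \<Longrightarrow> part word_degree d f \<in> \<F>"
  using keys_part[of word_degree d f] by (auto simp: free_space_def)

section \<open>Classes and the operations on them\<close>

abbreviation "cls f \<equiv> H_eq V grade `` {f}"
abbreviation "\<H> \<equiv> H V grade"

lemma H_eq_iff: "(f, g) \<in> H_eq V grade \<longleftrightarrow> f \<in> \<F> \<and> g \<in> \<F> \<and> f - g \<in> \<S>"
  by (auto simp: H_eq_def)

lemma cls_eqI: "f - g \<in> \<S> \<Longrightarrow> f \<in> \<F> \<Longrightarrow> g \<in> \<F> \<Longrightarrow> cls f = cls g"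
proof (intro equalityI subsetI)
  assume fg: "f - g \<in> \<S>" "f \<in> \<F>" "g \<in> \<F>"
  show "h \<in> cls g" if "h \<in> cls f" for h
    using relations_closed(4)[of "f - h" "f - g"] that fg by (auto simp: H_eq_iff)
  show "h \<in> cls f" if "h \<in> cls g" for h
    using relations_closed(2)[of "f - g" "g - h"] that fg by (auto simp: H_eq_iff)
qed

lemma cls_eq_iff: "f \<in> \<F> \<Longrightarrow> g \<in> \<F> \<Longrightarrow> cls f = cls g \<longleftrightarrow> f - g \<in> \<S>"
proof
  assume fg: "f \<in> \<F>" "g \<in> \<F>" and "cls f = cls g"
  moreover have "g \<in> cls g" using fg by (simp add: H_eq_iff relations_closed)
  ultimately have "g \<in> cls f" by simp
  then show "f - g \<in> \<S>" by (simp add: H_eq_iff)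
qed (rule cls_eqI)

lemma carrier_H: "carrier \<H> = cls ` \<F>"
  by (auto simp: H_def quotient_def)

text \<open>Once an operation is known to respect the relations, the union in its definition runs
  over copies of a single class.\<close>

lemma UN_cls:
  assumes "f \<in> \<F>" "\<And>f'. f' \<in> \<F> \<Longrightarrow> f - f' \<in> \<S> \<Longrightarrow> A f' = A f"
  shows "(\<Union>f'\<in>cls f. A f') = A f"
proof -
  have "f \<in> cls f" using assms(1) by (simp add: H_eq_iff relations_closed)
  moreover have "A f' = A f" if "f' \<in> cls f" for f' using that assms(2) by (simp add: H_eq_iff)
  ultimately show ?thesis by blast
qed

lemma H_add: "f \<in> \<F> \<Longrightarrow> g \<in> \<F> \<Longrightarrow> cls f \<oplus>\<^bsub>\<H>\<^esub> cls g = cls (f + g)"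
proof -
  assume fg: "f \<in> \<F>" "g \<in> \<F>"
  have "(\<Union>g'\<in>cls g. cls (f' + g')) = cls (f' + g)" if "f' \<in> \<F>" for f'
    using fg that by (intro UN_cls cls_eqI free_closed)
      (auto dest: relations_closed(5))
  then have "(\<Union>f'\<in>cls f. \<Union>g'\<in>cls g. cls (f' + g')) = (\<Union>f'\<in>cls f. cls (f' + g))"
    by (intro SUP_cong refl) (simp add: H_eq_iff)
  also have "\<dots> = cls (f + g)"
    using fg by (intro UN_cls cls_eqI free_closed) (auto dest: relations_closed(5))
  finally show ?thesis by (simp add: H_def)
qed

lemma H_smult: "f \<in> \<F> \<Longrightarrow> c \<odot>\<^bsub>\<H>\<^esub> cls f = cls (c \<cdot> f)"
proof -
  assume f: "f \<in> \<F>"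
  have "(\<Union>f'\<in>cls f. cls (c \<cdot> f')) = cls (c \<cdot> f)"
  proof (rule UN_cls[OF f])
    fix f' assume "f' \<in> \<F>" "f - f' \<in> \<S>"
    then show "cls (c \<cdot> f') = cls (c \<cdot> f)"
      using relations_closed(3)[of "f - f'" "- c"] f
      by (intro cls_eqI free_closed) (simp_all add: fscale_simps)
  qed
  then show ?thesis by (simp add: H_def)
qed

lemma H_zero: "\<zero>\<^bsub>\<H>\<^esub> = cls 0"
  by (simp add: H_def)

lemma \<mu>_word_eq: "\<mu>_word V wedge = merge_mu m20"
  by (rule ext) (simp add: mu_word_eq_merge_mu m20_def[abs_def])

lemma bracket_word_eq: "(bracket_word br :: _ \<Rightarrow> _ \<Rightarrow> _ \<Rightarrow>\<^sub>0 'k) = shuffle_bracket lb0"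
  by (intro ext) (simp add: bracket_word_eq_shuffle_bracket lb0_def[abs_def])

lemma H_\<mu>_cls: "f \<in> \<F> \<Longrightarrow> H_\<mu> V grade wedge (cls f) = cls (M0 f)"
proof -
  assume f: "f \<in> \<F>"
  show ?thesis
    unfolding H_\<mu>_def \<mu>_word_eq
  proof (rule UN_cls[OF f])
    fix f' assume "f' \<in> \<F>" "f - f' \<in> \<S>"
    then show "cls (M0 f') = cls (M0 f)"
      using relations_closed(5)[OF M0_relations[of "f - f'"]] f
      by (intro cls_eqI M0_free) simp_all
  qed
qed

lemma H_bracket_cls: "f \<in> \<F> \<Longrightarrow> g \<in> \<F> \<Longrightarrow> H_bracket V grade br (cls f) (cls g) = cls (BB0 f g)"
proof -
  assume f: "f \<in> \<F>" and g: "g \<in> \<F>"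
  have "(\<Union>g'\<in>cls g. cls (BB0 f' g')) = cls (BB0 f' g)" if f': "f' \<in> \<F>" for f'
  proof (rule UN_cls[OF g])
    fix g' assume "g' \<in> \<F>" "g - g' \<in> \<S>"
    then show "cls (BB0 f' g') = cls (BB0 f' g)"
      using relations_closed(5)[OF BB0_relations_right[OF f', of "g - g'"]] f' g
      by (intro cls_eqI BB0_free) simp_all
  qed
  then have "(\<Union>f'\<in>cls f. \<Union>g'\<in>cls g. cls (BB0 f' g')) = (\<Union>f'\<in>cls f. cls (BB0 f' g))"
    by (intro SUP_cong refl) (simp add: H_eq_iff)
  also have "\<dots> = cls (BB0 f g)"
  proof (rule UN_cls[OF f])
    fix f' assume "f' \<in> \<F>" "f - f' \<in> \<S>"
    then show "cls (BB0 f' g) = cls (BB0 f g)"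
      using relations_closed(5)[OF BB0_relations_left[of "f - f'", OF _ g]] f g
      by (intro cls_eqI BB0_free) simp_all
  qed
  finally show ?thesis by (simp add: H_bracket_def bracket_word_eq)
qed

section \<open>The quotient as a graded vector space\<close>

lemma module_H: "Module.module scalars \<H>"
proof (rule moduleI)
  show "cring (scalars :: 'k ring)" by (rule module.axioms(1)[OF module_axioms])
  show "abelian_group \<H>"
  proof (rule abelian_groupI)
    fix x assume "x \<in> carrier \<H>"
    then obtain f where f: "f \<in> \<F>" "x = cls f" by (auto simp: carrier_H)
    then show "\<exists>y\<in>carrier \<H>. y \<oplus>\<^bsub>\<H>\<^esub> x = \<zero>\<^bsub>\<H>\<^esub>"
      by (intro bexI[of _ "cls (- f)"]) (simp_all add: H_add H_zero free_closed carrier_H)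
  qed (auto simp: carrier_H H_add H_zero free_closed add_ac)
qed (auto simp: carrier_H H_add H_smult free_closed fscale_simps)

lemma H_grade_eq: "H_grade V grade d = cls ` {f \<in> \<F>. homw d f}"
  by (auto simp: H_grade_def homog_def)

lemma H_minus:
  assumes "f \<in> \<F>"
  shows "\<ominus>\<^bsub>\<H>\<^esub> cls f = cls (- f)"
proof -
  interpret H: Module.module scalars \<H> by (rule module_H)
  show ?thesis
    by (rule H.minus_equality) (use assms in \<open>auto simp: H_add H_zero free_closed carrier_H\<close>)
qed

lemma finsum_cls:
  assumes "finite I" "\<And>i. i \<in> I \<Longrightarrow> \<phi> i \<in> \<F>"
  shows "finsum \<H> (\<lambda>i. cls (\<phi> i)) I = cls (\<Sum>i\<in>I. \<phi> i)"
proof -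
  interpret H: Module.module scalars \<H> by (rule module_H)
  show ?thesis
    using assms
  proof (induction I rule: finite_induct)
    case (insert i I)
    then show ?case
      by (subst H.finsum_insert) (auto simp: carrier_H H_add free_closed)
  qed (simp add: H_zero)
qed

lemma graded_vector_space_H: "graded_vector_space \<H> (H_grade V grade)"
proof -
  interpret H: Module.module scalars \<H> by (rule module_H)
  show ?thesis
  proof (intro graded_vector_space.intro module_H graded_vector_space_axioms.intro)
    fix d
    show "submodule (H_grade V grade d) scalars \<H>"
    proof (rule H.submoduleI)
      show "\<zero>\<^bsub>\<H>\<^esub> \<in> H_grade V grade d"
        by (auto simp: H_grade_eq H_zero free_closed)
      show "\<ominus>\<^bsub>\<H>\<^esub> x \<in> H_grade V grade d" if "x \<in> H_grade V grade d" for x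
        using that homog_diff[of word_degree d 0] by (force simp: H_grade_eq H_minus free_closed)
    qed (auto simp: H_grade_eq carrier_H H_add H_smult free_closed)
  next
    fix x assume "x \<in> carrier \<H>"
    then obtain f where f: "f \<in> \<F>" "x = cls f" by (auto simp: carrier_H)
    define I where "I = word_degree ` Poly_Mapping.keys f"
    define h where "h d = cls (part word_degree d f)" for d
    have nz: "h d \<noteq> \<zero>\<^bsub>\<H>\<^esub> \<longleftrightarrow> part word_degree d f \<notin> \<S>" for d
      using f by (simp add: h_def H_zero cls_eq_iff part_free free_closed)
    have "part word_degree d f = 0" if "d \<notin> I" for d
    proof -
      have "Poly_Mapping.keys (part word_degree d f) = {}"
        using keys_part[of word_degree d f] homog_part[of word_degree d f] that
        unfolding I_def homog_def by (fastforce simp: image_iff)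
      then show ?thesis by simp
    qed
    then have sub: "{d. h d \<noteq> \<zero>\<^bsub>\<H>\<^esub>} \<subseteq> I"
      unfolding nz using relations_closed(1) by force
    have fin: "finite I" by (simp add: I_def)
    show "\<exists>!h. (\<forall>d. h d \<in> H_grade V grade d) \<and> finite {d. h d \<noteq> \<zero>\<^bsub>\<H>\<^esub>} \<and>
        x = finsum \<H> h {d. h d \<noteq> \<zero>\<^bsub>\<H>\<^esub>}"
    proof (intro ex1I[of _ h] conjI allI)
      show "h d \<in> H_grade V grade d" for d
        using f by (auto simp: h_def H_grade_eq part_free)
      show fin': "finite {d. h d \<noteq> \<zero>\<^bsub>\<H>\<^esub>}"
        using sub fin by (rule finite_subset)
      let ?K = "{d. h d \<noteq> \<zero>\<^bsub>\<H>\<^esub>}"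
      have "finsum \<H> h ?K = cls (\<Sum>d\<in>?K. part word_degree d f)"
        unfolding h_def by (rule finsum_cls[OF fin'[unfolded h_def]]) (simp add: part_free f)
      \<comment> \<open>A part of \<open>f\<close> may be a nonzero relation; its degree then lies
        in \<open>I\<close> but not in the support \<open>?K\<close>, and adding it does not change
        the class.\<close>
      also have "\<dots> = cls (\<Sum>d\<in>I. part word_degree d f)"
      proof (rule sym, rule cls_eqI)
        have "(\<Sum>d\<in>I. part word_degree d f) - (\<Sum>d\<in>?K. part word_degree d f) =
            (\<Sum>d\<in>I - ?K. part word_degree d f)"
          using fin sub by (simp add: sum_diff)
        also have "\<dots> \<in> \<S>"
          by (rule relations_closed(6)) (auto simp: nz)
        finally show "(\<Sum>d\<in>I. part word_degree d f) - (\<Sum>d\<in>?K. part word_degree d f) \<in> \<S>" .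
      qed (auto intro!: free_closed part_free f)
      also have "(\<Sum>d\<in>I. part word_degree d f) = f"
        by (rule sum_part[OF fin]) (simp add: I_def)
      finally show "x = finsum \<H> h ?K" using f by simp
    next
      fix h' assume h': "(\<forall>d. h' d \<in> H_grade V grade d) \<and> finite {d. h' d \<noteq> \<zero>\<^bsub>\<H>\<^esub>} \<and>
        x = finsum \<H> h' {d. h' d \<noteq> \<zero>\<^bsub>\<H>\<^esub>}"
      let ?K = "{d. h' d \<noteq> \<zero>\<^bsub>\<H>\<^esub>}"
      have "\<forall>d. \<exists>g. g \<in> \<F> \<and> homw d g \<and> h' d = cls g"
        using h' by (auto simp: H_grade_eq image_iff)
      then obtain g where g: "\<And>d. g d \<in> \<F>" "\<And>d. homw d (g d)" "\<And>d. h' d = cls (g d)"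
        by metis
      have "h' = (\<lambda>d. cls (g d))" using g(3) by blast
      then have "cls f = cls (\<Sum>d\<in>?K. g d)"
        using h' f finsum_cls[of ?K g] g(1) by simp
      then have S: "f - (\<Sum>d\<in>?K. g d) \<in> \<S>"
        using f g(1) by (simp add: cls_eq_iff free_closed)
      \<comment> \<open>Taking the part of degree \<open>d\<close> in the relation \<open>S\<close>
        isolates the homogeneous representative \<open>g d\<close>.\<close>
      show "h' = h"
      proof
        fix d
        have "part word_degree d (\<Sum>e\<in>?K. g e) = (\<Sum>e\<in>?K. if e = d then g d else 0)"
          unfolding lin_sum[OF lin_part] by (intro sum.cong refl) (auto simp: part_homog[OF g(2)])
        also have "\<dots> = (if d \<in> ?K then g d else 0)" using h' by simp
        finally have P: "part word_degree d f - (if d \<in> ?K then g d else 0) \<in> \<S>"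
          using part_relations[OF S, of d] by simp
        show "h' d = h d"
        proof (cases "d \<in> ?K")
          case True
          then have "cls (part word_degree d f) = cls (g d)"
            using P f g(1) by (intro cls_eqI part_free) simp_all
          then show ?thesis by (simp add: h_def g(3))
        next
          case False
          then have "cls (part word_degree d f) = cls 0"
            using P f by (intro cls_eqI part_free free_closed) simp_all
          then show ?thesis using False by (simp add: h_def H_zero)
        qed
      qed
    qed
  qed
qed

section \<open>The differential graded Lie algebra\<close>

lemma homog_BB0: "homw a f \<Longrightarrow> homw b g \<Longrightarrow> homw (a + b) (BB0 f g)"
  by (rule B.homog_BB)

lemma homog_M0: "homw a f \<Longrightarrow> homw (a + 1) (M0 f)"
  by (rule P.homog_M)

lemma powi_eq_ks: "(-1 :: 'k) powi a = ks 1 a" "(-1 :: 'k) powi (a * b) = ks a b"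
  by (simp_all add: ks_def)

lemma graded_lie_algebra_H: "graded_lie_algebra \<H> (H_grade V grade) (H_bracket V grade br)"
proof (intro graded_lie_algebra.intro graded_vector_space_H graded_lie_algebra_axioms.intro)
  show "bilinear_operation \<H> (H_bracket V grade br)"
    unfolding bilinear_operation_def linear_operator_def carrier_H
    by (auto simp: H_bracket_cls H_add H_smult BB0_free free_closed)
next
  fix x y a b assume "x \<in> H_grade V grade a" "y \<in> H_grade V grade b"
  then obtain f g where f: "f \<in> \<F>" "homw a f" "x = cls f" and g: "g \<in> \<F>" "homw b g" "y = cls g"
    by (auto simp: H_grade_eq)
  show "H_bracket V grade br x y \<in> H_grade V grade (a + b)"
    using f g by (auto simp: H_bracket_cls H_grade_eq BB0_free homog_BB0)
  have "cls (BB0 f g) = cls ((- ks a b) \<cdot> BB0 g f)"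
    by (rule cls_eqI[OF BB0_antisym]) (use f g in \<open>auto intro!: free_closed BB0_free\<close>)
  then show "H_bracket V grade br x y = (- ((-1) powi (a * b))) \<odot>\<^bsub>\<H>\<^esub> H_bracket V grade br y x"
    unfolding powi_eq_ks(2) using f g by (simp add: H_bracket_cls H_smult BB0_free)
next
  fix x y z a b c
  assume "x \<in> H_grade V grade a" "y \<in> H_grade V grade b" "z \<in> H_grade V grade c"
  then obtain f g h where f: "f \<in> \<F>" "homw a f" "x = cls f" and g: "g \<in> \<F>" "homw b g" "y = cls g"
    and h: "h \<in> \<F>" "homw c h" "z = cls h"
    by (auto simp: H_grade_eq)
  have "cls (ks a c \<cdot> BB0 (BB0 f g) h + ks b a \<cdot> BB0 (BB0 g h) f + ks c b \<cdot> BB0 (BB0 h f) g) = cls 0"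
  proof (rule cls_eqI[OF Rep_eq_imp_relations])
    show "Rep (ks a c \<cdot> BB0 (BB0 f g) h + ks b a \<cdot> BB0 (BB0 g h) f + ks c b \<cdot> BB0 (BB0 h f) g) = Rep 0"
      using L.jacobi[OF homog_Rep[OF f(2)] homog_Rep[OF g(2)] homog_Rep[OF h(2)]] f g h
      by (simp add: Rep_BB0 BB0_free)
  qed (use f g h in \<open>auto intro!: free_closed BB0_free\<close>)
  then show "(-1) powi (a * c) \<odot>\<^bsub>\<H>\<^esub> H_bracket V grade br (H_bracket V grade br x y) z
      \<oplus>\<^bsub>\<H>\<^esub> (-1) powi (b * a) \<odot>\<^bsub>\<H>\<^esub> H_bracket V grade br (H_bracket V grade br y z) x
      \<oplus>\<^bsub>\<H>\<^esub> (-1) powi (c * b) \<odot>\<^bsub>\<H>\<^esub> H_bracket V grade br (H_bracket V grade br z x) y = \<zero>\<^bsub>\<H>\<^esub>"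
    unfolding powi_eq_ks(2) using f g h
    by (simp add: H_bracket_cls H_smult H_add H_zero BB0_free free_closed)
qed

lemma dg_lie_algebra_H:
  "dg_lie_algebra \<H> (H_grade V grade) (H_bracket V grade br) (H_\<mu> V grade wedge)"
proof (intro dg_lie_algebra.intro graded_lie_algebra_H dg_lie_algebra_axioms.intro)
  show "linear_operator \<H> (H_\<mu> V grade wedge)"
    unfolding linear_operator_def carrier_H
    by (auto simp: H_\<mu>_cls H_add H_smult M0_free free_closed)
next
  fix x a assume "x \<in> H_grade V grade a"
  then obtain f where f: "f \<in> \<F>" "homw a f" "x = cls f"
    by (auto simp: H_grade_eq)
  then show "H_\<mu> V grade wedge x \<in> H_grade V grade (a + 1)"
    by (auto simp: H_\<mu>_cls H_grade_eq M0_free homog_M0)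
next
  fix x assume "x \<in> carrier \<H>"
  then obtain f where f: "f \<in> \<F>" "x = cls f" by (auto simp: carrier_H)
  have "cls (M0 (M0 f)) = cls 0"
    by (rule cls_eqI[OF Rep_eq_imp_relations])
      (use f in \<open>auto intro!: free_closed M0_free simp: Rep_M0 M0_free L.M_M\<close>)
  then show "H_\<mu> V grade wedge (H_\<mu> V grade wedge x) = \<zero>\<^bsub>\<H>\<^esub>"
    using f by (simp add: H_\<mu>_cls M0_free H_zero)
next
  fix x y a b assume "x \<in> H_grade V grade a" "y \<in> H_grade V grade b"
  then obtain f g where f: "f \<in> \<F>" "homw a f" "x = cls f" and g: "g \<in> \<F>" "homw b g" "y = cls g"
    by (auto simp: H_grade_eq)
  have "cls (M0 (BB0 f g)) = cls (BB0 (M0 f) g + ks 1 a \<cdot> BB0 f (M0 g))"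
  proof (rule cls_eqI[OF Rep_eq_imp_relations])
    show "Rep (M0 (BB0 f g)) = Rep (BB0 (M0 f) g + ks 1 a \<cdot> BB0 f (M0 g))"
      using f g by (simp add: Rep_M0 Rep_BB0 BB0_free M0_free L.M_BB[OF homog_Rep[OF f(2)]])
  qed (use f g in \<open>auto intro!: free_closed BB0_free M0_free\<close>)
  then show "H_\<mu> V grade wedge (H_bracket V grade br x y) =
      H_bracket V grade br (H_\<mu> V grade wedge x) y
      \<oplus>\<^bsub>\<H>\<^esub> (-1) powi a \<odot>\<^bsub>\<H>\<^esub> H_bracket V grade br x (H_\<mu> V grade wedge y)"
    unfolding powi_eq_ks(1) using f g
    by (simp add: H_\<mu>_cls H_bracket_cls H_smult H_add BB0_free M0_free free_closed)
qed

end

theorem mainTheorem3: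
  fixes V :: "('k::field_char_0, 'v) module"
    and grade :: "int \<Rightarrow> 'v set"
    and wedge br :: "'v \<Rightarrow> 'v \<Rightarrow> 'v"
  assumes "gerstenhaber_algebra V grade wedge br"
  shows "dg_lie_algebra (H V grade) (H_grade V grade) (H_bracket V grade br) (H_\<mu> V grade wedge)"
  using gerstenhaber_algebra.dg_lie_algebra_H[OF assms] .

end
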